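(* Consider the discretized gPC optimal control problem and the gPC-DDP algorithm described in the context. Suppose that: (i) the dynamics and cost functions of the problem are differentiable up to the third order over a compact convex set $\mathcal R\subset\mathbb R^{\mathbf n+m}$; (ii) $(\mathbf X(t_k),u(t_k))\in\mathcal R$ for all $t_k\in[t_0,t_f]$; (iii) $Q_{uu}^k$ remains positive definite for all time instants $k$ and all iterations of gPC-DDP. Let $U^*=((u^{*0})^\top,(u^{*1})^\top,\dots)^\top$ denote the stationary point gPC-DDP converges to, and let $U^{(l)}$ denote the control sequence obtained at iteration $l$. Then there exists $c>0$ such that, for all $l$ large enough, $$\|U^{(l)}-U^*\|\le c\,\|U^{(l-1)}-U^*\|^2 .$$ Therefore, the convergence rate is locally quadratic.
   Context: Problem. An uncertain system $\dot x=f(x,u,t;\lambda^p)$, $x\in\mathbb R^n$, $u\in\mathbb R^m$ (deterministic control), with random parameters and random initial state depending on a random vector $\xi$ with support $\mathcal D$ and density $\rho$, is represented by the truncated expansion $x_i(t)=\sum_{j=0}^K x_{ij}(t)\phi_j(\xi)$, where the polynomials $\phi_j$ are orthogonal with respect to $\rho$ and $\langle\phi_j,\phi_j\rangle=\int_{\mathcal D}\phi_j^2\rho\,\mathrm d\xi$. Galerkin projection gives the deterministic system $\dot{\mathbf X}=\mathbf f(\mathbf X,u,t)$ for $\mathbf X=(x_{10},\dots,x_{1K},\dots,x_{nK})^\top\in\mathbb R^{\mathbf n}$, $\mathbf n=n(K+1)$, whose component associated with $x_{ij}$ is $\dot x_{ij}=\langle\phi_j,\phi_j\rangle^{-1}\int_{\mathcal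 D}f_i(x(t,\xi),u,t,\xi)\phi_j(\xi)\rho(\xi)\,\mathrm d\xi$. The problem is to minimize over $u$ the cost $\int_{t_0}^{t_f}\boldsymbol L(\mathbf X,u,t)\,\mathrm dt+\boldsymbol F(\mathbf X(t_f),t_f)$ subject to these dynamics and a fixed initial state $\mathbf X^0$. Discrete form. With time step $\Delta t$, $K_f$ steps and superscript $k$ denoting evaluation at $t_k$ (so $t_{K_f}=t_f$), the dynamics are $\mathbf X^{k+1}=\mathbf f^k(\mathbf X^k,u^k)$, where $\mathbf f^k$ is a one-step discretization of $\dot{\mathbf X}=\mathbf f$ (e.g. Euler: $\mathbf f^k(\mathbf X,u)=\mathbf X+\Delta t\,\mathbf f(\mathbf X,u,t_k)$). The total cost is $\boldsymbol J=\sum_{k=0}^{K_f-1}\boldsymbol L^k(\mathbf X^k,u^k)+\boldsymbol F(\mathbf X^{K_f})$ with $\boldsymbol L^k=\boldsymbol L(\mathbf X^k,u^k,t_k)\Delta t$. A control sequence is $U=((u^0)^\top,\dots,(u^{K_f-1})^\top)^\top$. A stationary point is a control sequence at which the gradient of $\boldsymbol J$ with respect to $U$ (states eliminated through the dynamics) vanishes. gPC-DDP iteration. Given the nominal controls $\bar U=U^{(l-1)}$ and the corresponding nominal states $\overline{\mathbf X}$ (obtained by propagating the discrete dynamics from $\mathbf X^0$), evaluate all derivatives along the nominal trajectory; subscripts denote partial derivatives, $\Theta^k=\nabla_{\mathbf x}\mathbf f^k$, $B^k=\nabla_u\mathbf f^k$, and $[\cdot]_i$ is the $i$-th component. Set $V_{\mathbf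 x}^{K_f}=\boldsymbol F_{\mathbf x}$, $V_{\mathbf{xx}}^{K_f}=\boldsymbol F_{\mathbf{xx}}$ and, for $k=K_f-1,\dots,0$, $Q_{\mathbf x}^k=\boldsymbol L_{\mathbf x}^k+(\Theta^k)^\top V_{\mathbf x}^{k+1}$, $Q_u^k=\boldsymbol L_u^k+(B^k)^\top V_{\mathbf x}^{k+1}$, $Q_{\mathbf{xx}}^k=\boldsymbol L_{\mathbf{xx}}^k+(\Theta^k)^\top V_{\mathbf{xx}}^{k+1}\Theta^k+\sum_{i}[V_{\mathbf x}^{k+1}]_i\nabla_{\mathbf{xx}}[\mathbf f^k]_i$, $Q_{\mathbf xu}^k=(Q_{u\mathbf x}^k)^\top=\boldsymbol L_{\mathbf xu}^k+(\Theta^k)^\top V_{\mathbf{xx}}^{k+1}B^k+\sum_{i}[V_{\mathbf x}^{k+1}]_i\nabla_{\mathbf xu}[\mathbf f^k]_i$, $Q_{uu}^k=\boldsymbol L_{uu}^k+(B^k)^\top V_{\mathbf{xx}}^{k+1}B^k+\sum_{i}[V_{\mathbf x}^{k+1}]_i\nabla_{uu}[\mathbf f^k]_i$, $\ell^k=-(Q_{uu}^k)^{-1}Q_u^k$, $\Sigma^k=-(Q_{uu}^k)^{-1}Q_{u\mathbf x}^k$, $V_{\mathbf x}^k=Q_{\mathbf x}^k+(\Sigma^k)^\top Q_{uu}^k\ell^k+(\Sigma^k)^\top Q_u^k+Q_{\mathbf xu}^k\ell^k$, $V_{\mathbf{xx}}^k=Q_{\mathbf{xx}}^k+(\Sigma^k)^\top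 Q_{uu}^k\Sigma^k+(\Sigma^k)^\top Q_{u\mathbf x}^k+Q_{\mathbf xu}^k\Sigma^k$. Then, starting from the fixed initial state (so $\delta\mathbf X^0=0$), the new controls are computed forward in time by $u^k=\bar u^k+\gamma\ell^k+\Sigma^k\delta\mathbf X^k$, where $\delta\mathbf X^k=\mathbf X^k-\overline{\mathbf X}^k$ and $\mathbf X^{k+1}=\mathbf f^k(\mathbf X^k,u^k)$. The line-search parameter $\gamma\in(0,1]$ is initialized at $1$ in each iteration and is reduced until the total cost $\boldsymbol J$ is decreased. The resulting control sequence is $U^{(l)}$. The procedure is repeated until convergence.
   Formalization: Positive definiteness of Q_uu^k is assumed also at the limit U*, not only at all iterations; otherwise the claim fails: for one step with cost u^4, Q_uu=12u^2>0 at every iterate, but the full steps u -> 2u/3 converge only linearly. *)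

theory Defs
  imports "HOL-Analysis.Analysis" "HOL-Probability.Probability"
begin

section \<open>Calculus and matrix notions\<close>

text \<open>Every order of differentiability below the last one is required in a neighbourhood of the
  point, since the next derivative makes no sense otherwise. In finite dimension a derivative is
  differentiable iff all its directional components are.\<close>

fun times_differentiable_at ::
    "nat \<Rightarrow> ('a::euclidean_space \<Rightarrow> 'b::real_normed_vector) \<Rightarrow> 'a \<Rightarrow> bool" where
  "times_differentiable_at 0 f z \<longleftrightarrow> True"
| "times_differentiable_at (Suc 0) f z \<longleftrightarrow> f differentiable (at z)"
| "times_differentiable_at (Suc (Suc n)) f z \<longleftrightarrow>
     (\<forall>\<^sub>F y in nhds z. f differentiable (at y)) \<and>
     (\<forall>v. times_differentiable_at (Suc n) (\<lambda>y. frechet_derivative f (at y) v) z)"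

definition grad :: "(real^'a \<Rightarrow> real) \<Rightarrow> real^'a \<Rightarrow> real^'a" where
  "grad g x = (\<chi> i. frechet_derivative g (at x) (axis i 1))"

definition hess :: "(real^'a \<Rightarrow> real) \<Rightarrow> real^'a \<Rightarrow> real^'a^'a" where
  "hess g x = jacobian (grad g) (at x)"

text \<open>Mixed second derivatives: row \<open>i\<close>, column \<open>j\<close> is the derivative with respect to \<open>x\<^sub>i\<close> and \<open>u\<^sub>j\<close>.\<close>

definition hess_xu :: "(real^'a \<Rightarrow> real^'m \<Rightarrow> real) \<Rightarrow> real^'a \<Rightarrow> real^'m \<Rightarrow> real^'m^'a" where
  "hess_xu g x u = jacobian (\<lambda>w. grad (\<lambda>y. g y w) x) (at u)"

definition pos_def :: "real^'a^'a \<Rightarrow> bool" where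
  "pos_def A \<longleftrightarrow> (\<forall>v. v \<noteq> 0 \<longrightarrow> v \<bullet> (A *v v) > 0)"


section \<open>Generalized polynomial chaos\<close>

definition support :: "'a::topological_space measure \<Rightarrow> 'a set" where
  "support \<mu> = {z. \<forall>S. open S \<and> z \<in> S \<longrightarrow> emeasure \<mu> S > 0}"

definition random_vector_with_density ::
    "'w measure \<Rightarrow> ('w \<Rightarrow> real^'d) \<Rightarrow> (real^'d) set \<Rightarrow> (real^'d \<Rightarrow> real) \<Rightarrow> bool" where
  "random_vector_with_density M \<xi> D \<rho> \<longleftrightarrow>
     prob_space M \<and> (\<forall>z. \<rho> z \<ge> 0) \<and> distributed M lborel \<xi> (\<lambda>z. ennreal (\<rho> z)) \<and>
     D = support (distr M borel \<xi>)"

definition weighted_inner ::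
    "(real^'d) set \<Rightarrow> (real^'d \<Rightarrow> real) \<Rightarrow> (real^'d \<Rightarrow> real) \<Rightarrow> (real^'d \<Rightarrow> real) \<Rightarrow> real" where
  "weighted_inner D \<rho> g h = (LINT z:D|lborel. g z * h z * \<rho> z)"

text \<open>The finite type \<open>'k\<close> stands for the index set \<open>{0..K}\<close>.\<close>

definition orthogonal_polynomials ::
    "(real^'d) set \<Rightarrow> (real^'d \<Rightarrow> real) \<Rightarrow> ('k \<Rightarrow> real^'d \<Rightarrow> real) \<Rightarrow> bool" where
  "orthogonal_polynomials D \<rho> \<phi> \<longleftrightarrow>
     (\<forall>j. real_polynomial_function (\<phi> j)) \<and>
     (\<forall>i j. set_integrable lborel D (\<lambda>z. \<phi> i z * \<phi> j z * \<rho> z)) \<and>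
     (\<forall>j. weighted_inner D \<rho> (\<phi> j) (\<phi> j) > 0) \<and>
     (\<forall>i j. i \<noteq> j \<longrightarrow> weighted_inner D \<rho> (\<phi> i) (\<phi> j) = 0)"

text \<open>The stacked vector of expansion coefficients \<open>x\<^sub>i\<^sub>j\<close> has the index type \<open>'n \<times> 'k\<close>.\<close>

definition gpc_expansion ::
    "('k::finite \<Rightarrow> real^'d \<Rightarrow> real) \<Rightarrow> real^('n::finite \<times> 'k) \<Rightarrow> real^'d \<Rightarrow> real^'n" where
  "gpc_expansion \<phi> X z = (\<chi> i. \<Sum>j\<in>UNIV. X $ (i, j) * \<phi> j z)"

definition galerkin_field ::
    "(real^'d) set \<Rightarrow> (real^'d \<Rightarrow> real) \<Rightarrow> ('k::finite \<Rightarrow> real^'d \<Rightarrow> real) \<Rightarrow>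
     (real^'n \<Rightarrow> real^'m \<Rightarrow> real \<Rightarrow> real^'d \<Rightarrow> real^'n) \<Rightarrow>
     real^('n::finite \<times> 'k) \<Rightarrow> real^'m \<Rightarrow> real \<Rightarrow> real^('n \<times> 'k)" where
  "galerkin_field D \<rho> \<phi> f X u t =
     (\<chi> ij. case ij of (i, j) \<Rightarrow> inverse (weighted_inner D \<rho> (\<phi> j) (\<phi> j)) *
        (LINT z:D|lborel. f (gpc_expansion \<phi> X z) u t z $ i * \<phi> j z * \<rho> z))"

text \<open>A one-step method maps a vector field \<open>G\<close>, a step size \<open>h\<close> and a time \<open>t\<close> to the discrete
  transition over one step (with the control held fixed); it has to be consistent for
  fields that are continuous and locally Lipschitz in the state.\<close>

definition one_step_method ::
    "(('x::real_normed_vector \<Rightarrow> 'u::topological_space \<Rightarrow> real \<Rightarrow> 'x) \<Rightarrow>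
      real \<Rightarrow> real \<Rightarrow> 'x \<Rightarrow> 'u \<Rightarrow> 'x) \<Rightarrow> bool" where
  "one_step_method \<Phi> \<longleftrightarrow>
     (\<forall>G. continuous_on UNIV (\<lambda>(x, u, t). G x u t) \<and>
          (\<forall>u. local_lipschitz UNIV UNIV (\<lambda>t x. G x u t)) \<longrightarrow>
          (\<forall>x u t. ((\<lambda>h. (\<Phi> G h t x u - x) /\<^sub>R h) \<longlongrightarrow> G x u t) (at_right 0)))"

definition explicit_euler ::
    "('x::real_normed_vector \<Rightarrow> 'u::topological_space \<Rightarrow> real \<Rightarrow> 'x) \<Rightarrow>
     real \<Rightarrow> real \<Rightarrow> 'x \<Rightarrow> 'u \<Rightarrow> 'x" where
  "explicit_euler G h t x u = x + h *\<^sub>R G x u t"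

lemma one_step_method_explicit_euler: "one_step_method explicit_euler"
  unfolding one_step_method_def
proof (intro allI impI)
  fix G :: "'x::real_normed_vector \<Rightarrow> 'u::topological_space \<Rightarrow> real \<Rightarrow> 'x" and x u t
  have "\<forall>\<^sub>F h in at_right 0. G x u t = (explicit_euler G h t x u - x) /\<^sub>R h"
    by (auto simp: explicit_euler_def eventually_at_filter)
  then show "((\<lambda>h. (explicit_euler G h t x u - x) /\<^sub>R h) \<longlongrightarrow> G x u t) (at_right 0)"
    by (rule tendsto_eventually[OF eventually_mono]) simp
qed


section \<open>Discrete-time optimal control problems\<close>

record ('x, 'u) ocp =
  steps :: nat
  init_state :: 'x
  dyn :: "nat \<Rightarrow> 'x \<Rightarrow> 'u \<Rightarrow> 'x"
  stage_cost :: "nat \<Rightarrow> 'x \<Rightarrow> 'u \<Rightarrow> real"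
  final_cost :: "'x \<Rightarrow> real"

definition gpc_ocp ::
    "(real^'d) set \<Rightarrow> (real^'d \<Rightarrow> real) \<Rightarrow> ('k::finite \<Rightarrow> real^'d \<Rightarrow> real) \<Rightarrow>
     (real^'n \<Rightarrow> real^'m \<Rightarrow> real \<Rightarrow> real^'d \<Rightarrow> real^'n) \<Rightarrow>
     ((real^('n::finite \<times> 'k) \<Rightarrow> real^'m \<Rightarrow> real \<Rightarrow> real^('n \<times> 'k)) \<Rightarrow>
        real \<Rightarrow> real \<Rightarrow> real^('n \<times> 'k) \<Rightarrow> real^'m \<Rightarrow> real^('n \<times> 'k)) \<Rightarrow>
     real \<Rightarrow> real \<Rightarrow> nat \<Rightarrow> real^('n \<times> 'k) \<Rightarrow>
     (real^('n \<times> 'k) \<Rightarrow> real^'m \<Rightarrow> real \<Rightarrow> real) \<Rightarrow> (real^('n \<times> 'k) \<Rightarrow> real \<Rightarrow> real) \<Rightarrow>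
     (real^('n \<times> 'k), real^'m) ocp" where
  "gpc_ocp D \<rho> \<phi> f \<Phi> t0 \<Delta>t Kf X0 L F =
     \<lparr>steps = Kf,
      init_state = X0,
      dyn = (\<lambda>k X u. \<Phi> (galerkin_field D \<rho> \<phi> f) \<Delta>t (t0 + real k * \<Delta>t) X u),
      stage_cost = (\<lambda>k X u. L X u (t0 + real k * \<Delta>t) * \<Delta>t),
      final_cost = (\<lambda>X. F X (t0 + real Kf * \<Delta>t))\<rparr>"

text \<open>A control sequence is a function on \<open>nat\<close> of which only the values at \<open>k < steps P\<close> matter.\<close>

primrec states :: "('x, 'u) ocp \<Rightarrow> (nat \<Rightarrow> 'u) \<Rightarrow> nat \<Rightarrow> 'x" where
  "states P U 0 = init_state P"
| "states P U (Suc k) = dyn P k (states P U k) (U k)"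

definition total_cost :: "('x, 'u) ocp \<Rightarrow> (nat \<Rightarrow> 'u) \<Rightarrow> real" where
  "total_cost P U = (\<Sum>k<steps P. stage_cost P k (states P U k) (U k))
                    + final_cost P (states P U (steps P))"

text \<open>Euclidean norm of the stacked vector of the first \<open>N\<close> controls.\<close>

definition control_norm :: "nat \<Rightarrow> (nat \<Rightarrow> 'u::real_normed_vector) \<Rightarrow> real" where
  "control_norm N U = L2_set (\<lambda>k. norm (U k)) {..<N}"

definition stationary_point :: "('x, 'u::real_inner) ocp \<Rightarrow> (nat \<Rightarrow> 'u) \<Rightarrow> bool" where
  "stationary_point P U \<longleftrightarrow>
     (\<forall>k<steps P. GDERIV (\<lambda>v. total_cost P (U(k := v))) (U k) :> 0)"


section \<open>The gPC-DDP iteration\<close>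

definition Theta :: "(real^'a, real^'m) ocp \<Rightarrow> (nat \<Rightarrow> real^'m) \<Rightarrow> nat \<Rightarrow> real^'a^'a" where
  "Theta P U k = jacobian (\<lambda>x. dyn P k x (U k)) (at (states P U k))"

definition Bmat :: "(real^'a, real^'m) ocp \<Rightarrow> (nat \<Rightarrow> real^'m) \<Rightarrow> nat \<Rightarrow> real^'m^'a" where
  "Bmat P U k = jacobian (\<lambda>u. dyn P k (states P U k) u) (at (U k))"

text \<open>In the following, \<open>p\<close> and \<open>W\<close> stand for the gradient and the Hessian of the value function
  at stage \<open>k + 1\<close>.\<close>

definition Qx_of :: "(real^'a, real^'m) ocp \<Rightarrow> (nat \<Rightarrow> real^'m) \<Rightarrow> nat \<Rightarrow> real^'a \<Rightarrow> real^'a" where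
  "Qx_of P U k p = grad (\<lambda>x. stage_cost P k x (U k)) (states P U k)
                   + transpose (Theta P U k) *v p"

definition Qu_of :: "(real^'a, real^'m) ocp \<Rightarrow> (nat \<Rightarrow> real^'m) \<Rightarrow> nat \<Rightarrow> real^'a \<Rightarrow> real^'m" where
  "Qu_of P U k p = grad (\<lambda>u. stage_cost P k (states P U k) u) (U k)
                   + transpose (Bmat P U k) *v p"

definition Qxx_of ::
    "(real^'a, real^'m) ocp \<Rightarrow> (nat \<Rightarrow> real^'m) \<Rightarrow> nat \<Rightarrow> real^'a \<Rightarrow> real^'a^'a \<Rightarrow> real^'a^'a" where
  "Qxx_of P U k p W = hess (\<lambda>x. stage_cost P k x (U k)) (states P U k)
     + transpose (Theta P U k) ** W ** Theta P U k
     + (\<Sum>i\<in>UNIV. (p $ i) *\<^sub>R hess (\<lambda>x. dyn P k x (U k) $ i) (states P U k))"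

definition Qxu_of ::
    "(real^'a, real^'m) ocp \<Rightarrow> (nat \<Rightarrow> real^'m) \<Rightarrow> nat \<Rightarrow> real^'a \<Rightarrow> real^'a^'a \<Rightarrow> real^'m^'a" where
  "Qxu_of P U k p W = hess_xu (stage_cost P k) (states P U k) (U k)
     + transpose (Theta P U k) ** W ** Bmat P U k
     + (\<Sum>i\<in>UNIV. (p $ i) *\<^sub>R hess_xu (\<lambda>x u. dyn P k x u $ i) (states P U k) (U k))"

definition Quu_of ::
    "(real^'a, real^'m) ocp \<Rightarrow> (nat \<Rightarrow> real^'m) \<Rightarrow> nat \<Rightarrow> real^'a \<Rightarrow> real^'a^'a \<Rightarrow> real^'m^'m" where
  "Quu_of P U k p W = hess (\<lambda>u. stage_cost P k (states P U k) u) (U k)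
     + transpose (Bmat P U k) ** W ** Bmat P U k
     + (\<Sum>i\<in>UNIV. (p $ i) *\<^sub>R hess (\<lambda>u. dyn P k (states P U k) u $ i) (U k))"

definition ell_of ::
    "(real^'a, real^'m) ocp \<Rightarrow> (nat \<Rightarrow> real^'m) \<Rightarrow> nat \<Rightarrow> real^'a \<Rightarrow> real^'a^'a \<Rightarrow> real^'m" where
  "ell_of P U k p W = - (matrix_inv (Quu_of P U k p W) *v Qu_of P U k p)"

definition Sigma_of ::
    "(real^'a, real^'m) ocp \<Rightarrow> (nat \<Rightarrow> real^'m) \<Rightarrow> nat \<Rightarrow> real^'a \<Rightarrow> real^'a^'a \<Rightarrow> real^'a^'m" where
  "Sigma_of P U k p W = - (matrix_inv (Quu_of P U k p W) ** transpose (Qxu_of P U k p W))"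

text \<open>The backward recursion for the gradient and the Hessian of the value function, indexed by the
  number \<open>s\<close> of remaining stages, that is, at stage \<open>steps P - s\<close>.\<close>

primrec value_expansion ::
    "(real^'a, real^'m) ocp \<Rightarrow> (nat \<Rightarrow> real^'m) \<Rightarrow> nat \<Rightarrow> (real^'a) \<times> (real^'a^'a)" where
  "value_expansion P U 0 =
     (grad (final_cost P) (states P U (steps P)), hess (final_cost P) (states P U (steps P)))"
| "value_expansion P U (Suc s) =
     (let k = steps P - Suc s;
          p = fst (value_expansion P U s);
          W = snd (value_expansion P U s);
          Qx = Qx_of P U k p; Qu = Qu_of P U k p;
          Qxx = Qxx_of P U k p W; Qxu = Qxu_of P U k p W; Quu = Quu_of P U k p W;
          l = ell_of P U k p W; S = Sigma_of P U k p W
      in (Qx + transpose S *v (Quu *v l) + transpose S *v Qu + Qxu *v l,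
          Qxx + transpose S ** Quu ** S + transpose S ** transpose Qxu + Qxu ** S))"

definition Vx :: "(real^'a, real^'m) ocp \<Rightarrow> (nat \<Rightarrow> real^'m) \<Rightarrow> nat \<Rightarrow> real^'a" where
  "Vx P U k = fst (value_expansion P U (steps P - k))"

definition Vxx :: "(real^'a, real^'m) ocp \<Rightarrow> (nat \<Rightarrow> real^'m) \<Rightarrow> nat \<Rightarrow> real^'a^'a" where
  "Vxx P U k = snd (value_expansion P U (steps P - k))"

definition Quu :: "(real^'a, real^'m) ocp \<Rightarrow> (nat \<Rightarrow> real^'m) \<Rightarrow> nat \<Rightarrow> real^'m^'m" where
  "Quu P U k = Quu_of P U k (Vx P U (Suc k)) (Vxx P U (Suc k))"

definition ell :: "(real^'a, real^'m) ocp \<Rightarrow> (nat \<Rightarrow> real^'m) \<Rightarrow> nat \<Rightarrow> real^'m" where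
  "ell P U k = ell_of P U k (Vx P U (Suc k)) (Vxx P U (Suc k))"

definition Sigma_gain :: "(real^'a, real^'m) ocp \<Rightarrow> (nat \<Rightarrow> real^'m) \<Rightarrow> nat \<Rightarrow> real^'a^'m" where
  "Sigma_gain P U k = Sigma_of P U k (Vx P U (Suc k)) (Vxx P U (Suc k))"

definition feedback ::
    "(real^'a, real^'m) ocp \<Rightarrow> (nat \<Rightarrow> real^'m) \<Rightarrow> real \<Rightarrow> nat \<Rightarrow> real^'a \<Rightarrow> real^'m" where
  "feedback P U \<gamma> k x = U k + \<gamma> *\<^sub>R ell P U k + Sigma_gain P U k *v (x - states P U k)"

primrec new_states ::
    "(real^'a, real^'m) ocp \<Rightarrow> (nat \<Rightarrow> real^'m) \<Rightarrow> real \<Rightarrow> nat \<Rightarrow> real^'a" where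
  "new_states P U \<gamma> 0 = init_state P"
| "new_states P U \<gamma> (Suc k) =
     dyn P k (new_states P U \<gamma> k) (feedback P U \<gamma> k (new_states P U \<gamma> k))"

definition new_controls ::
    "(real^'a, real^'m) ocp \<Rightarrow> (nat \<Rightarrow> real^'m) \<Rightarrow> real \<Rightarrow> nat \<Rightarrow> real^'m" where
  "new_controls P U \<gamma> k = feedback P U \<gamma> k (new_states P U \<gamma> k)"

text \<open>The line search starts from \<open>\<gamma> = 1\<close> and runs through an arbitrary strictly decreasing schedule of
  trial values until the total cost is decreased for the first time.\<close>

definition line_search_result ::
    "(real^'a, real^'m) ocp \<Rightarrow> (nat \<Rightarrow> real^'m) \<Rightarrow> real \<Rightarrow> bool" where
  "line_search_result P U \<gamma> \<longleftrightarrow>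
     (\<exists>g :: nat \<Rightarrow> real. \<exists>r.
        g 0 = 1 \<and> (\<forall>i. 0 < g i \<and> g (Suc i) < g i) \<and> \<gamma> = g r \<and>
        total_cost P (new_controls P U (g r)) < total_cost P U \<and>
        (\<forall>i<r. \<not> total_cost P (new_controls P U (g i)) < total_cost P U))"

text \<open>At a stationary point the method has converged and no step decreases the cost. The
  sequence of iterates is then continued by a constant, so that finite termination is covered as well.\<close>

definition ddp_step ::
    "(real^'a, real^'m) ocp \<Rightarrow> (nat \<Rightarrow> real^'m) \<Rightarrow> (nat \<Rightarrow> real^'m) \<Rightarrow> bool" where
  "ddp_step P U U' \<longleftrightarrow>
     (if stationary_point P U then \<forall>k<steps P. U' k = U k
      else \<exists>\<gamma>. line_search_result P U \<gamma> \<and> (\<forall>k<steps P. U' k = new_controls P U \<gamma> k))"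

end

(*
Expand everything at the limit Us, with e the distance of the current iterate U from Us. There the
hypotheses only give that second derivatives are Lipschitz at the limit trajectory itself (third
derivatives exist pointwise and need not be bounded nearby), which is all that is used.

Let dx and du be the deviations of the nominal states and controls from their limits xs and us; a
subscript s marks quantities at the limit. Backward induction gives Vx = Vx_s + Vxx_s dx + O(e^2),
Vxx = Vxx_s + O(e) and, since Qu_s = 0, ell = -du + Sigma_s dx + O(e^2). Hence the feedback law with
gamma = 1 maps x to us + Sigma_s (x - xs) + O(e^2) when x is within O(e) of xs, and forward
induction from the common initial state gives new controls within O(e^2) of us.

The line search accepts gamma = 1 near the limit: telescoping the stagewise expansions and completing
squares yields J(U) - J(Us) = (1/2) sum_k w_k . Quu_s w_k + O(e^3) with w = du - Sigma_s dx. The sum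
is at least a multiple of e^2, because Quu_s is positive definite and w determines (dx, du), while
the cost after the full step exceeds J(Us) by at most O(e^3).
*)
theory Submission
  imports Defs
begin

section \<open>Third-order differentiability\<close>

text \<open>Stationarity is a statement about the total cost, whereas \<open>Vx\<close> contains
  feedback terms: it is the adjoint gradient of the cost to go only where the later
  \<open>ell\<close> vanish. So \<open>Qu = 0\<close> at the limit has to be proved, backwards over
  the stages, and it is proved with the same cost expansion, applied to a perturbation of a single
  control by a parameter t tending to 0 from the right. For this reason orders of magnitude are
  formulated for an arbitrary filter and scale. Lipschitz estimates at the limit point suffice for
  the second derivatives, because in the controls these always meet a factor of order e: either
  \<open>Qu\<close>, which vanishes at the limit, or a state deviation. An error O(e) in a Hessian,
  in the inverse of \<open>Quu\<close> or in the gain thus costs only O(e^2). Lower coercivity of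
  the cost is obtained by changing the scale: sizes are measured by the norm of w instead of e, and
  the dynamics then bound e by a multiple of that norm.\<close>

definition deriv1 :: "('a::euclidean_space \<Rightarrow> real) \<Rightarrow> 'a \<Rightarrow> 'a \<Rightarrow> real" where
  "deriv1 g v = (\<lambda>y. frechet_derivative g (at y) v)"

text \<open>The directions precede the base point, so that \<open>deriv2 g v w\<close> is again a
  scalar function of the point, to which the third order of differentiability applies.
  \<open>v\<close> belongs to the inner derivative and \<open>w\<close> to the outer one; that they
  may be exchanged has to be proved.\<close>

definition deriv2 :: "('a::euclidean_space \<Rightarrow> real) \<Rightarrow> 'a \<Rightarrow> 'a \<Rightarrow> 'a \<Rightarrow> real" where
  "deriv2 g v w = (\<lambda>y. frechet_derivative (deriv1 g v) (at y) w)"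

lemma has_derivative_cong_eventually:
  assumes "\<forall>\<^sub>F y in nhds z. f y = g y"
  shows "(f has_derivative f') (at z) \<longleftrightarrow> (g has_derivative f') (at z)"
proof -
  have ev: "\<forall>\<^sub>F y in at z. f y = g y" "\<forall>\<^sub>F y in at z. g y = f y"
    using assms by (auto simp: eventually_at_filter elim: eventually_mono)
  show ?thesis
    using has_derivative_transform_eventually[OF _ ev(1)] has_derivative_transform_eventually[OF _ ev(2)]
      eventually_nhds_x_imp_x[OF assms] by auto
qed

lemma frechet_derivative_cong_eventually:
  assumes "\<forall>\<^sub>F y in nhds z. f y = g y"
  shows "frechet_derivative f (at z) = frechet_derivative g (at z)"
  using has_derivative_cong_eventually[OF assms] by (simp add: frechet_derivative_def)

lemma differentiable_cong_eventually:
  assumes "\<forall>\<^sub>F y in nhds z. f y = g y"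
  shows "f differentiable (at z) \<longleftrightarrow> g differentiable (at z)"
  using has_derivative_cong_eventually[OF assms] by (simp add: differentiable_def)

lemma frechet_derivative_eqI:
  assumes "(f has_derivative f') (at z)" "\<forall>\<^sub>F y in nhds z. f y = g y"
  shows "frechet_derivative g (at z) = f'"
  using frechet_derivative_at[OF assms(1)] frechet_derivative_cong_eventually[OF assms(2)] by simp

lemma times_differentiable_at_cong:
  assumes "\<forall>\<^sub>F y in nhds z. f y = g y" "times_differentiable_at n f z"
  shows "times_differentiable_at n g z"
  using assms
proof (induction n f z arbitrary: g rule: times_differentiable_at.induct)
  case (2 f z)
  then show ?case using differentiable_cong_eventually[of f g z] by simp
next
  case (3 n f z)
  \<comment> \<open>Equality near \<open>z\<close> is equality near every point close to
    \<open>z\<close>; therefore the derivatives agree on a neighbourhood and the induction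
    hypothesis applies to them.\<close>
  have ev: "\<forall>\<^sub>F y in nhds z. \<forall>\<^sub>F x in nhds y. f x = g x"
    using 3(2) by (simp add: eventually_eventually)
  have 1: "\<forall>\<^sub>F y in nhds z. g differentiable (at y)"
    using eventually_conj[OF ev conjunct1[OF 3(3)[unfolded times_differentiable_at.simps]]]
    by eventually_elim (use differentiable_cong_eventually in blast)
  have 2: "\<forall>\<^sub>F y in nhds z. frechet_derivative f (at y) v = frechet_derivative g (at y) v" for v
    using ev by eventually_elim (simp add: frechet_derivative_cong_eventually)
  show ?case
    using 1 3(1)[OF 2] 3(3) by simp
qed simp

text \<open>Applied to a coordinate projection, this passes from the vector-valued dynamics to their
  scalar components.\<close>

lemma times_differentiable_at_bounded_linear:
  assumes "bounded_linear c" "times_differentiable_at n f z"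
  shows "times_differentiable_at n (\<lambda>y. c (f y)) z"
  using assms(2)
proof (induction n f z rule: times_differentiable_at.induct)
  case (2 f z)
  then obtain f' where "(f has_derivative f') (at z)" by (auto simp: differentiable_def)
  from bounded_linear.has_derivative[OF assms(1) this] show ?case by (auto simp: differentiable_def)
next
  case (3 n f z)
  have d: "\<forall>\<^sub>F y in nhds z. f differentiable (at y)" using 3 by simp
  have 1: "\<forall>\<^sub>F y in nhds z. (\<lambda>y. c (f y)) differentiable (at y)"
    using d
    by eventually_elim (use bounded_linear.has_derivative[OF assms(1)] in \<open>auto simp: differentiable_def\<close>)
  have 2: "\<forall>\<^sub>F y in nhds z. c (frechet_derivative f (at y) v) = frechet_derivative (\<lambda>y. c (f y)) (at y) v" for v
    using d
  proof eventually_elim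
    case (elim y)
    then have "((\<lambda>y. c (f y)) has_derivative (\<lambda>v. c (frechet_derivative f (at y) v))) (at y)"
      using assms(1) bounded_linear.has_derivative frechet_derivative_works by blast
    then show ?case using frechet_derivative_at by metis
  qed
  show ?case
    using 1 3 by (auto intro!: times_differentiable_at_cong[OF 2])
qed simp

text \<open>The bound of the derivative plus 1, the 1 being the tolerance used in the definition of
  differentiability. One endpoint of the estimate stays at \<open>z\<close>.\<close>

lemma differentiable_imp_lipschitz_at:
  fixes f :: "'a::real_normed_vector \<Rightarrow> 'b::real_normed_vector"
  assumes "f differentiable (at z)"
  obtains C where "C \<ge> 0" "\<forall>\<^sub>F y in nhds z. norm (f y - f z) \<le> C * norm (y - z)"
proof -
  obtain f' where f': "bounded_linear f'"
      "\<forall>e>0. \<exists>d>0. \<forall>y. norm (y - z) < d \<longrightarrow> norm (f y - f z - f' (y - z)) \<le> e * norm (y - z)"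
    using assms by (auto simp: differentiable_def has_derivative_at_alt)
  obtain K where K: "\<And>x. norm (f' x) \<le> K * norm x" "K > 0"
    using f'(1) bounded_linear.pos_bounded by (metis mult.commute)
  obtain d where d: "d > 0" "\<And>y. norm (y - z) < d \<Longrightarrow> norm (f y - f z - f' (y - z)) \<le> 1 * norm (y - z)"
    using f'(2) zero_less_one by metis
  show thesis
  proof
    show "K + 1 \<ge> 0" using K by simp
    show "\<forall>\<^sub>F y in nhds z. norm (f y - f z) \<le> (K + 1) * norm (y - z)"
      unfolding eventually_nhds_metric
    proof (intro exI conjI allI impI)
      fix y assume "dist y z < d"
      then have "norm (f y - f z - f' (y - z)) \<le> norm (y - z)" using d(2) by (auto simp: dist_norm)
      with K(1)[of "y - z"] norm_triangle_ineq[of "f y - f z - f' (y - z)" "f' (y - z)"]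
      show "norm (f y - f z) \<le> (K + 1) * norm (y - z)" by (simp add: algebra_simps)
    qed (rule d)
  qed
qed

lemma linear_basis_sum:
  fixes f :: "'a::euclidean_space \<Rightarrow> real"
  assumes "linear f"
  shows "f v = (\<Sum>b\<in>Basis. (v \<bullet> b) * f b)"
  using arg_cong[OF euclidean_representation[of v], of f] assms
  by (simp add: linear_sum linear_scale)

locale thrice_differentiable =
  fixes g :: "'a::euclidean_space \<Rightarrow> real" and z :: 'a
  assumes thrice: "times_differentiable_at 3 g z"
begin

lemma eventually_differentiable: "\<forall>\<^sub>F y in nhds z. g differentiable (at y)"
  using thrice by (simp add: numeral_3_eq_3)

text \<open>The hypothesis gives for each direction its own neighbourhood. Finitely many basis
  directions share one, and linearity in the direction carries it over to all
  \<open>v\<close>.\<close>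

lemma eventually_differentiable_deriv1:
  "\<forall>\<^sub>F y in nhds z. \<forall>v. deriv1 g v differentiable (at y)"
proof -
  have 1: "\<forall>\<^sub>F y in nhds z. \<forall>b\<in>Basis. deriv1 g b differentiable (at y)"
    using thrice by (intro eventually_ball_finite) (auto simp: numeral_3_eq_3 deriv1_def)
  \<comment> \<open>Linearity of \<open>deriv1 g v\<close> in \<open>v\<close> is needed around
    \<open>y\<close> and not just at \<open>y\<close>, since it is about to be differentiated
    there.\<close>
  have 2: "\<forall>\<^sub>F y in nhds z. \<forall>\<^sub>F x in nhds y. g differentiable (at x)"
    using eventually_differentiable by (simp add: eventually_eventually)
  show ?thesis using 1 2
  proof eventually_elim
    case (elim y)
    show ?case
    proof
      fix v
      have "(\<lambda>x. \<Sum>b\<in>Basis. (v \<bullet> b) * deriv1 g b x) differentiable (at y)"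
        using elim(1) by (intro differentiable_sum) auto
      moreover have "\<forall>\<^sub>F x in nhds y. (\<Sum>b\<in>Basis. (v \<bullet> b) * deriv1 g b x) = deriv1 g v x"
        using elim(2) by eventually_elim
          (simp add: deriv1_def linear_basis_sum[OF linear_frechet_derivative, of _ _ v])
      ultimately show "deriv1 g v differentiable (at y)"
        by (simp add: differentiable_cong_eventually)
    qed
  qed
qed

text \<open>A radius chosen once, so that the following facts share one ball instead of each
  carrying its own neighbourhood.\<close>

definition rad :: real where
  "rad = (SOME r. r > 0 \<and> (\<forall>y\<in>ball z r. g differentiable (at y) \<and>
     (\<forall>v. deriv1 g v differentiable (at y))))"

lemma rad: "rad > 0"
  and differentiable: "y \<in> ball z rad \<Longrightarrow> g differentiable (at y)"
  and differentiable_deriv1: "y \<in> ball z rad \<Longrightarrow> deriv1 g v differentiable (at y)"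
proof -
  have "\<exists>r. r > 0 \<and> (\<forall>y\<in>ball z r. g differentiable (at y) \<and>
     (\<forall>v. deriv1 g v differentiable (at y)))"
    using eventually_conj[OF eventually_differentiable eventually_differentiable_deriv1]
    unfolding eventually_nhds_metric by (auto simp: dist_commute)
  from someI_ex[OF this, folded rad_def]
  show "rad > 0" "y \<in> ball z rad \<Longrightarrow> g differentiable (at y)"
     "y \<in> ball z rad \<Longrightarrow> deriv1 g v differentiable (at y)"
    by blast+
qed

lemma has_derivative_deriv1: "y \<in> ball z rad \<Longrightarrow> (g has_derivative (\<lambda>v. deriv1 g v y)) (at y)"
  using differentiable by (simp add: deriv1_def frechet_derivative_works)

lemma has_derivative_deriv2:
  "y \<in> ball z rad \<Longrightarrow> (deriv1 g v has_derivative (\<lambda>w. deriv2 g v w y)) (at y)"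
  using differentiable_deriv1 by (simp add: deriv2_def frechet_derivative_works)

lemma linear_deriv1: "y \<in> ball z rad \<Longrightarrow> linear (\<lambda>v. deriv1 g v y)"
  using differentiable linear_frechet_derivative by (auto simp: deriv1_def)

lemma linear_deriv2: "y \<in> ball z rad \<Longrightarrow> linear (\<lambda>w. deriv2 g v w y)"
  using differentiable_deriv1 linear_frechet_derivative by (auto simp: deriv2_def)

lemma eventually_in_ball: "y \<in> ball z rad \<Longrightarrow> \<forall>\<^sub>F x in nhds y. x \<in> ball z rad"
  using eventually_nhds_in_open by blast

text \<open>Linearity of \<open>deriv1\<close> in its direction holds on a neighbourhood of
  \<open>y\<close>; differentiating that identity at \<open>y\<close> gives linearity of
  \<open>deriv2\<close> in the inner direction.\<close>

lemma linear_deriv2_left: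
  assumes y: "y \<in> ball z rad"
  shows "linear (\<lambda>v. deriv2 g v w y)"
proof (rule linearI)
  fix v1 v2 :: 'a and r :: real
  have "((\<lambda>x. deriv1 g v1 x + deriv1 g v2 x) has_derivative
      (\<lambda>w. deriv2 g v1 w y + deriv2 g v2 w y)) (at y)"
    by (intro has_derivative_add has_derivative_deriv2 y)
  moreover have "\<forall>\<^sub>F x in nhds y. deriv1 g v1 x + deriv1 g v2 x = deriv1 g (v1 + v2) x"
    using eventually_in_ball[OF y] by eventually_elim (simp add: linear_add[OF linear_deriv1])
  ultimately show "deriv2 g (v1 + v2) w y = deriv2 g v1 w y + deriv2 g v2 w y"
    unfolding deriv2_def by (rule fun_cong[OF frechet_derivative_eqI])
  have "((\<lambda>x. r *\<^sub>R deriv1 g v1 x) has_derivative (\<lambda>w. r *\<^sub>R deriv2 g v1 w y)) (at y)"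
    by (intro has_derivative_scaleR_right has_derivative_deriv2 y)
  moreover have "\<forall>\<^sub>F x in nhds y. r *\<^sub>R deriv1 g v1 x = deriv1 g (r *\<^sub>R v1) x"
    using eventually_in_ball[OF y] by eventually_elim (simp add: linear_scale[OF linear_deriv1])
  ultimately show "deriv2 g (r *\<^sub>R v1) w y = r *\<^sub>R deriv2 g v1 w y"
    unfolding deriv2_def by (rule fun_cong[OF frechet_derivative_eqI])
qed

lemma deriv2_basis_sum:
  assumes y: "y \<in> ball z rad"
  shows "deriv2 g v w y = (\<Sum>b\<in>Basis. \<Sum>c\<in>Basis. (v \<bullet> b) * (w \<bullet> c) * deriv2 g b c y)"
proof -
  have "deriv2 g v w y = (\<Sum>b\<in>Basis. (v \<bullet> b) * deriv2 g b w y)"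
    by (rule linear_basis_sum[OF linear_deriv2_left[OF y]])
  also have "\<dots> = (\<Sum>b\<in>Basis. (v \<bullet> b) * (\<Sum>c\<in>Basis. (w \<bullet> c) * deriv2 g b c y))"
    by (intro sum.cong refl arg_cong2[where f = "(*)"] linear_basis_sum[OF linear_deriv2[OF y]])
  finally show ?thesis by (simp only: sum_distrib_left mult.assoc)
qed

lemma z_in_ball: "z \<in> ball z rad"
  using rad by simp

text \<open>The finitely many entries in basis directions are differentiable at \<open>z\<close>,
  hence Lipschitz there; bilinearity extends this to all directions, with the sum of the entrywise
  constants.\<close>

lemma ex_deriv2_lipschitz:
  "\<exists>r C. 0 < r \<and> r \<le> rad \<and> 0 \<le> C \<and> (\<forall>y\<in>ball z r. \<forall>v w.
      \<bar>deriv2 g v w y - deriv2 g v w z\<bar> \<le> C * norm v * norm w * norm (y - z))"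
proof -
  have "\<exists>C. 0 \<le> C \<and> (\<forall>\<^sub>F y in nhds z. norm (deriv2 g b c y - deriv2 g b c z) \<le> C * norm (y - z))"
    for b c
  proof -
    have "deriv2 g b c differentiable (at z)"
      using thrice by (simp add: numeral_3_eq_3 deriv1_def deriv2_def)
    then show ?thesis by (rule differentiable_imp_lipschitz_at) blast
  qed
  then obtain C where C: "\<And>b c. 0 \<le> C b c"
     "\<And>b c. \<forall>\<^sub>F y in nhds z. norm (deriv2 g b c y - deriv2 g b c z) \<le> C b c * norm (y - z)"
    by metis
  have "\<forall>\<^sub>F y in nhds z. \<forall>b\<in>Basis. \<forall>c\<in>Basis. norm (deriv2 g b c y - deriv2 g b c z) \<le> C b c * norm (y - z)"
    by (intro eventually_ball_finite ballI C) auto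
  then obtain r where r: "r > 0" "\<forall>y. dist y z < r \<longrightarrow> (\<forall>b\<in>Basis. \<forall>c\<in>Basis.
      norm (deriv2 g b c y - deriv2 g b c z) \<le> C b c * norm (y - z))"
    unfolding eventually_nhds_metric by (elim exE conjE)
  show ?thesis
  proof (intro exI conjI ballI allI)
    show "0 < min r rad" using r rad by simp
    show "min r rad \<le> rad" by simp
    show "0 \<le> (\<Sum>b\<in>Basis. \<Sum>c\<in>Basis. C b c)" by (intro sum_nonneg C)
    fix y v w assume y: "y \<in> ball z (min r rad)"
    then have y': "y \<in> ball z rad" by simp
    have "\<bar>deriv2 g v w y - deriv2 g v w z\<bar>
       = \<bar>\<Sum>b\<in>Basis. \<Sum>c\<in>Basis. (v \<bullet> b) * (w \<bullet> c) * (deriv2 g b c y - deriv2 g b c z)\<bar>"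
      unfolding deriv2_basis_sum[OF y', of v w] deriv2_basis_sum[OF z_in_ball, of v w]
      by (simp only: right_diff_distrib sum_subtractf)
    also have "\<dots> \<le> (\<Sum>b\<in>Basis. \<Sum>c\<in>Basis. \<bar>(v \<bullet> b) * (w \<bullet> c) * (deriv2 g b c y - deriv2 g b c z)\<bar>)"
      by (rule order_trans[OF sum_abs sum_mono[OF sum_abs]])
    also have "\<dots> \<le> (\<Sum>b\<in>Basis. \<Sum>c\<in>Basis. norm v * norm w * (C b c * norm (y - z)))"
    proof (intro sum_mono)
      fix b c :: 'a assume bc: "b \<in> Basis" "c \<in> Basis"
      have "norm (deriv2 g b c y - deriv2 g b c z) \<le> C b c * norm (y - z)"
        using r(2) y bc by (simp add: dist_commute)
      then show "\<bar>(v \<bullet> b) * (w \<bullet> c) * (deriv2 g b c y - deriv2 g b c z)\<bar>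
          \<le> norm v * norm w * (C b c * norm (y - z))"
        unfolding abs_mult using bc by (intro mult_mono) (auto simp: Basis_le_norm C)
    qed
    also have "\<dots> = (\<Sum>b\<in>Basis. \<Sum>c\<in>Basis. C b c) * norm v * norm w * norm (y - z)"
      by (simp add: sum_distrib_left sum_distrib_right mult_ac)
    finally show "\<bar>deriv2 g v w y - deriv2 g v w z\<bar>
        \<le> (\<Sum>b\<in>Basis. \<Sum>c\<in>Basis. C b c) * norm v * norm w * norm (y - z)" .
  qed
qed

text \<open>Mean value inequality for \<open>deriv1 g v\<close> minus its linearization at
  \<open>z\<close>: on the closed ball of radius \<open>norm (y - z)\<close> the derivative of this
  difference is itself bounded by a multiple of \<open>norm (y - z)\<close>, which gives the
  square.\<close>

lemma ex_deriv1_expansion: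
  "\<exists>r C. 0 < r \<and> r \<le> rad \<and> 0 \<le> C \<and> (\<forall>y\<in>ball z r. \<forall>v.
      \<bar>deriv1 g v y - deriv1 g v z - deriv2 g v (y - z) z\<bar> \<le> C * norm v * (norm (y - z))\<^sup>2)"
proof -
  obtain r C where r: "0 < r" "r \<le> rad" "0 \<le> C"
    and C: "\<And>y v w. y \<in> ball z r \<Longrightarrow>
      \<bar>deriv2 g v w y - deriv2 g v w z\<bar> \<le> C * norm v * norm w * norm (y - z)"
    using ex_deriv2_lipschitz by metis
  have "\<bar>deriv1 g v y - deriv1 g v z - deriv2 g v (y - z) z\<bar> \<le> C * norm v * (norm (y - z))\<^sup>2"
    if y: "y \<in> ball z r" for y v
  proof -
    let ?S = "cball z (norm (y - z))"
    let ?f = "\<lambda>x. deriv1 g v x - deriv2 g v (x - z) z"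
    have sub: "?S \<subseteq> ball z r" using y by (auto simp: dist_norm norm_minus_commute)
    have "norm (?f y - ?f z) \<le> (C * norm v * norm (y - z)) * norm (y - z)"
    proof (rule differentiable_bound[where S = ?S and f' = "\<lambda>x w. deriv2 g v w x - deriv2 g v w z"])
      fix x assume x: "x \<in> ?S"
      then have x': "x \<in> ball z r" "x \<in> ball z rad" using sub r by auto
      have "((\<lambda>x. deriv2 g v (x - z) z) has_derivative (\<lambda>w. deriv2 g v (w - 0) z)) (at x within ?S)"
        using linear_deriv2[OF z_in_ball, THEN linear_conv_bounded_linear[THEN iffD1]]
        by (rule bounded_linear.has_derivative) (auto intro!: derivative_eq_intros)
      then show "(?f has_derivative (\<lambda>w. deriv2 g v w x - deriv2 g v w z)) (at x within ?S)"
        by (intro has_derivative_diff has_derivative_at_withinI[OF has_derivative_deriv2] x') simp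
      show "onorm (\<lambda>w. deriv2 g v w x - deriv2 g v w z) \<le> C * norm v * norm (y - z)"
      proof (rule onorm_le)
        fix w :: 'a
        have "norm (x - z) \<le> norm (y - z)" using x by (simp add: dist_norm norm_minus_commute)
        then have "C * norm v * norm w * norm (x - z) \<le> C * norm v * norm w * norm (y - z)"
          using r by (intro mult_left_mono) auto
        then show "norm (deriv2 g v w x - deriv2 g v w z) \<le> C * norm v * norm (y - z) * norm w"
          using C[OF x'(1), of v w] by (simp add: mult_ac)
      qed
    qed (auto simp: dist_norm norm_minus_commute)
    then show ?thesis
      using linear_0[OF linear_deriv2[OF z_in_ball]]
      by (simp add: power2_eq_square mult_ac algebra_simps)
  qed
  then show ?thesis using r by blast
qed

text \<open>The second difference does not depend on the order of \<open>v\<close> and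
  \<open>w\<close>, so this determines its leading coefficient for both orders at once; it is the
  tool for symmetry of the second derivative.\<close>

lemma second_difference:
  "\<exists>C. 0 \<le> C \<and> (\<forall>\<^sub>F t in at_right (0::real).
     \<bar>g (z + t *\<^sub>R v + t *\<^sub>R w) - g (z + t *\<^sub>R v) - g (z + t *\<^sub>R w) + g z - t\<^sup>2 * deriv2 g v w z\<bar> \<le> C * t^3)"
proof -
  obtain r C where r: "0 < r" "r \<le> rad" "0 \<le> C"
    and C: "\<And>y v. y \<in> ball z r \<Longrightarrow>
      \<bar>deriv1 g v y - deriv1 g v z - deriv2 g v (y - z) z\<bar> \<le> C * norm v * (norm (y - z))\<^sup>2"
    using ex_deriv1_expansion by metis
  \<comment> \<open>Bounds both directions jointly, so that all points used lie within
    \<open>t * N\<close> of \<open>z\<close>; the summand 1 makes the division \<open>r / N\<close>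
    legitimate.\<close>
  define N where "N = norm v + norm w + 1"
  have N: "N > 0" "norm v \<le> N" by (auto simp: N_def intro: add_nonneg_pos)
  have "\<bar>g (z + t *\<^sub>R v + t *\<^sub>R w) - g (z + t *\<^sub>R v) - g (z + t *\<^sub>R w) + g z - t\<^sup>2 * deriv2 g v w z\<bar>
      \<le> 2 * C * N^3 * t^3" if t: "0 < t" "t < r / N" for t
  proof -
    have tN: "t * N < r" using t N by (simp add: field_simps)
    have near: "norm (s *\<^sub>R v + s' *\<^sub>R w) \<le> t * N" if "0 \<le> s" "s \<le> t" "0 \<le> s'" "s' \<le> t" for s s'
    proof -
      have "norm (s *\<^sub>R v + s' *\<^sub>R w) \<le> s * norm v + s' * norm w"
        using that norm_triangle_ineq[of "s *\<^sub>R v" "s' *\<^sub>R w"] by simp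
      also have "\<dots> \<le> t * norm v + t * norm w"
        using that by (intro add_mono mult_right_mono) auto
      also have "\<dots> \<le> t * N" using t by (simp add: N_def algebra_simps)
      finally show ?thesis .
    qed
    \<comment> \<open>The second difference is the increment of \<psi> over \<open>[0, t]\<close>.
      One mean value theorem along \<open>v\<close> turns it into a difference of first derivatives
      at two points, to both of which the expansion at \<open>z\<close> applies.\<close>
    define \<psi> where "\<psi> s = g (z + s *\<^sub>R v + t *\<^sub>R w) - g (z + s *\<^sub>R v)" for s
    have in_ball: "z + (s *\<^sub>R v + s' *\<^sub>R w) \<in> ball z r" if "0 \<le> s" "s \<le> t" "0 \<le> s'" "s' \<le> t" for s s'
    proof -
      have "dist z (z + h) = norm h" for h by (simp add: dist_norm)
      then show ?thesis using near[OF that] tN by (simp only: mem_ball)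
    qed
    have \<psi>_deriv: "(\<psi> has_real_derivative
        deriv1 g v (z + s *\<^sub>R v + t *\<^sub>R w) - deriv1 g v (z + s *\<^sub>R v)) (at s)" if s: "0 \<le> s" "s \<le> t" for s
    proof -
      have b: "z + s *\<^sub>R v + t *\<^sub>R w \<in> ball z rad" "z + s *\<^sub>R v \<in> ball z rad"
        using in_ball[of s t] in_ball[of s 0] s t r by (auto simp: add.assoc)
      have 1: "((\<lambda>s. g (z + s *\<^sub>R v + t *\<^sub>R w)) has_derivative
         (\<lambda>h. deriv1 g (h *\<^sub>R v) (z + s *\<^sub>R v + t *\<^sub>R w))) (at s)"
        by (rule has_derivative_compose[where f = "\<lambda>s. z + s *\<^sub>R v + t *\<^sub>R w" and g = g
              and f' = "\<lambda>h. h *\<^sub>R v" and g' = "\<lambda>x. deriv1 g x (z + s *\<^sub>R v + t *\<^sub>R w)"])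
           (auto intro!: derivative_eq_intros has_derivative_deriv1[OF b(1)])
      have 2: "((\<lambda>s. g (z + s *\<^sub>R v)) has_derivative (\<lambda>h. deriv1 g (h *\<^sub>R v) (z + s *\<^sub>R v))) (at s)"
        by (rule has_derivative_compose[where f = "\<lambda>s. z + s *\<^sub>R v" and g = g
              and f' = "\<lambda>h. h *\<^sub>R v" and g' = "\<lambda>x. deriv1 g x (z + s *\<^sub>R v)"])
           (auto intro!: derivative_eq_intros has_derivative_deriv1[OF b(2)])
      have "(\<lambda>h. deriv1 g (h *\<^sub>R v) (z + s *\<^sub>R v + t *\<^sub>R w) - deriv1 g (h *\<^sub>R v) (z + s *\<^sub>R v))
          = (*) (deriv1 g v (z + s *\<^sub>R v + t *\<^sub>R w) - deriv1 g v (z + s *\<^sub>R v))"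
        by (rule ext) (simp add: linear_scale[OF linear_deriv1[OF b(1)]]
          linear_scale[OF linear_deriv1[OF b(2)]] right_diff_distrib mult.commute)
      then show ?thesis
        using has_derivative_diff[OF 1 2] unfolding has_field_derivative_def \<psi>_def by simp
    qed
    obtain s where s: "0 < s" "s < t"
      and mvt: "\<psi> t - \<psi> 0 = (t - 0) * (deriv1 g v (z + s *\<^sub>R v + t *\<^sub>R w) - deriv1 g v (z + s *\<^sub>R v))"
      using MVT2[OF t(1) \<psi>_deriv] by blast
    let ?E = "\<lambda>h. deriv1 g v (z + h) - deriv1 g v z - deriv2 g v h z"
    have bnd: "\<bar>?E h\<bar> \<le> C * N^3 * t\<^sup>2" if "norm h \<le> t * N" for h
    proof -
      have "\<bar>?E h\<bar> \<le> C * norm v * (norm h)\<^sup>2"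
        using C[of "z + h" v] that tN by (simp add: dist_norm)
      also have "\<dots> \<le> C * N * (t * N)\<^sup>2"
        using r N that by (intro mult_mono power_mono) auto
      finally show ?thesis by (simp add: power2_eq_square power3_eq_cube mult_ac)
    qed
    have "deriv2 g v (s *\<^sub>R v + t *\<^sub>R w) z - deriv2 g v (s *\<^sub>R v) z = t * deriv2 g v w z"
      by (simp add: linear_add[OF linear_deriv2[OF z_in_ball]] linear_scale[OF linear_deriv2[OF z_in_ball]])
    then have "deriv1 g v (z + s *\<^sub>R v + t *\<^sub>R w) - deriv1 g v (z + s *\<^sub>R v) - t * deriv2 g v w z
        = ?E (s *\<^sub>R v + t *\<^sub>R w) - ?E (s *\<^sub>R v)"
      by (simp add: add.assoc)
    then have "\<psi> t - \<psi> 0 - t\<^sup>2 * deriv2 g v w z = t * (?E (s *\<^sub>R v + t *\<^sub>R w) - ?E (s *\<^sub>R v))"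
      using mvt by (simp add: power2_eq_square algebra_simps)
    then have "\<bar>\<psi> t - \<psi> 0 - t\<^sup>2 * deriv2 g v w z\<bar> = t * \<bar>?E (s *\<^sub>R v + t *\<^sub>R w) - ?E (s *\<^sub>R v)\<bar>"
      using t by (simp add: abs_mult)
    also have "\<dots> \<le> t * (2 * (C * N^3 * t\<^sup>2))"
      using bnd[OF near[of s t]] bnd[of "s *\<^sub>R v"] near[of s 0] s t
      by (intro mult_left_mono) auto
    finally show ?thesis
      by (simp add: \<psi>_def power2_eq_square power3_eq_cube algebra_simps)
  qed
  moreover have "\<forall>\<^sub>F t in at_right 0. t \<in> {0<..<r / N}"
    using r N by (intro eventually_at_right_real) simp
  ultimately show ?thesis
    using r N by (intro exI[of _ "2 * C * N^3"]) (auto elim!: eventually_mono)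
qed

text \<open>Comparing the two expansions of the same second difference, t^2 times the discrepancy is
  O(t^3), which forces it to vanish.\<close>

lemma deriv2_commute: "deriv2 g v w z = deriv2 g w v z"
proof (rule ccontr)
  let ?d = "deriv2 g v w z - deriv2 g w v z"
  assume "deriv2 g v w z \<noteq> deriv2 g w v z"
  then have d: "\<bar>?d\<bar> > 0" by simp
  let ?\<Delta> = "\<lambda>t v w. g (z + t *\<^sub>R v + t *\<^sub>R w) - g (z + t *\<^sub>R v) - g (z + t *\<^sub>R w) + g z"
  obtain C1 where C1: "C1 \<ge> 0" "\<forall>\<^sub>F t in at_right 0. \<bar>?\<Delta> t v w - t\<^sup>2 * deriv2 g v w z\<bar> \<le> C1 * t^3"
    using second_difference[of v w] by (elim exE conjE)
  obtain C2 where C2: "C2 \<ge> 0" "\<forall>\<^sub>F t in at_right 0. \<bar>?\<Delta> t w v - t\<^sup>2 * deriv2 g w v z\<bar> \<le> C2 * t^3"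
    using second_difference[of w v] by (elim exE conjE)
  \<comment> \<open>For such \<open>t\<close> the error \<open>(C1 + C2) * t\<close> stays below the
    discrepancy; the 1 avoids a zero denominator.\<close>
  have "\<forall>\<^sub>F t in at_right 0. t \<in> {0<..<\<bar>?d\<bar> / (C1 + C2 + 1)}"
    using d C1 C2 by (intro eventually_at_right_real) (auto intro!: divide_pos_pos)
  then have "\<forall>\<^sub>F t in at_right (0::real). False"
    using C1(2) C2(2)
  proof eventually_elim
    case (elim t)
    have "?\<Delta> t v w = ?\<Delta> t w v" by (simp add: algebra_simps)
    then have "\<bar>t\<^sup>2 * ?d\<bar> \<le> C1 * t^3 + C2 * t^3"
      using elim(2,3) by (simp add: right_diff_distrib)
    then have "t\<^sup>2 * \<bar>?d\<bar> \<le> C1 * t^3 + C2 * t^3"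
      by (simp only: abs_mult abs_power2)
    also have "\<dots> = t\<^sup>2 * ((C1 + C2) * t)"
      by (simp add: power2_eq_square power3_eq_cube algebra_simps)
    finally have "t\<^sup>2 * \<bar>?d\<bar> \<le> t\<^sup>2 * ((C1 + C2) * t)" .
    then have "\<bar>?d\<bar> \<le> (C1 + C2) * t"
      using elim(1) by (simp add: mult_le_cancel_left)
    moreover have "t * (C1 + C2 + 1) < \<bar>?d\<bar>"
      using elim(1) C1 C2 by (simp add: field_simps)
    ultimately show False using elim(1) by (simp add: algebra_simps)
  qed
  then show False by (simp add: eventually_False)
qed

text \<open>Mean value inequality once more. The derivative of the halved quadratic term along
  \<open>w\<close> is the average of \<open>deriv2\<close> over both orders of \<open>x - z\<close>
  and \<open>w\<close>; by symmetry at \<open>z\<close> it equals the linear part in the expansion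
  of \<open>deriv1 g w\<close>, so a remainder of order two is left.\<close>

lemma ex_second_order_expansion:
  "\<exists>r C. 0 < r \<and> r \<le> rad \<and> 0 \<le> C \<and> (\<forall>y\<in>ball z r.
      \<bar>g y - g z - deriv1 g (y - z) z - deriv2 g (y - z) (y - z) z / 2\<bar> \<le> C * (norm (y - z))^3)"
proof -
  obtain r C where r: "0 < r" "r \<le> rad" "0 \<le> C"
    and C: "\<And>y v. y \<in> ball z r \<Longrightarrow>
      \<bar>deriv1 g v y - deriv1 g v z - deriv2 g v (y - z) z\<bar> \<le> C * norm v * (norm (y - z))\<^sup>2"
    using ex_deriv1_expansion by metis
  have bil: "bounded_bilinear (\<lambda>v w. deriv2 g v w z)"
    using linear_deriv2_left[OF z_in_ball] linear_deriv2[OF z_in_ball]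
    by (subst bilinear_conv_bounded_bilinear[symmetric]) (simp add: bilinear_def)
  have "\<bar>g y - g z - deriv1 g (y - z) z - deriv2 g (y - z) (y - z) z / 2\<bar> \<le> C * (norm (y - z))^3"
    if y: "y \<in> ball z r" for y
  proof -
    let ?S = "cball z (norm (y - z))"
    let ?f = "\<lambda>x. g x - deriv1 g (x - z) z - deriv2 g (x - z) (x - z) z / 2"
    let ?f' = "\<lambda>x w. deriv1 g w x - deriv1 g (w - 0) z
       - (deriv2 g (x - z) (w - 0) z + deriv2 g (w - 0) (x - z) z) / 2"
    have sub: "?S \<subseteq> ball z r" using y by (auto simp: dist_norm norm_minus_commute)
    have "norm (?f y - ?f z) \<le> (C * (norm (y - z))\<^sup>2) * norm (y - z)"
    proof (rule differentiable_bound[where S = ?S and f' = ?f'])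
      fix x assume x: "x \<in> ?S"
      then have x': "x \<in> ball z r" "x \<in> ball z rad" using sub r by auto
      have 1: "((\<lambda>x. deriv1 g (x - z) z) has_derivative (\<lambda>w. deriv1 g (w - 0) z)) (at x within ?S)"
        using linear_deriv1[OF z_in_ball, THEN linear_conv_bounded_linear[THEN iffD1]]
        by (rule bounded_linear.has_derivative) (auto intro!: derivative_eq_intros)
      have 2: "((\<lambda>x. deriv2 g (x - z) (x - z) z) has_derivative
          (\<lambda>w. deriv2 g (x - z) (w - 0) z + deriv2 g (w - 0) (x - z) z)) (at x within ?S)"
        by (rule bounded_bilinear.FDERIV[OF bil]) (auto intro!: derivative_eq_intros)
      have "((\<lambda>x. deriv2 g (x - z) (x - z) z / 2) has_derivative
          (\<lambda>w. (deriv2 g (x - z) (w - 0) z + deriv2 g (w - 0) (x - z) z) / 2)) (at x within ?S)"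
        by (rule bounded_linear.has_derivative[OF bounded_linear_divide 2])
      with 1 show "(?f has_derivative ?f' x) (at x within ?S)"
        by (intro has_derivative_diff has_derivative_at_withinI[OF has_derivative_deriv1] x')
      show "onorm (?f' x) \<le> C * (norm (y - z))\<^sup>2"
      proof (rule onorm_le)
        fix w :: 'a
        have "norm (x - z) \<le> norm (y - z)" using x by (simp add: dist_norm norm_minus_commute)
        then have "C * norm w * (norm (x - z))\<^sup>2 \<le> C * norm w * (norm (y - z))\<^sup>2"
          using r by (intro mult_left_mono power_mono) auto
        then show "norm (?f' x w) \<le> C * (norm (y - z))\<^sup>2 * norm w"
          using C[OF x'(1), of w] deriv2_commute[of w "x - z"] by (simp add: mult_ac)
      qed
    qed (auto simp: dist_norm norm_minus_commute)
    then show ?thesis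
      using linear_0[OF linear_deriv2[OF z_in_ball]] linear_0[OF linear_deriv1[OF z_in_ball]]
      by (simp add: power2_eq_square power3_eq_cube mult_ac algebra_simps)
  qed
  then show ?thesis using r by blast
qed

end


section \<open>Asymptotic expansions\<close>

text \<open>Three instances are needed: the iterates with their distance from the limit, a one-sided
  real parameter for stationarity, and an auxiliary scale for coercivity of the cost.\<close>

locale asymptotic_scale =
  fixes F :: "'i filter" and e :: "'i \<Rightarrow> real"
  assumes e_nonneg: "\<forall>\<^sub>F l in F. 0 \<le> e l" and e_tendsto: "(e \<longlongrightarrow> 0) F"
begin

text \<open>Order 0 means eventually bounded. The constant may have any sign here;
  \<open>bigOE\<close> supplies a nonnegative one.\<close>

definition bigO :: "nat \<Rightarrow> ('i \<Rightarrow> 'b::real_normed_vector) \<Rightarrow> bool" where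
  "bigO n x \<longleftrightarrow> (\<exists>C. \<forall>\<^sub>F l in F. norm (x l) \<le> C * e l ^ n)"

lemma bigOI: "\<forall>\<^sub>F l in F. norm (x l) \<le> C * e l ^ n \<Longrightarrow> bigO n x"
  by (auto simp: bigO_def)

lemma bigOE:
  assumes "bigO n x"
  obtains C where "C \<ge> 0" "\<forall>\<^sub>F l in F. norm (x l) \<le> C * e l ^ n"
proof -
  obtain C where "\<forall>\<^sub>F l in F. norm (x l) \<le> C * e l ^ n" using assms by (auto simp: bigO_def)
  then have "\<forall>\<^sub>F l in F. norm (x l) \<le> \<bar>C\<bar> * e l ^ n"
    using e_nonneg
  proof eventually_elim
    case (elim l)
    have "C * e l ^ n \<le> \<bar>C\<bar> * e l ^ n" using elim by (intro mult_right_mono) auto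
    with elim show ?case by linarith
  qed
  then show thesis using that[of "\<bar>C\<bar>"] by simp
qed

lemma bigO_dominated:
  assumes "bigO n y" "\<forall>\<^sub>F l in F. norm (x l) \<le> K * norm (y l)"
  shows "bigO n x"
proof -
  obtain C where C: "C \<ge> 0" "\<forall>\<^sub>F l in F. norm (y l) \<le> C * e l ^ n" using assms(1) by (rule bigOE)
  show ?thesis
  proof (rule bigOI[where C = "\<bar>K\<bar> * C"])
    show "\<forall>\<^sub>F l in F. norm (x l) \<le> \<bar>K\<bar> * C * e l ^ n"
      using assms(2) C(2)
    proof eventually_elim
      case (elim l)
      have "K * norm (y l) \<le> \<bar>K\<bar> * norm (y l)" by (intro mult_right_mono) auto
      also have "\<dots> \<le> \<bar>K\<bar> * (C * e l ^ n)" using elim by (intro mult_left_mono) auto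
      finally show ?case using elim by (simp add: mult.assoc)
    qed
  qed
qed

lemma bigO_cong:
  assumes "bigO n y" "\<forall>\<^sub>F l in F. x l = y l"
  shows "bigO n x"
  by (rule bigO_dominated[OF assms(1), where K = 1]) (use assms(2) in \<open>auto elim: eventually_mono\<close>)

lemma bigO_eq: "bigO n y \<Longrightarrow> (\<And>l. x l = y l) \<Longrightarrow> bigO n x"
  by (rule bigO_cong) auto

lemma bigO_mono:
  assumes "bigO n x" "m \<le> n"
  shows "bigO m x"
proof -
  obtain C where C: "C \<ge> 0" "\<forall>\<^sub>F l in F. norm (x l) \<le> C * e l ^ n" using assms(1) by (rule bigOE)
  have e1: "\<forall>\<^sub>F l in F. e l < 1" using e_tendsto by (rule order_tendstoD) simp
  show ?thesis
  proof (rule bigOI)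
    show "\<forall>\<^sub>F l in F. norm (x l) \<le> C * e l ^ m"
      using C(2) e1 e_nonneg
    proof eventually_elim
      case (elim l)
      have "C * e l ^ n \<le> C * e l ^ m"
        using elim assms C by (intro mult_left_mono power_decreasing) auto
      with elim show ?case by linarith
    qed
  qed
qed

lemma bigO_const: "bigO 0 (\<lambda>_. c)"
  by (rule bigOI[where C = "norm c"]) simp

lemma bigO_zero: "bigO n (\<lambda>_. 0)"
  by (rule bigOI[where C = 0]) simp

lemma bigO_add:
  assumes "bigO n x" "bigO n y"
  shows "bigO n (\<lambda>l. x l + y l)"
proof -
  obtain C where C: "\<forall>\<^sub>F l in F. norm (x l) \<le> C * e l ^ n" using assms(1) by (rule bigOE)
  obtain D where D: "\<forall>\<^sub>F l in F. norm (y l) \<le> D * e l ^ n" using assms(2) by (rule bigOE)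
  have "\<forall>\<^sub>F l in F. norm (x l + y l) \<le> (C + D) * e l ^ n"
    using C D
  proof eventually_elim
    case (elim l)
    then show ?case using norm_triangle_ineq[of "x l" "y l"] by (simp add: distrib_right)
  qed
  then show ?thesis by (rule bigOI)
qed

lemma bigO_bounded_linear:
  assumes "bounded_linear f" "bigO n x"
  shows "bigO n (\<lambda>l. f (x l))"
proof -
  obtain K where "\<And>x. norm (f x) \<le> norm x * K" using assms(1) bounded_linear.bounded by blast
  then show ?thesis
    by (intro bigO_dominated[OF assms(2), where K = K]) (simp add: mult.commute)
qed

lemma bigO_minus: "bigO n x \<Longrightarrow> bigO n (\<lambda>l. - x l)"
  by (rule bigO_bounded_linear[OF bounded_linear_minus[OF bounded_linear_ident]])

lemma bigO_diff: "bigO n x \<Longrightarrow> bigO n y \<Longrightarrow> bigO n (\<lambda>l. x l - y l)"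
  using bigO_add[of n x "\<lambda>l. - y l"] bigO_minus[of n y] by simp

lemma bigO_sum: "(\<And>i. i \<in> I \<Longrightarrow> bigO n (x i)) \<Longrightarrow> bigO n (\<lambda>l. \<Sum>i\<in>I. x i l)"
  by (induction I rule: infinite_finite_induct) (auto intro: bigO_zero bigO_add)

lemma bigO_bilinear:
  assumes "bounded_bilinear p" "bigO n x" "bigO m y"
  shows "bigO (n + m) (\<lambda>l. p (x l) (y l))"
proof -
  obtain C where C: "C \<ge> 0" "\<forall>\<^sub>F l in F. norm (x l) \<le> C * e l ^ n" using assms(2) by (rule bigOE)
  obtain D where D: "D \<ge> 0" "\<forall>\<^sub>F l in F. norm (y l) \<le> D * e l ^ m" using assms(3) by (rule bigOE)
  obtain K where K: "K \<ge> 0" "\<And>a b. norm (p a b) \<le> norm a * norm b * K"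
    using bounded_bilinear.nonneg_bounded[OF assms(1)] by blast
  have "\<forall>\<^sub>F l in F. norm (p (x l) (y l)) \<le> (K * C * D) * e l ^ (n + m)"
    using C(2) D(2) e_nonneg
  proof eventually_elim
    case (elim l)
    have "norm (p (x l) (y l)) \<le> norm (x l) * norm (y l) * K" by (rule K)
    also have "\<dots> \<le> (C * e l ^ n) * (D * e l ^ m) * K"
      using elim C D K by (intro mult_right_mono mult_mono) auto
    finally show ?case by (simp add: power_add mult_ac)
  qed
  then show ?thesis by (rule bigOI)
qed

lemma bigO_vec:
  fixes x :: "'i \<Rightarrow> 'b::real_normed_vector^'n"
  assumes "\<And>j. bigO n (\<lambda>l. x l $ j)"
  shows "bigO n x"
proof (rule bigO_dominated[where K = 1])
  have "bigO n (\<lambda>l. norm (x l $ j))" for j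
    by (rule bigO_dominated[OF assms[of j], where K = 1]) simp
  then show "bigO n (\<lambda>l. \<Sum>j\<in>UNIV. norm (x l $ j))"
    by (intro bigO_sum)
  show "\<forall>\<^sub>F l in F. norm (x l) \<le> 1 * norm (\<Sum>j\<in>UNIV. norm (x l $ j))"
  proof (intro always_eventually allI)
    fix l
    have "norm (x l) \<le> (\<Sum>j\<in>UNIV. norm (x l $ j))"
      unfolding norm_vec_def by (rule L2_set_le_sum) simp
    then show "norm (x l) \<le> 1 * norm (\<Sum>j\<in>UNIV. norm (x l $ j))" by simp
  qed
qed

lemma bigO_imp_tendsto:
  assumes "bigO (Suc n) x"
  shows "(x \<longlongrightarrow> 0) F"
proof -
  have "bigO 1 x" by (rule bigO_mono[OF assms]) simp
  then obtain C where "\<forall>\<^sub>F l in F. norm (x l) \<le> C * e l" by (auto simp: bigO_def)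
  moreover have "((\<lambda>l. C * e l) \<longlongrightarrow> 0) F" using tendsto_mult_right_zero[OF e_tendsto] .
  ultimately show ?thesis by (rule Lim_null_comparison)
qed

section \<open>Calculus of expansions with errors of order one and two\<close>

definition approx :: "('i \<Rightarrow> 'b::real_normed_vector) \<Rightarrow> 'b \<Rightarrow> bool" where
  "approx x x0 \<longleftrightarrow> bigO 1 (\<lambda>l. x l - x0)"

text \<open>The linear term is any family of order 1 and not a fixed linear map of some increment.
  Sums and products of expansions then combine without naming the underlying variables, and the
  linear term may be altered by order 2.\<close>

definition first_order :: "('i \<Rightarrow> 'b::real_normed_vector) \<Rightarrow> 'b \<Rightarrow> ('i \<Rightarrow> 'b) \<Rightarrow> bool" where
  "first_order x x0 x1 \<longleftrightarrow> bigO 1 x1 \<and> bigO 2 (\<lambda>l. x l - x0 - x1 l)"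

lemma approx_bounded:
  assumes "approx x x0"
  shows "bigO 0 x"
proof -
  have "bigO 0 (\<lambda>l. (x l - x0) + x0)"
    using assms unfolding approx_def by (intro bigO_add bigO_const) (rule bigO_mono, auto)
  then show ?thesis by simp
qed

lemma approx_const: "approx (\<lambda>_. c) c"
  by (simp add: approx_def bigO_zero)

lemma approx_add:
  assumes "approx x x0" "approx y y0"
  shows "approx (\<lambda>l. x l + y l) (x0 + y0)"
proof -
  have "bigO 1 (\<lambda>l. (x l - x0) + (y l - y0))"
    using assms unfolding approx_def by (rule bigO_add)
  then show ?thesis unfolding approx_def by (rule bigO_eq) simp
qed

lemma approx_bounded_linear:
  assumes "bounded_linear f" "approx x x0"
  shows "approx (\<lambda>l. f (x l)) (f x0)"
  using bigO_bounded_linear[OF assms(1) assms(2)[unfolded approx_def]]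
    linear_diff[OF bounded_linear.linear[OF assms(1)]] by (simp add: approx_def)

lemma approx_minus: "approx x x0 \<Longrightarrow> approx (\<lambda>l. - x l) (- x0)"
  by (rule approx_bounded_linear[OF bounded_linear_minus[OF bounded_linear_ident]])

lemma approx_sum:
  "(\<And>i. i \<in> I \<Longrightarrow> approx (x i) (x0 i)) \<Longrightarrow> approx (\<lambda>l. \<Sum>i\<in>I. x i l) (\<Sum>i\<in>I. x0 i)"
  by (induction I rule: infinite_finite_induct) (auto intro: approx_const approx_add)

lemma approx_bilinear:
  assumes "bounded_bilinear p" "approx x x0" "approx y y0"
  shows "approx (\<lambda>l. p (x l) (y l)) (p x0 y0)"
  unfolding approx_def
proof (rule bigO_eq)
  have "bigO 1 (\<lambda>l. p (x l - x0) (y l))"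
    using bigO_bilinear[OF assms(1) assms(2)[unfolded approx_def] approx_bounded[OF assms(3)]] by simp
  moreover have "bigO 1 (\<lambda>l. p x0 (y l - y0))"
    using bigO_bilinear[OF assms(1) bigO_const assms(3)[unfolded approx_def]] by simp
  ultimately show "bigO 1 (\<lambda>l. p (x l - x0) (y l) + p x0 (y l - y0))" by (rule bigO_add)
qed (simp add: bounded_bilinear.diff_left[OF assms(1)] bounded_bilinear.diff_right[OF assms(1)])

lemma first_order_imp_approx:
  assumes "first_order x x0 x1"
  shows "approx x x0"
proof -
  have "bigO 1 (\<lambda>l. x1 l + (x l - x0 - x1 l))"
    using assms unfolding first_order_def by (intro bigO_add) (auto intro: bigO_mono)
  then show ?thesis unfolding approx_def by (rule bigO_eq) simp
qed

lemma first_order_const: "first_order (\<lambda>_. c) c (\<lambda>_. 0)"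
  by (simp add: first_order_def bigO_zero)

lemma first_order_add:
  assumes "first_order x x0 x1" "first_order y y0 y1"
  shows "first_order (\<lambda>l. x l + y l) (x0 + y0) (\<lambda>l. x1 l + y1 l)"
proof -
  have "bigO 2 (\<lambda>l. (x l - x0 - x1 l) + (y l - y0 - y1 l))" "bigO 1 (\<lambda>l. x1 l + y1 l)"
    using assms unfolding first_order_def by (auto intro!: bigO_add)
  then show ?thesis unfolding first_order_def by (auto elim!: bigO_eq)
qed

lemma first_order_bounded_linear:
  assumes "bounded_linear f" "first_order x x0 x1"
  shows "first_order (\<lambda>l. f (x l)) (f x0) (\<lambda>l. f (x1 l))"
proof -
  have "bigO 2 (\<lambda>l. f (x l - x0 - x1 l))" "bigO 1 (\<lambda>l. f (x1 l))"
    using assms unfolding first_order_def by (auto intro: bigO_bounded_linear)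
  then show ?thesis
    using linear_diff[OF bounded_linear.linear[OF assms(1)]] unfolding first_order_def by simp
qed

lemma first_order_minus: "first_order x x0 x1 \<Longrightarrow> first_order (\<lambda>l. - x l) (- x0) (\<lambda>l. - x1 l)"
  by (rule first_order_bounded_linear[OF bounded_linear_minus[OF bounded_linear_ident]])

lemma first_order_sum:
  "(\<And>i. i \<in> I \<Longrightarrow> first_order (x i) (x0 i) (x1 i)) \<Longrightarrow>
   first_order (\<lambda>l. \<Sum>i\<in>I. x i l) (\<Sum>i\<in>I. x0 i) (\<lambda>l. \<Sum>i\<in>I. x1 i l)"
  by (induction I rule: infinite_finite_induct) (auto intro: first_order_const first_order_add)

lemma first_order_bilinear:
  assumes "bounded_bilinear p" "first_order x x0 x1" "first_order y y0 y1"
  shows "first_order (\<lambda>l. p (x l) (y l)) (p x0 y0) (\<lambda>l. p (x1 l) y0 + p x0 (y1 l))"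
proof -
  note a = assms(2,3)[unfolded first_order_def]
  have y: "approx y y0" by (rule first_order_imp_approx[OF assms(3)])
  have "bigO 2 (\<lambda>l. p (x l - x0 - x1 l) (y l))"
    using bigO_bilinear[OF assms(1) conjunct2[OF a(1)] approx_bounded[OF y]] by (simp add: numeral_2_eq_2)
  moreover have "bigO 2 (\<lambda>l. p (x1 l) (y l - y0))"
    using bigO_bilinear[OF assms(1) conjunct1[OF a(1)] y[unfolded approx_def]]
    by (simp add: numeral_2_eq_2)
  moreover have "bigO 2 (\<lambda>l. p x0 (y l - y0 - y1 l))"
    using bigO_bilinear[OF assms(1) bigO_const conjunct2[OF a(2)]] by (simp add: numeral_2_eq_2)
  ultimately have "bigO 2 (\<lambda>l. p (x l - x0 - x1 l) (y l) + p (x1 l) (y l - y0) + p x0 (y l - y0 - y1 l))"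
    by (intro bigO_add)
  then have "bigO 2 (\<lambda>l. p (x l) (y l) - p x0 y0 - (p (x1 l) y0 + p x0 (y1 l)))"
    by (rule bigO_eq)
      (simp add: bounded_bilinear.diff_left[OF assms(1)] bounded_bilinear.diff_right[OF assms(1)])
  moreover have "bigO 1 (\<lambda>l. p (x1 l) y0)"
    using bigO_bilinear[OF assms(1) conjunct1[OF a(1)] bigO_const] by simp
  moreover have "bigO 1 (\<lambda>l. p x0 (y1 l))"
    using bigO_bilinear[OF assms(1) bigO_const conjunct1[OF a(2)]] by simp
  ultimately show ?thesis
    unfolding first_order_def by (intro conjI bigO_add)
qed

lemma first_order_cong:
  "first_order x x0 x1 \<Longrightarrow> (\<And>l. y l = x l) \<Longrightarrow> y0 = x0 \<Longrightarrow> (\<And>l. y1 l = x1 l) \<Longrightarrow> first_order y y0 y1"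
  by (metis ext)

lemma approx_vec: "(\<And>j. approx (\<lambda>l. x l $ j) (x0 $ j)) \<Longrightarrow> approx x x0"
  unfolding approx_def by (rule bigO_vec) simp

lemma first_order_vec:
  "(\<And>j. first_order (\<lambda>l. x l $ j) (x0 $ j) (\<lambda>l. x1 l $ j)) \<Longrightarrow> first_order x x0 x1"
  unfolding first_order_def by (auto intro!: bigO_vec)

text \<open>Transfers the local estimates in powers of \<open>norm (y - z)\<close> to orders of the
  scale, along arguments that approach the centre at rate \<open>e\<close>. The last claim keeps
  them in the ball where the derivatives exist.\<close>

lemma thrice_differentiable_bigO:
  assumes g: "thrice_differentiable g z0" and z: "approx z z0"
  shows "bigO 1 (\<lambda>l. deriv2 g v w (z l) - deriv2 g v w z0)"
    and "bigO 2 (\<lambda>l. deriv1 g v (z l) - deriv1 g v z0 - deriv2 g v (z l - z0) z0)"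
    and "bigO 3 (\<lambda>l. g (z l) - g z0 - deriv1 g (z l - z0) z0 - deriv2 g (z l - z0) (z l - z0) z0 / 2)"
    and "\<forall>\<^sub>F l in F. z l \<in> ball z0 (thrice_differentiable.rad g z0)"
proof -
  interpret thrice_differentiable g z0 by (rule g)
  have lim: "(z \<longlongrightarrow> z0) F"
    using bigO_imp_tendsto[of 0 "\<lambda>l. z l - z0"] z by (simp add: approx_def LIM_zero_iff)
  have ball: "\<forall>\<^sub>F l in F. z l \<in> ball z0 r" if "r > 0" for r
    using lim that by (auto simp: tendsto_iff dist_commute)
  then show "\<forall>\<^sub>F l in F. z l \<in> ball z0 rad" using rad by blast
  obtain D where D: "D \<ge> 0" "\<forall>\<^sub>F l in F. norm (z l - z0) \<le> D * e l"
    using bigOE[OF z[unfolded approx_def]] by auto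
  have *: "bigO n x" if "0 < r" "0 \<le> C" "\<And>l. z l \<in> ball z0 r \<Longrightarrow> norm (x l) \<le> C * norm (z l - z0) ^ n"
    for x :: "'i \<Rightarrow> real" and r C n
  proof (rule bigOI)
    show "\<forall>\<^sub>F l in F. norm (x l) \<le> C * D ^ n * e l ^ n"
      using ball[OF that(1)] D(2)
    proof eventually_elim
      case (elim l)
      have "norm (x l) \<le> C * norm (z l - z0) ^ n" using elim that by simp
      also have "\<dots> \<le> C * (D * e l) ^ n" using elim that by (intro mult_left_mono power_mono) auto
      finally show ?case by (simp add: power_mult_distrib mult.assoc)
    qed
  qed
  show "bigO 1 (\<lambda>l. deriv2 g v w (z l) - deriv2 g v w z0)"
  proof -
    obtain r C where h: "0 < r" "0 \<le> C" "\<forall>y\<in>ball z0 r. \<forall>v w.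
      \<bar>deriv2 g v w y - deriv2 g v w z0\<bar> \<le> C * norm v * norm w * norm (y - z0)"
      using ex_deriv2_lipschitz by (elim exE conjE)
    then show ?thesis by (intro *[OF h(1), of "C * norm v * norm w"]) auto
  qed
  show "bigO 2 (\<lambda>l. deriv1 g v (z l) - deriv1 g v z0 - deriv2 g v (z l - z0) z0)"
  proof -
    obtain r C where h: "0 < r" "0 \<le> C" "\<forall>y\<in>ball z0 r. \<forall>v.
      \<bar>deriv1 g v y - deriv1 g v z0 - deriv2 g v (y - z0) z0\<bar> \<le> C * norm v * (norm (y - z0))\<^sup>2"
      using ex_deriv1_expansion by (elim exE conjE)
    then show ?thesis by (intro *[OF h(1), of "C * norm v"]) auto
  qed
  show "bigO 3 (\<lambda>l. g (z l) - g z0 - deriv1 g (z l - z0) z0 - deriv2 g (z l - z0) (z l - z0) z0 / 2)"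
  proof -
    obtain r C where h: "0 < r" "0 \<le> C" "\<forall>y\<in>ball z0 r.
      \<bar>g y - g z0 - deriv1 g (y - z0) z0 - deriv2 g (y - z0) (y - z0) z0 / 2\<bar> \<le> C * (norm (y - z0))^3"
      using ex_second_order_expansion by (elim exE conjE)
    then show ?thesis by (intro *[OF h(1), of C]) auto
  qed
qed

end


section \<open>Partial gradients and Hessians\<close>

lemma jacobian_component:
  assumes "(f has_derivative f') (at x)"
  shows "jacobian f (at x) $ i $ j = f' (axis j 1) $ i"
  using frechet_derivative_at[OF assms] by (simp add: jacobian_def matrix_def)

lemma has_derivative_vecI:
  fixes f :: "'a::real_normed_vector \<Rightarrow> real^'n"
  assumes "\<And>i. ((\<lambda>x. f x $ i) has_derivative (\<lambda>h. f' h $ i)) (at x)"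
  shows "(f has_derivative f') (at x)"
  by (subst has_derivative_componentwise_within) (auto simp: Basis_vec_def inner_axis assms)

lemma linear_functional_vec:
  fixes f :: "real^'n \<Rightarrow> real"
  assumes "linear f"
  shows "f v = (\<chi> i. f (axis i 1)) \<bullet> v"
proof -
  have "f v = f (\<Sum>i\<in>UNIV. v $ i *\<^sub>R axis i 1)"
    using basis_expansion[of v] by (simp add: scalar_mult_eq_scaleR)
  also have "\<dots> = (\<chi> i. f (axis i 1)) \<bullet> v"
    using assms by (simp add: linear_sum linear_scale inner_vec_def mult.commute)
  finally show ?thesis .
qed

lemma linear_Pair_split: "linear f \<Longrightarrow> f (v, w) = f (v, 0) + f (0, w)"
  using linear_add[of f "(v, 0)" "(0, w)"] by simp

lemma linear_Pair_left: "linear f \<Longrightarrow> linear (\<lambda>v. f (v, 0))"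
  by (rule linear_compose[of "\<lambda>v. (v, 0)" f, unfolded o_def]) (auto intro!: linearI)

lemma linear_Pair_right: "linear f \<Longrightarrow> linear (\<lambda>w. f (0, w))"
  by (rule linear_compose[of "\<lambda>w. (0, w)" f, unfolded o_def]) (auto intro!: linearI)

text \<open>Differentiability is assumed jointly in \<open>(x, u)\<close>, while the iteration uses
  partial gradients and Hessians. The entries of the latter are identified with joint derivatives in
  coordinate directions on the whole ball \<open>N\<close>, because they are evaluated at moving
  points.\<close>

locale thrice_differentiable_bivariate =
  fixes g :: "real^'a \<Rightarrow> real^'m \<Rightarrow> real" and x0 u0
  assumes thrice_bivariate: "thrice_differentiable (\<lambda>(x, u). g x u) (x0, u0)"
begin

abbreviation G where "G \<equiv> \<lambda>(x, u). g x u"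

sublocale G: thrice_differentiable G "(x0, u0)"
  by (rule thrice_bivariate)

abbreviation "N \<equiv> ball (x0, u0) G.rad"

lemma eventually_N:
  assumes "(x, u) \<in> N"
  shows "\<forall>\<^sub>F x' in nhds x. (x', u) \<in> N" "\<forall>\<^sub>F u' in nhds u. (x, u') \<in> N"
proof -
  have "((\<lambda>x'. (x', u)) \<longlongrightarrow> (x, u)) (nhds x)" "((\<lambda>u'. (x, u')) \<longlongrightarrow> (x, u)) (nhds u)"
    by (auto intro!: tendsto_intros filterlim_ident)
  from this[THEN topological_tendstoD, OF open_ball assms]
  show "\<forall>\<^sub>F x' in nhds x. (x', u) \<in> N" "\<forall>\<^sub>F u' in nhds u. (x, u') \<in> N" .
qed

lemma has_derivative_partial:
  assumes "(H has_derivative H') (at (x, u))"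
  shows "((\<lambda>x. H (x, u)) has_derivative (\<lambda>h. H' (h, 0))) (at x)"
    and "((\<lambda>u. H (x, u)) has_derivative (\<lambda>h. H' (0, h))) (at u)"
proof -
  have "((\<lambda>x. (x, u)) has_derivative (\<lambda>h. (h, 0))) (at x)"
    "((\<lambda>u. (x, u)) has_derivative (\<lambda>h. (0, h))) (at u)"
    by (auto intro!: has_derivative_Pair has_derivative_ident has_derivative_const)
  from this[THEN has_derivative_compose, OF assms]
  show "((\<lambda>x. H (x, u)) has_derivative (\<lambda>h. H' (h, 0))) (at x)"
    "((\<lambda>u. H (x, u)) has_derivative (\<lambda>h. H' (0, h))) (at u)" .
qed

lemma grad_x: "(x, u) \<in> N \<Longrightarrow> grad (\<lambda>x. g x u) x $ i = deriv1 G (axis i 1, 0) (x, u)"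
  using fun_cong[OF frechet_derivative_at[OF has_derivative_partial(1)[OF G.has_derivative_deriv1[of "(x, u)"]]], of "axis i 1"]
  by (simp add: grad_def del: mem_ball)

lemma grad_u: "(x, u) \<in> N \<Longrightarrow> grad (\<lambda>u. g x u) u $ i = deriv1 G (0, axis i 1) (x, u)"
  using fun_cong[OF frechet_derivative_at[OF has_derivative_partial(2)[OF G.has_derivative_deriv1[of "(x, u)"]]], of "axis i 1"]
  by (simp add: grad_def del: mem_ball)

lemma hess_x:
  assumes N: "(x, u) \<in> N"
  shows "hess (\<lambda>x. g x u) x $ i $ j = deriv2 G (axis i 1, 0) (axis j 1, 0) (x, u)"
proof -
  have "((\<lambda>x. \<chi> i. deriv1 G (axis i 1, 0) (x, u)) has_derivative
      (\<lambda>h. \<chi> i. deriv2 G (axis i 1, 0) (h, 0) (x, u))) (at x)"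
    by (rule has_derivative_vecI) (simp add: has_derivative_partial(1)[OF G.has_derivative_deriv2[OF N]])
  moreover have "\<forall>\<^sub>F x' in nhds x. (\<chi> i. deriv1 G (axis i 1, 0) (x', u)) = grad (\<lambda>x. g x u) x'"
    using eventually_N(1)[OF N] by eventually_elim (simp add: vec_eq_iff grad_x)
  ultimately have "(grad (\<lambda>x. g x u) has_derivative
      (\<lambda>h. \<chi> i. deriv2 G (axis i 1, 0) (h, 0) (x, u))) (at x)"
    by (rule has_derivative_cong_eventually[THEN iffD1, rotated])
  then show ?thesis by (simp add: hess_def jacobian_component)
qed

lemma hess_u:
  assumes N: "(x, u) \<in> N"
  shows "hess (\<lambda>u. g x u) u $ i $ j = deriv2 G (0, axis i 1) (0, axis j 1) (x, u)"
proof -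
  have "((\<lambda>u. \<chi> i. deriv1 G (0, axis i 1) (x, u)) has_derivative
      (\<lambda>h. \<chi> i. deriv2 G (0, axis i 1) (0, h) (x, u))) (at u)"
    by (rule has_derivative_vecI) (simp add: has_derivative_partial(2)[OF G.has_derivative_deriv2[OF N]])
  moreover have "\<forall>\<^sub>F u' in nhds u. (\<chi> i. deriv1 G (0, axis i 1) (x, u')) = grad (\<lambda>u. g x u) u'"
    using eventually_N(2)[OF N] by eventually_elim (simp add: vec_eq_iff grad_u)
  ultimately have "(grad (\<lambda>u. g x u) has_derivative
      (\<lambda>h. \<chi> i. deriv2 G (0, axis i 1) (0, h) (x, u))) (at u)"
    by (rule has_derivative_cong_eventually[THEN iffD1, rotated])
  then show ?thesis by (simp add: hess_def jacobian_component)
qed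

lemma hess_xu:
  assumes N: "(x, u) \<in> N"
  shows "hess_xu g x u $ i $ j = deriv2 G (axis i 1, 0) (0, axis j 1) (x, u)"
proof -
  have "((\<lambda>u. \<chi> i. deriv1 G (axis i 1, 0) (x, u)) has_derivative
      (\<lambda>h. \<chi> i. deriv2 G (axis i 1, 0) (0, h) (x, u))) (at u)"
    by (rule has_derivative_vecI) (simp add: has_derivative_partial(2)[OF G.has_derivative_deriv2[OF N]])
  moreover have "\<forall>\<^sub>F u' in nhds u. (\<chi> i. deriv1 G (axis i 1, 0) (x, u')) = grad (\<lambda>x. g x u') x"
    using eventually_N(2)[OF N] by eventually_elim (simp add: vec_eq_iff grad_x)
  ultimately have "((\<lambda>w. grad (\<lambda>y. g y w) x) has_derivative
      (\<lambda>h. \<chi> i. deriv2 G (axis i 1, 0) (0, h) (x, u))) (at u)"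
    by (rule has_derivative_cong_eventually[THEN iffD1, rotated])
  then show ?thesis by (simp add: hess_xu_def jacobian_component)
qed

lemmas partials_at_center =
  grad_x[OF G.z_in_ball] grad_u[OF G.z_in_ball]
  hess_x[OF G.z_in_ball] hess_u[OF G.z_in_ball] hess_xu[OF G.z_in_ball]

text \<open>\<open>deriv2_commute\<close> speaks of the centre only, and the centre is where
  symmetry gets used: the algebra of the backward step at the iterates does not rely on it.\<close>

lemma transpose_hess:
  shows "transpose (hess (\<lambda>x. g x u0) x0) = hess (\<lambda>x. g x u0) x0"
    and "transpose (hess (\<lambda>u. g x0 u) u0) = hess (\<lambda>u. g x0 u) u0"
  using G.deriv2_commute by (simp_all add: transpose_def vec_eq_iff partials_at_center)

abbreviation "gx \<equiv> grad (\<lambda>x. g x u0) x0"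
abbreviation "gu \<equiv> grad (\<lambda>u. g x0 u) u0"
abbreviation "gxx \<equiv> hess (\<lambda>x. g x u0) x0"
abbreviation "guu \<equiv> hess (\<lambda>u. g x0 u) u0"
abbreviation "gxu \<equiv> hess_xu g x0 u0"

lemma deriv1_eq: "deriv1 G (v, w) (x0, u0) = gx \<bullet> v + gu \<bullet> w"
proof -
  have 1: "deriv1 G (v, 0) (x0, u0) = gx \<bullet> v"
    using linear_functional_vec[OF linear_Pair_left[OF G.linear_deriv1[OF G.z_in_ball]], of v]
    by (simp add: inner_vec_def partials_at_center)
  have 2: "deriv1 G (0, w) (x0, u0) = gu \<bullet> w"
    using linear_functional_vec[OF linear_Pair_right[OF G.linear_deriv1[OF G.z_in_ball]], of w]
    by (simp add: inner_vec_def partials_at_center)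
  show ?thesis
    using linear_Pair_split[OF G.linear_deriv1[OF G.z_in_ball], of v w] by (simp only: 1 2)
qed

lemma deriv2_x_eq: "deriv2 G (axis i 1, 0) (v, w) (x0, u0) = (gxx *v v + gxu *v w) $ i"
proof -
  have 1: "deriv2 G (axis i 1, 0) (v, 0) (x0, u0) = (gxx *v v) $ i"
    using linear_functional_vec[OF linear_Pair_left[OF G.linear_deriv2[OF G.z_in_ball]], of "(axis i 1, 0)" v]
    by (simp add: inner_vec_def partials_at_center matrix_vector_mult_def)
  have 2: "deriv2 G (axis i 1, 0) (0, w) (x0, u0) = (gxu *v w) $ i"
    using linear_functional_vec[OF linear_Pair_right[OF G.linear_deriv2[OF G.z_in_ball]], of "(axis i 1, 0)" w]
    by (simp add: inner_vec_def partials_at_center matrix_vector_mult_def)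
  show ?thesis
    using linear_Pair_split[OF G.linear_deriv2[OF G.z_in_ball], of "(axis i 1, 0)" v w]
    by (simp add: 1 2)
qed

lemma deriv2_u_eq: "deriv2 G (0, axis i 1) (v, w) (x0, u0) = (transpose gxu *v v + guu *v w) $ i"
proof -
  have 1: "deriv2 G (0, axis i 1) (v, 0) (x0, u0) = (transpose gxu *v v) $ i"
    using linear_functional_vec[OF linear_Pair_left[OF G.linear_deriv2[OF G.z_in_ball]], of "(0, axis i 1)" v]
      G.deriv2_commute[of "(0, axis i 1)"]
    by (simp add: inner_vec_def partials_at_center matrix_vector_mult_def transpose_def del: transpose_matrix_vector)
  have 2: "deriv2 G (0, axis i 1) (0, w) (x0, u0) = (guu *v w) $ i"
    using linear_functional_vec[OF linear_Pair_right[OF G.linear_deriv2[OF G.z_in_ball]], of "(0, axis i 1)" w]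
    by (simp add: inner_vec_def partials_at_center matrix_vector_mult_def)
  show ?thesis
    using linear_Pair_split[OF G.linear_deriv2[OF G.z_in_ball], of "(0, axis i 1)" v w]
    by (simp add: 1 2 del: transpose_matrix_vector)
qed

lemma deriv2_eq:
  "deriv2 G (v, w) (v, w) (x0, u0) = v \<bullet> (gxx *v v) + 2 * (v \<bullet> (gxu *v w)) + w \<bullet> (guu *v w)"
proof -
  note lin = G.linear_deriv2_left[OF G.z_in_ball, of "(v, w)"]
  have 1: "deriv2 G (v, 0) (v, w) (x0, u0) = v \<bullet> (gxx *v v + gxu *v w)"
    using linear_functional_vec[OF linear_Pair_left[OF lin], of v]
    by (simp add: inner_vec_def deriv2_x_eq mult.commute)
  have 2: "deriv2 G (0, w) (v, w) (x0, u0) = w \<bullet> (transpose gxu *v v + guu *v w)"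
    using linear_functional_vec[OF linear_Pair_right[OF lin], of w]
    by (simp add: inner_vec_def deriv2_u_eq mult.commute del: transpose_matrix_vector)
  have 3: "w \<bullet> (transpose gxu *v v) = v \<bullet> (gxu *v w)"
    by (simp add: dot_lmul_matrix[symmetric] inner_commute)
  show ?thesis
    using linear_Pair_split[OF lin, of v w] 1 2 3 by (simp add: inner_add_right)
qed

end

section \<open>Expansions of values, gradients and Hessians along converging arguments\<close>

context asymptotic_scale
begin

lemma bigO_norm: "bigO n x \<Longrightarrow> bigO n (\<lambda>l. norm (x l))"
  by (rule bigO_dominated[where K = 1]) auto

lemma approx_Pair: "approx x x0 \<Longrightarrow> approx u u0 \<Longrightarrow> approx (\<lambda>l. (x l, u l)) (x0, u0)"
  unfolding approx_def
proof -
  assume a: "bigO 1 (\<lambda>l. x l - x0)" "bigO 1 (\<lambda>l. u l - u0)"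
  have "bigO 1 (\<lambda>l. norm (x l - x0) + norm (u l - u0))"
    using a by (intro bigO_add bigO_norm)
  then show "bigO 1 (\<lambda>l. (x l, u l) - (x0, u0))"
    by (rule bigO_dominated[where K = 1]) (simp add: norm_Pair_le)
qed

context
  fixes g :: "real^'a \<Rightarrow> real^'m \<Rightarrow> real" and x u x0 u0
  assumes g: "thrice_differentiable_bivariate g x0 u0"
    and x: "approx x x0" and u: "approx u u0"
begin

interpretation thrice_differentiable_bivariate g x0 u0 by (rule g)

lemmas expansions = thrice_differentiable_bigO[OF thrice_bivariate approx_Pair[OF x u]]

lemma first_order_grad_x:
  "first_order (\<lambda>l. grad (\<lambda>x. g x (u l)) (x l)) gx (\<lambda>l. gxx *v (x l - x0) + gxu *v (u l - u0))"
proof (rule first_order_vec)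
  fix j
  have "bigO 1 (\<lambda>l. (gxx *v (x l - x0) + gxu *v (u l - u0)) $ j)"
    using x u unfolding approx_def
    by (intro bigO_bounded_linear[OF bounded_linear_vec_nth] bigO_add
        bigO_bounded_linear[OF matrix_vector_mul_bounded_linear])
  moreover have "bigO 2 (\<lambda>l. grad (\<lambda>x. g x (u l)) (x l) $ j - gx $ j
      - (gxx *v (x l - x0) + gxu *v (u l - u0)) $ j)"
    by (rule bigO_cong[OF expansions(2)[of "(axis j 1, 0)"]], use expansions(4) in eventually_elim)
       (simp add: grad_x partials_at_center deriv2_x_eq)
  ultimately show "first_order (\<lambda>l. grad (\<lambda>x. g x (u l)) (x l) $ j) (gx $ j)
      (\<lambda>l. (gxx *v (x l - x0) + gxu *v (u l - u0)) $ j)"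
    by (simp add: first_order_def)
qed

lemma first_order_grad_u:
  "first_order (\<lambda>l. grad (\<lambda>u. g (x l) u) (u l)) gu
     (\<lambda>l. transpose gxu *v (x l - x0) + guu *v (u l - u0))"
proof (rule first_order_vec)
  fix j
  have "bigO 1 (\<lambda>l. (transpose gxu *v (x l - x0) + guu *v (u l - u0)) $ j)"
    using x u unfolding approx_def
    by (intro bigO_bounded_linear[OF bounded_linear_vec_nth] bigO_add
        bigO_bounded_linear[OF matrix_vector_mul_bounded_linear])
  moreover have "bigO 2 (\<lambda>l. grad (\<lambda>u. g (x l) u) (u l) $ j - gu $ j
      - (transpose gxu *v (x l - x0) + guu *v (u l - u0)) $ j)"
    by (rule bigO_cong[OF expansions(2)[of "(0, axis j 1)"]], use expansions(4) in eventually_elim)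
       (simp add: grad_u partials_at_center deriv2_u_eq del: transpose_matrix_vector)
  ultimately show "first_order (\<lambda>l. grad (\<lambda>u. g (x l) u) (u l) $ j) (gu $ j)
      (\<lambda>l. (transpose gxu *v (x l - x0) + guu *v (u l - u0)) $ j)"
    by (simp add: first_order_def)
qed

lemma approx_hess_x: "approx (\<lambda>l. hess (\<lambda>x. g x (u l)) (x l)) gxx"
  unfolding approx_def
  by (intro bigO_vec, rule bigO_cong[OF expansions(1)], use expansions(4) in eventually_elim)
     (simp add: hess_x partials_at_center)

lemma approx_hess_u: "approx (\<lambda>l. hess (\<lambda>u. g (x l) u) (u l)) guu"
  unfolding approx_def
  by (intro bigO_vec, rule bigO_cong[OF expansions(1)], use expansions(4) in eventually_elim)
     (simp add: hess_u partials_at_center)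

lemma approx_hess_xu: "approx (\<lambda>l. hess_xu g (x l) (u l)) gxu"
  unfolding approx_def
  by (intro bigO_vec, rule bigO_cong[OF expansions(1)], use expansions(4) in eventually_elim)
     (simp add: hess_xu partials_at_center)

lemma bigO_second_order:
  "bigO 3 (\<lambda>l. g (x l) (u l) - g x0 u0 - gx \<bullet> (x l - x0) - gu \<bullet> (u l - u0)
     - ((x l - x0) \<bullet> (gxx *v (x l - x0)) + 2 * ((x l - x0) \<bullet> (gxu *v (u l - u0)))
        + (u l - u0) \<bullet> (guu *v (u l - u0))) / 2)"
  by (rule bigO_eq[OF expansions(3)]) (simp add: deriv1_eq deriv2_eq)

lemma first_order_value:
  "first_order (\<lambda>l. g (x l) (u l)) (g x0 u0) (\<lambda>l. gx \<bullet> (x l - x0) + gu \<bullet> (u l - u0))"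
  unfolding first_order_def
proof
  have dx: "bigO 1 (\<lambda>l. x l - x0)" and du: "bigO 1 (\<lambda>l. u l - u0)"
    using x u by (simp_all add: approx_def)
  show "bigO 1 (\<lambda>l. gx \<bullet> (x l - x0) + gu \<bullet> (u l - u0))"
    using dx du by (intro bigO_add bigO_bounded_linear[OF bounded_linear_inner_right])
  have bil: "bigO 2 (\<lambda>l. y l \<bullet> (A *v w l))" if "bigO 1 y" "bigO 1 w"
    for y :: "'i \<Rightarrow> real^'r" and A :: "real^'c^'r" and w :: "'i \<Rightarrow> real^'c"
    using bigO_bilinear[OF bounded_bilinear_inner that(1)
        bigO_bounded_linear[OF matrix_vector_mul_bounded_linear that(2)]] by (simp add: numeral_2_eq_2)
  have quad: "bigO 2 (\<lambda>l. ((x l - x0) \<bullet> (gxx *v (x l - x0)) + (2::real) *\<^sub>R ((x l - x0) \<bullet> (gxu *v (u l - u0)))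
        + (u l - u0) \<bullet> (guu *v (u l - u0))) /\<^sub>R 2)"
    using bil[OF dx dx] bil[OF dx du] bil[OF du du]
    by (intro bigO_bounded_linear[OF bounded_linear_scaleR_right] bigO_add)
  show "bigO 2 (\<lambda>l. g (x l) (u l) - g x0 u0 - (gx \<bullet> (x l - x0) + gu \<bullet> (u l - u0)))"
    by (rule bigO_eq[OF bigO_add[OF bigO_mono[OF bigO_second_order] quad]]) (auto simp: field_simps)
qed

end

end


section \<open>Matrix calculus and the backward recursion\<close>

lemma bounded_bilinear_matrix_vector_mult:
  "bounded_bilinear ((*v) :: real^'n^'m \<Rightarrow> real^'n \<Rightarrow> real^'m)"
  by (subst bilinear_conv_bounded_bilinear[symmetric])
     (auto simp: bilinear_def matrix_vector_mult_add_rdistrib scaleR_matrix_vector_assoc intro!: linearI)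

lemma bounded_bilinear_matrix_matrix_mult:
  "bounded_bilinear ((**) :: real^'n^'m \<Rightarrow> real^'p^'n \<Rightarrow> real^'p^'m)"
  by (subst bilinear_conv_bounded_bilinear[symmetric])
     (auto simp: bilinear_def vec_eq_iff matrix_matrix_mult_def sum.distrib distrib_left distrib_right
        sum_distrib_left mult_ac intro!: linearI)

lemma linear_transpose: "linear (transpose :: real^'n^'m \<Rightarrow> real^'m^'n)"
  by (rule linearI) (simp_all add: vec_eq_iff transpose_def)

lemma bounded_linear_transpose: "bounded_linear (transpose :: real^'n^'m \<Rightarrow> real^'m^'n)"
  using linear_transpose by (simp add: linear_conv_bounded_linear)

lemma
  assumes "invertible (A :: real^'n^'n)"
  shows matrix_inv_right: "A ** matrix_inv A = mat 1"
    and matrix_inv_left: "matrix_inv A ** A = mat 1"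
  using someI_ex[OF assms[unfolded invertible_def]] by (auto simp: matrix_inv_def)

text \<open>\<open>pos_def\<close> does not include symmetry, so the argument goes through the
  trivial kernel.\<close>

lemma pos_def_imp_invertible:
  assumes "pos_def A"
  shows "invertible A"
proof -
  have "x = 0" if "A *v x = 0" for x
    using assms that unfolding pos_def_def by (metis inner_zero_right less_irrefl)
  then show ?thesis
    using invertible_left_inverse matrix_left_invertible_ker by blast
qed

lemma inner_transpose_matrix: "x \<bullet> (transpose A *v y) = (A *v x) \<bullet> y" for A :: "real^'n^'m"
  using dot_lmul_matrix[of y A x] by (simp add: inner_commute)

context asymptotic_scale
begin

text \<open>Resolvent identity: the difference of the inverses is minus
  \<open>matrix_inv (A l) ** (A l - A0) ** matrix_inv A0\<close>. The first factor needs an a priori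
  bound: once \<open>A l\<close> is close to \<open>A0\<close>, the identity gives a difference of
  at most half the norm of \<open>matrix_inv (A l)\<close>, which is absorbed.\<close>

lemma approx_matrix_inv:
  fixes A :: "'i \<Rightarrow> real^'n^'n"
  assumes A: "approx A A0" and A0: "invertible A0" and ev: "\<forall>\<^sub>F l in F. invertible (A l)"
  shows "approx (\<lambda>l. matrix_inv (A l)) (matrix_inv A0)"
proof -
  interpret mm: bounded_bilinear "(**) :: real^'n^'n \<Rightarrow> real^'n^'n \<Rightarrow> real^'n^'n"
    by (rule bounded_bilinear_matrix_matrix_mult)
  let ?I = "\<lambda>l. matrix_inv (A l)" and ?J = "matrix_inv A0"
  have id: "?I l - ?J = - (?I l ** (A l - A0) ** ?J)" if "invertible (A l)" for l
    using matrix_inv_left[OF that] matrix_inv_right[OF A0]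
    by (simp add: mm.diff_right mm.diff_left matrix_mul_assoc[symmetric])
  obtain K where K: "K \<ge> 0" "\<forall>(B :: real^'n^'n) (C :: real^'n^'n). norm (B ** C) \<le> norm B * norm C * K"
    using mm.nonneg_bounded by (elim exE conjE)
  have "((\<lambda>l. norm (A l - A0) * K * norm ?J * K) \<longlongrightarrow> 0) F"
    using bigO_imp_tendsto[of 0 "\<lambda>l. A l - A0"] A unfolding approx_def
    by (auto intro!: tendsto_mult_left_zero tendsto_norm_zero)
  then have half: "\<forall>\<^sub>F l in F. norm (A l - A0) * K * norm ?J * K < 1 / 2"
    by (rule order_tendstoD) simp
  have "bigO 0 ?I"
  proof (rule bigOI[where C = "2 * norm ?J"])
    show "\<forall>\<^sub>F l in F. norm (?I l) \<le> 2 * norm ?J * e l ^ 0"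
      using ev half
    proof eventually_elim
      case (elim l)
      have "norm (?I l ** (A l - A0) ** ?J) \<le> norm (?I l ** (A l - A0)) * norm ?J * K"
        using K by blast
      also have "\<dots> \<le> (norm (?I l) * norm (A l - A0) * K) * norm ?J * K"
        using K by (intro mult_right_mono) auto
      also have "\<dots> = norm (?I l) * (norm (A l - A0) * K * norm ?J * K)" by (simp add: mult_ac)
      also have "\<dots> \<le> norm (?I l) * (1/2)" using elim by (intro mult_left_mono) auto
      finally have "norm (?I l - ?J) \<le> norm (?I l) / 2" by (simp add: id elim)
      then show ?case
        using norm_triangle_ineq2[of "?I l" ?J] by simp
    qed
  qed
  then have "bigO 1 (\<lambda>l. - (?I l ** (A l - A0) ** ?J))"
    using bigO_bilinear[OF bounded_bilinear_matrix_matrix_mult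
       bigO_bilinear[OF bounded_bilinear_matrix_matrix_mult _ A[unfolded approx_def]] bigO_const[of ?J], of 0]
    by (intro bigO_minus) simp
  then show ?thesis
    unfolding approx_def by (rule bigO_cong) (use ev in \<open>auto elim!: eventually_mono simp: id\<close>)
qed

text \<open>Since \<open>x\<close> vanishes in the limit, only the limit of the factor
  \<open>A\<close> enters the linear term. So inverses, gains and Hessians that multiply
  \<open>Qu\<close> or \<open>ell\<close> need no first-order expansion.\<close>

lemma first_order_bilinear_null:
  assumes "bounded_bilinear p" "approx A A0" "first_order x 0 x1"
  shows "first_order (\<lambda>l. p (A l) (x l)) 0 (\<lambda>l. p A0 (x1 l))"
proof -
  note x = assms(3)[unfolded first_order_def]
  have "bigO 2 (\<lambda>l. p (A l - A0) (x l) + p A0 (x l - 0 - x1 l))"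
    using bigO_bilinear[OF assms(1) assms(2)[unfolded approx_def]
        first_order_imp_approx[OF assms(3), unfolded approx_def]]
      bigO_bilinear[OF assms(1) bigO_const[of A0] conjunct2[OF x]]
    by (intro bigO_add) (simp_all add: numeral_2_eq_2)
  moreover have "bigO 1 (\<lambda>l. p A0 (x1 l))"
    using bigO_bilinear[OF assms(1) bigO_const[of A0] conjunct1[OF x]] by simp
  ultimately show ?thesis
    by (simp add: first_order_def bounded_bilinear.diff_left[OF assms(1)] bounded_bilinear.diff_right[OF assms(1)])
qed

end

section \<open>Algebra of one backward step\<close>

abbreviation Qu :: "(real^'a, real^'m) ocp \<Rightarrow> (nat \<Rightarrow> real^'m) \<Rightarrow> nat \<Rightarrow> real^'m" where
  "Qu P U k \<equiv> Qu_of P U k (Vx P U (Suc k))"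

abbreviation Qx :: "(real^'a, real^'m) ocp \<Rightarrow> (nat \<Rightarrow> real^'m) \<Rightarrow> nat \<Rightarrow> real^'a" where
  "Qx P U k \<equiv> Qx_of P U k (Vx P U (Suc k))"

abbreviation Qxx :: "(real^'a, real^'m) ocp \<Rightarrow> (nat \<Rightarrow> real^'m) \<Rightarrow> nat \<Rightarrow> real^'a^'a" where
  "Qxx P U k \<equiv> Qxx_of P U k (Vx P U (Suc k)) (Vxx P U (Suc k))"

abbreviation Qxu :: "(real^'a, real^'m) ocp \<Rightarrow> (nat \<Rightarrow> real^'m) \<Rightarrow> nat \<Rightarrow> real^'m^'a" where
  "Qxu P U k \<equiv> Qxu_of P U k (Vx P U (Suc k)) (Vxx P U (Suc k))"

lemma value_final:
  "Vx P U (steps P) = grad (final_cost P) (states P U (steps P))"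
  "Vxx P U (steps P) = hess (final_cost P) (states P U (steps P))"
  by (simp_all add: Vx_def Vxx_def)

lemma Quu_ell:
  assumes "pos_def (Quu P U k)"
  shows "Quu P U k *v ell P U k = - Qu P U k"
proof -
  have "Quu P U k *v (matrix_inv (Quu P U k) *v Qu P U k) = Qu P U k"
    using matrix_inv_right[OF pos_def_imp_invertible[OF assms]] by (simp add: matrix_vector_mul_assoc)
  then show ?thesis
    unfolding ell_def ell_of_def Quu_def[symmetric]
    by (simp add: bounded_bilinear.minus_right[OF bounded_bilinear_matrix_vector_mult])
qed

lemma Quu_Sigma:
  assumes "pos_def (Quu P U k)"
  shows "Quu P U k ** Sigma_gain P U k = - transpose (Qxu P U k)"
proof -
  have "Quu P U k ** (matrix_inv (Quu P U k) ** transpose (Qxu P U k)) = transpose (Qxu P U k)"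
    using matrix_inv_right[OF pos_def_imp_invertible[OF assms]] by (simp add: matrix_mul_assoc)
  then show ?thesis
    unfolding Sigma_gain_def Sigma_of_def Quu_def[symmetric]
    by (simp add: bounded_bilinear.minus_right[OF bounded_bilinear_matrix_matrix_mult])
qed

text \<open>The defining equations of \<open>ell\<close> and \<open>Sigma_gain\<close> make
  \<open>Quu *v ell + Qu\<close> and \<open>Quu ** Sigma_gain + transpose Qxu\<close> vanish, so all
  summands containing the transposed gain cancel, without any symmetry.\<close>

lemma value_step:
  assumes "k < steps P" "pos_def (Quu P U k)"
  shows "Vx P U k = Qx P U k + Qxu P U k *v ell P U k"
    and "Vxx P U k = Qxx P U k + Qxu P U k ** Sigma_gain P U k"
proof -
  \<comment> \<open>\<open>value_expansion\<close> counts the remaining stages, so stage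
    \<open>k\<close> is its successor case for \<open>steps P - Suc k\<close>.\<close>
  have k: "steps P - k = Suc (steps P - Suc k)" "steps P - Suc (steps P - Suc k) = k"
    using assms by auto
  have "Vx P U k = Qx P U k + transpose (Sigma_gain P U k) *v (Quu P U k *v ell P U k)
      + transpose (Sigma_gain P U k) *v Qu P U k + Qxu P U k *v ell P U k"
    unfolding Vx_def[of P U k] k(1) value_expansion.simps Let_def k(2) fst_conv
    by (simp add: Vx_def Vxx_def ell_def Sigma_gain_def Quu_def)
  then show "Vx P U k = Qx P U k + Qxu P U k *v ell P U k"
    by (simp add: Quu_ell[OF assms(2)] bounded_bilinear.minus_right[OF bounded_bilinear_matrix_vector_mult]
      del: transpose_matrix_vector)
  have "Vxx P U k = Qxx P U k + transpose (Sigma_gain P U k) ** Quu P U k ** Sigma_gain P U k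
      + transpose (Sigma_gain P U k) ** transpose (Qxu P U k) + Qxu P U k ** Sigma_gain P U k"
    unfolding Vxx_def[of P U k] k(1) value_expansion.simps Let_def k(2) snd_conv
    by (simp add: Vx_def Vxx_def ell_def Sigma_gain_def Quu_def)
  then show "Vxx P U k = Qxx P U k + Qxu P U k ** Sigma_gain P U k"
    by (simp add: Quu_Sigma[OF assms(2)] matrix_mul_assoc[symmetric]
       bounded_bilinear.minus_right[OF bounded_bilinear_matrix_matrix_mult])
qed

lemma states_new_controls: "states P (new_controls P U \<gamma>) k = new_states P U \<gamma> k"
  by (induction k) (simp_all add: new_controls_def)

lemma states_cong: "(\<And>j. j < k \<Longrightarrow> U j = U' j) \<Longrightarrow> states P U k = states P U' k"
  by (induction k) auto

lemma total_cost_cong: "(\<And>j. j < steps P \<Longrightarrow> U j = U' j) \<Longrightarrow> total_cost P U = total_cost P U'"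
  unfolding total_cost_def by (auto intro!: arg_cong2[where f = "(+)"] sum.cong arg_cong2[where f = "stage_cost P _"]
      states_cong arg_cong[where f = "final_cost P"])


section \<open>Expansions along a family of control sequences\<close>

text \<open>Differentiability matters because \<open>frechet_derivative\<close> is a choice
  operator. Rows reduce the Jacobians of the dynamics to gradients of scalar functions.\<close>

lemma jacobian_row:
  fixes f :: "real^'b \<Rightarrow> real^'a"
  assumes "\<And>i. (\<lambda>x. f x $ i) differentiable (at x)"
  shows "jacobian f (at x) $ i = grad (\<lambda>x. f x $ i) x"
proof -
  have d: "((\<lambda>x. f x $ i) has_derivative frechet_derivative (\<lambda>x. f x $ i) (at x)) (at x)" for i
    using assms frechet_derivative_works by blast
  have "(f has_derivative (\<lambda>h. \<chi> i. frechet_derivative (\<lambda>x. f x $ i) (at x) h)) (at x)"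
    by (rule has_derivative_vecI) (simp add: d)
  then show ?thesis by (simp add: vec_eq_iff jacobian_component grad_def)
qed

lemma transpose_mult_rows: "transpose A *v q = (\<Sum>i\<in>UNIV. q $ i *\<^sub>R A $ i)" for A :: "real^'n^'m"
  by (simp add: vec_eq_iff matrix_vector_mult_def transpose_def mult.commute del: transpose_matrix_vector)

lemma matrix_vector_mult_nth: "(A *v v) $ i = A $ i \<bullet> v" for A :: "real^'n^'m"
  by (simp add: matrix_vector_mult_def inner_vec_def)

lemmas matrix_vector_mult_sum_left = bounded_bilinear.sum_left[OF bounded_bilinear_matrix_vector_mult]

context asymptotic_scale
begin

lemma approx_cong: "approx y x0 \<Longrightarrow> \<forall>\<^sub>F l in F. x l = y l \<Longrightarrow> approx x x0"
  unfolding approx_def by (erule bigO_cong) (auto elim: eventually_mono)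

lemma first_order_cong_ev:
  assumes "first_order y x0 x1" "\<forall>\<^sub>F l in F. x l = y l"
  shows "first_order x x0 x1"
  unfolding first_order_def
proof
  show "bigO 2 (\<lambda>l. x l - x0 - x1 l)"
    by (rule bigO_cong[where y = "\<lambda>l. y l - x0 - x1 l"])
      (use assms in \<open>auto simp: first_order_def elim: eventually_mono\<close>)
qed (use assms in \<open>simp add: first_order_def\<close>)

text \<open>Allows a state deviation in a linear term to be replaced by its prediction through the
  linearized dynamics.\<close>

lemma first_order_shift:
  assumes "first_order x x0 x1" "bigO 2 (\<lambda>l. x1 l - y1 l)"
  shows "first_order x x0 y1"
proof -
  have x1: "bigO 1 x1"
    using assms(1) by (simp add: first_order_def)
  have "bigO 1 y1"
    by (rule bigO_eq[OF bigO_diff[OF x1 bigO_mono[OF assms(2)]]]) simp_all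
  moreover have "bigO 2 (\<lambda>l. (x l - x0 - x1 l) + (x1 l - y1 l))"
    using assms unfolding first_order_def by (intro bigO_add) auto
  ultimately show ?thesis by (simp add: first_order_def)
qed

lemma bigO_matrix: "bigO n x \<Longrightarrow> bigO n (\<lambda>l. (A :: real^'n^'m) *v x l)"
  by (rule bigO_bounded_linear[OF matrix_vector_mul_bounded_linear])

end

context thrice_differentiable_bivariate
begin

lemma partial_differentiable:
  assumes "(x, u) \<in> N"
  shows "(\<lambda>x. g x u) differentiable (at x)" "(\<lambda>u. g x u) differentiable (at u)"
  using has_derivative_partial[OF G.has_derivative_deriv1[OF assms]]
  by (auto simp: differentiable_def)

end

text \<open>The final cost depends on the state only. It is treated as a function of state and
  control that is constant in the latter, at some control \<open>uf\<close>, so that one bivariate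
  theory serves all data of the problem.\<close>

locale regular_ocp =
  fixes P :: "(real^'a, real^'m) ocp" and Us :: "nat \<Rightarrow> real^'m" and uf :: "real^'m"
  assumes smooth_dyn: "k < steps P \<Longrightarrow>
      times_differentiable_at 3 (\<lambda>(x, u). dyn P k x u) (states P Us k, Us k)"
    and smooth_cost: "k < steps P \<Longrightarrow>
      times_differentiable_at 3 (\<lambda>(x, u). stage_cost P k x u) (states P Us k, Us k)"
    and smooth_final: "times_differentiable_at 3 (\<lambda>(x, u). final_cost P x) (states P Us (steps P), uf)"
    and Quu_star: "k < steps P \<Longrightarrow> pos_def (Quu P Us k)"
begin

abbreviation "xs \<equiv> states P Us"

lemma bivariate_cost:
  "k < steps P \<Longrightarrow> thrice_differentiable_bivariate (stage_cost P k) (xs k) (Us k)"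
  by (simp add: thrice_differentiable_bivariate_def thrice_differentiable_def smooth_cost)

lemma bivariate_final:
  "thrice_differentiable_bivariate (\<lambda>x u. final_cost P x) (xs (steps P)) uf"
  by (simp add: thrice_differentiable_bivariate_def thrice_differentiable_def smooth_final)

lemma bivariate_dyn:
  assumes "k < steps P"
  shows "thrice_differentiable_bivariate (\<lambda>x u. dyn P k x u $ i) (xs k) (Us k)"
  using times_differentiable_at_bounded_linear[OF bounded_linear_vec_nth smooth_dyn[OF assms], of i]
  by (simp add: thrice_differentiable_bivariate_def thrice_differentiable_def case_prod_beta')

lemma Theta_row_star: "k < steps P \<Longrightarrow> Theta P Us k $ i = grad (\<lambda>x. dyn P k x (Us k) $ i) (xs k)"
  unfolding Theta_def
  by (rule jacobian_row)
     (rule thrice_differentiable_bivariate.partial_differentiable[OF bivariate_dyn],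
      auto intro!: thrice_differentiable.rad thrice_differentiable_bivariate.thrice_bivariate[OF bivariate_dyn])

lemma Bmat_row_star: "k < steps P \<Longrightarrow> Bmat P Us k $ i = grad (\<lambda>u. dyn P k (xs k) u $ i) (Us k)"
  unfolding Bmat_def
  by (rule jacobian_row)
     (rule thrice_differentiable_bivariate.partial_differentiable[OF bivariate_dyn],
      auto intro!: thrice_differentiable.rad thrice_differentiable_bivariate.thrice_bivariate[OF bivariate_dyn])

lemma transpose_second_derivatives:
  assumes "k < steps P"
  shows "transpose (Vxx P Us (Suc k)) = Vxx P Us (Suc k) \<Longrightarrow> transpose (Qxx P Us k) = Qxx P Us k"
    and "transpose (Vxx P Us (Suc k)) = Vxx P Us (Suc k) \<Longrightarrow> transpose (Quu P Us k) = Quu P Us k"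
  using assms thrice_differentiable_bivariate.transpose_hess[OF bivariate_cost]
    thrice_differentiable_bivariate.transpose_hess[OF bivariate_dyn]
  by (simp_all add: Qxx_of_def Quu_def Quu_of_def linear_add[OF linear_transpose] linear_sum[OF linear_transpose]
      linear_scale[OF linear_transpose] matrix_transpose_mul matrix_mul_assoc)

text \<open>By \<open>Quu_Sigma\<close>, the correction \<open>Qxu ** Sigma_gain\<close> is minus
  the congruence transform of \<open>Quu\<close> by the gain, which is symmetric as soon as
  \<open>Quu\<close> is; \<open>Quu\<close> and \<open>Qxx\<close> inherit symmetry from
  \<open>Vxx\<close> at the next stage.\<close>

lemma transpose_Vxx: "k \<le> steps P \<Longrightarrow> transpose (Vxx P Us k) = Vxx P Us k"
proof (induction k rule: inc_induct)
  case base
  show ?case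
    using thrice_differentiable_bivariate.transpose_hess(1)[OF bivariate_final] by (simp add: value_final)
next
  case (step k)
  let ?Q = "Quu P Us k" and ?S = "Sigma_gain P Us k"
  have "Qxu P Us k = - (transpose ?S ** transpose ?Q)"
    using arg_cong[OF Quu_Sigma[OF Quu_star[OF step(2)]], of transpose]
    by (simp add: matrix_transpose_mul linear_neg[OF linear_transpose])
  then have "Qxu P Us k ** ?S = - (transpose ?S ** ?Q ** ?S)"
    using transpose_second_derivatives(2)[OF step(2,3)]
    by (simp add: bounded_bilinear.minus_left[OF bounded_bilinear_matrix_matrix_mult])
  then show ?case
    using transpose_second_derivatives[OF step(2,3)]
    by (simp add: value_step[OF step(2) Quu_star[OF step(2)]] linear_add[OF linear_transpose]
        linear_diff[OF linear_transpose] matrix_transpose_mul matrix_mul_assoc)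
qed

end

text \<open>The controls need not come from the algorithm: the iterates, their full-step updates and
  perturbations of a single control are all such families.\<close>

locale control_family = regular_ocp P Us uf + asymptotic_scale F e
  for P :: "(real^'a, real^'m) ocp" and Us uf and F :: "'i filter" and e +
  fixes U :: "'i \<Rightarrow> nat \<Rightarrow> real^'m"
  assumes controls: "k < steps P \<Longrightarrow> approx (\<lambda>l. U l k) (Us k)"
begin

abbreviation "X l k \<equiv> states P (U l) k"
abbreviation "dx k l \<equiv> states P (U l) k - xs k"
abbreviation "du k l \<equiv> U l k - Us k"
text \<open>The prime refers to the next stage: this is the linear prediction of
  \<open>dx (Suc k) l\<close>.\<close>

abbreviation "dx' k l \<equiv> Theta P Us k *v dx k l + Bmat P Us k *v du k l"

lemma first_order_dyn:
  assumes "k < steps P" "approx (\<lambda>l. X l k) (xs k)"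
  shows "first_order (\<lambda>l. X l (Suc k)) (xs (Suc k)) (dx' k)"
proof (rule first_order_vec)
  fix j
  show "first_order (\<lambda>l. X l (Suc k) $ j) (xs (Suc k) $ j) (\<lambda>l. dx' k l $ j)"
    using first_order_value[OF bivariate_dyn[OF assms(1)] assms(2) controls[OF assms(1)], of j]
    by (simp add: matrix_vector_mult_nth Theta_row_star Bmat_row_star assms(1))
qed

lemma approx_states: "k \<le> steps P \<Longrightarrow> approx (\<lambda>l. X l k) (xs k)"
proof (induction k)
  case 0
  then show ?case by (simp add: approx_const)
next
  case (Suc k)
  then show ?case using first_order_imp_approx[OF first_order_dyn[of k]] by simp
qed

lemmas first_order_states = first_order_dyn[OF _ approx_states[OF less_imp_le]]

lemma bigO_dx: "k \<le> steps P \<Longrightarrow> bigO 1 (dx k)"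
  using approx_states by (simp add: approx_def)

lemma bigO_du: "k < steps P \<Longrightarrow> bigO 1 (du k)"
  using controls by (simp add: approx_def)

lemma bigO_dx_Suc: "k < steps P \<Longrightarrow> bigO 2 (\<lambda>l. dx (Suc k) l - dx' k l)"
  using first_order_states[of k] by (simp add: first_order_def)

text \<open>Near the limit all of the finitely many components are differentiable, so one tail of
  the filter serves every row.\<close>

lemma eventually_rows:
  assumes k: "k < steps P"
  shows "\<forall>\<^sub>F l in F. \<forall>i. Theta P (U l) k $ i = grad (\<lambda>x. dyn P k x (U l k) $ i) (X l k)"
    and "\<forall>\<^sub>F l in F. \<forall>i. Bmat P (U l) k $ i = grad (\<lambda>u. dyn P k (X l k) u $ i) (U l k)"
proof -
  have "\<forall>\<^sub>F l in F. \<forall>i\<in>UNIV. (X l k, U l k) \<in> ball (xs k, Us k)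
       (thrice_differentiable.rad (\<lambda>(x, u). dyn P k x u $ i) (xs k, Us k))"
    by (intro eventually_ball_finite ballI finite_class.finite_UNIV
        expansions(4)[OF bivariate_dyn[OF k] approx_states[OF less_imp_le[OF k]] controls[OF k]])
  then have diff: "\<forall>\<^sub>F l in F. \<forall>i. (\<lambda>x. dyn P k x (U l k) $ i) differentiable (at (X l k)) \<and>
      (\<lambda>u. dyn P k (X l k) u $ i) differentiable (at (U l k))"
  proof eventually_elim
    case (elim l)
    show ?case
      using thrice_differentiable_bivariate.partial_differentiable[OF bivariate_dyn[OF k]] elim by blast
  qed
  show "\<forall>\<^sub>F l in F. \<forall>i. Theta P (U l) k $ i = grad (\<lambda>x. dyn P k x (U l k) $ i) (X l k)"
    using diff by eventually_elim (simp add: Theta_def jacobian_row)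
  show "\<forall>\<^sub>F l in F. \<forall>i. Bmat P (U l) k $ i = grad (\<lambda>u. dyn P k (X l k) u $ i) (U l k)"
    using diff by eventually_elim (simp add: Bmat_def jacobian_row)
qed

section \<open>Derivatives along the family at one stage\<close>

context
  fixes k assumes k: "k < steps P"
begin

lemmas cost_args = bivariate_cost[OF k] approx_states[OF less_imp_le[OF k]] controls[OF k]
lemmas dyn_args = bivariate_dyn[OF k] approx_states[OF less_imp_le[OF k]] controls[OF k]

lemma approx_Theta: "approx (\<lambda>l. Theta P (U l) k) (Theta P Us k)"
proof (rule approx_vec)
  fix j
  show "approx (\<lambda>l. Theta P (U l) k $ j) (Theta P Us k $ j)"
    unfolding Theta_row_star[OF k]
    by (rule approx_cong[OF first_order_imp_approx[OF first_order_grad_x[OF dyn_args]]])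
       (use eventually_rows(1)[OF k] in \<open>auto elim: eventually_mono\<close>)
qed

lemma approx_Bmat: "approx (\<lambda>l. Bmat P (U l) k) (Bmat P Us k)"
proof (rule approx_vec)
  fix j
  show "approx (\<lambda>l. Bmat P (U l) k $ j) (Bmat P Us k $ j)"
    unfolding Bmat_row_star[OF k]
    by (rule approx_cong[OF first_order_imp_approx[OF first_order_grad_u[OF dyn_args]]])
       (use eventually_rows(2)[OF k] in \<open>auto elim: eventually_mono\<close>)
qed

text \<open>The product is a sum of gradients of the components weighted by \<open>q\<close>, and
  the product rule applies. Differentiating the gradients contracts the second derivatives of the
  dynamics with \<open>q0\<close>, which are the curvature sums in \<open>Qxx\<close> and
  \<open>Qxu\<close>.\<close>

lemma first_order_transpose_Theta:
  assumes "first_order q q0 q1"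
  shows "first_order (\<lambda>l. transpose (Theta P (U l) k) *v q l) (transpose (Theta P Us k) *v q0)
    (\<lambda>l. transpose (Theta P Us k) *v q1 l
       + (\<Sum>i\<in>UNIV. q0 $ i *\<^sub>R hess (\<lambda>x. dyn P k x (Us k) $ i) (xs k)) *v dx k l
       + (\<Sum>i\<in>UNIV. q0 $ i *\<^sub>R hess_xu (\<lambda>x u. dyn P k x u $ i) (xs k) (Us k)) *v du k l)"
proof (rule first_order_cong_ev)
  show "\<forall>\<^sub>F l in F. transpose (Theta P (U l) k) *v q l
     = (\<Sum>i\<in>UNIV. q l $ i *\<^sub>R grad (\<lambda>x. dyn P k x (U l k) $ i) (X l k))"
    using eventually_rows(1)[OF k] by eventually_elim (simp add: transpose_mult_rows del: transpose_matrix_vector)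
  have "first_order (\<lambda>l. \<Sum>i\<in>UNIV. q l $ i *\<^sub>R grad (\<lambda>x. dyn P k x (U l k) $ i) (X l k))
     (\<Sum>i\<in>UNIV. q0 $ i *\<^sub>R grad (\<lambda>x. dyn P k x (Us k) $ i) (xs k))
     (\<lambda>l. \<Sum>i\<in>UNIV. q1 l $ i *\<^sub>R grad (\<lambda>x. dyn P k x (Us k) $ i) (xs k)
         + q0 $ i *\<^sub>R (hess (\<lambda>x. dyn P k x (Us k) $ i) (xs k) *v dx k l
             + hess_xu (\<lambda>x u. dyn P k x u $ i) (xs k) (Us k) *v du k l))"
    by (intro first_order_sum first_order_bilinear[OF bounded_bilinear_scaleR] first_order_grad_x[OF dyn_args]
        first_order_bounded_linear[OF bounded_linear_vec_nth] assms)
  then show "first_order (\<lambda>l. \<Sum>i\<in>UNIV. q l $ i *\<^sub>R grad (\<lambda>x. dyn P k x (U l k) $ i) (X l k))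
     (transpose (Theta P Us k) *v q0)
     (\<lambda>l. transpose (Theta P Us k) *v q1 l
       + (\<Sum>i\<in>UNIV. q0 $ i *\<^sub>R hess (\<lambda>x. dyn P k x (Us k) $ i) (xs k)) *v dx k l
       + (\<Sum>i\<in>UNIV. q0 $ i *\<^sub>R hess_xu (\<lambda>x u. dyn P k x u $ i) (xs k) (Us k)) *v du k l)"
    by (simp add: transpose_mult_rows Theta_row_star k matrix_vector_mult_sum_left sum.distrib
        scaleR_right_distrib scaleR_matrix_vector_assoc add.assoc del: transpose_matrix_vector)
qed

lemma first_order_transpose_Bmat:
  assumes "first_order q q0 q1"
  shows "first_order (\<lambda>l. transpose (Bmat P (U l) k) *v q l) (transpose (Bmat P Us k) *v q0)
    (\<lambda>l. transpose (Bmat P Us k) *v q1 l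
       + transpose (\<Sum>i\<in>UNIV. q0 $ i *\<^sub>R hess_xu (\<lambda>x u. dyn P k x u $ i) (xs k) (Us k)) *v dx k l
       + (\<Sum>i\<in>UNIV. q0 $ i *\<^sub>R hess (\<lambda>u. dyn P k (xs k) u $ i) (Us k)) *v du k l)"
proof (rule first_order_cong_ev)
  show "\<forall>\<^sub>F l in F. transpose (Bmat P (U l) k) *v q l
     = (\<Sum>i\<in>UNIV. q l $ i *\<^sub>R grad (\<lambda>u. dyn P k (X l k) u $ i) (U l k))"
    using eventually_rows(2)[OF k] by eventually_elim (simp add: transpose_mult_rows del: transpose_matrix_vector)
  have "first_order (\<lambda>l. \<Sum>i\<in>UNIV. q l $ i *\<^sub>R grad (\<lambda>u. dyn P k (X l k) u $ i) (U l k))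
     (\<Sum>i\<in>UNIV. q0 $ i *\<^sub>R grad (\<lambda>u. dyn P k (xs k) u $ i) (Us k))
     (\<lambda>l. \<Sum>i\<in>UNIV. q1 l $ i *\<^sub>R grad (\<lambda>u. dyn P k (xs k) u $ i) (Us k)
         + q0 $ i *\<^sub>R (transpose (hess_xu (\<lambda>x u. dyn P k x u $ i) (xs k) (Us k)) *v dx k l
             + hess (\<lambda>u. dyn P k (xs k) u $ i) (Us k) *v du k l))"
    by (intro first_order_sum first_order_bilinear[OF bounded_bilinear_scaleR] first_order_grad_u[OF dyn_args]
        first_order_bounded_linear[OF bounded_linear_vec_nth] assms)
  then show "first_order (\<lambda>l. \<Sum>i\<in>UNIV. q l $ i *\<^sub>R grad (\<lambda>u. dyn P k (X l k) u $ i) (U l k))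
     (transpose (Bmat P Us k) *v q0)
     (\<lambda>l. transpose (Bmat P Us k) *v q1 l
       + transpose (\<Sum>i\<in>UNIV. q0 $ i *\<^sub>R hess_xu (\<lambda>x u. dyn P k x u $ i) (xs k) (Us k)) *v dx k l
       + (\<Sum>i\<in>UNIV. q0 $ i *\<^sub>R hess (\<lambda>u. dyn P k (xs k) u $ i) (Us k)) *v du k l)"
    by (simp add: transpose_mult_rows[of "Bmat P Us k"] Bmat_row_star k matrix_vector_mult_sum_left sum.distrib
        linear_sum[OF linear_transpose] linear_scale[OF linear_transpose]
        scaleR_right_distrib scaleR_matrix_vector_assoc add.assoc del: transpose_matrix_vector)
qed

context
  assumes Vx': "first_order (\<lambda>l. Vx P (U l) (Suc k)) (Vx P Us (Suc k)) (\<lambda>l. Vxx P Us (Suc k) *v dx (Suc k) l)"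
    and Vxx': "approx (\<lambda>l. Vxx P (U l) (Suc k)) (Vxx P Us (Suc k))"
begin

lemma Vx'_dx': "first_order (\<lambda>l. Vx P (U l) (Suc k)) (Vx P Us (Suc k)) (\<lambda>l. Vxx P Us (Suc k) *v dx' k l)"
  by (rule first_order_shift[OF Vx'])
     (use bigO_matrix[OF bigO_dx_Suc[OF k], of "Vxx P Us (Suc k)"] in \<open>simp add: matrix_vector_mult_diff_distrib\<close>)

text \<open>The linear term of \<open>Vx\<close> at the next stage is \<open>Vxx\<close> applied to
  \<open>dx'\<close>. Multiplied by the transposed \<open>Theta\<close> it supplies the congruence
  terms of \<open>Qxx\<close> and \<open>Qxu\<close>; the Hessians of cost and dynamics supply the
  rest.\<close>

lemma first_order_Qx:
  "first_order (\<lambda>l. Qx P (U l) k) (Qx P Us k) (\<lambda>l. Qxx P Us k *v dx k l + Qxu P Us k *v du k l)"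
proof -
  note * = first_order_add[OF first_order_grad_x[OF cost_args] first_order_transpose_Theta[OF Vx'_dx']]
  show ?thesis
    unfolding Qx_of_def Qxx_of_def Qxu_of_def
    by (rule first_order_cong[OF *])
      (simp_all add: matrix_vector_mult_add_rdistrib matrix_vector_right_distrib matrix_vector_mul_assoc[symmetric]
         del: transpose_matrix_vector)
qed

text \<open>As for \<open>Qx\<close>, except that \<open>transpose Qxu\<close> contains the
  transpose of \<open>Vxx\<close>, so symmetry at the limit is needed.\<close>

lemma first_order_Qu:
  "first_order (\<lambda>l. Qu P (U l) k) (Qu P Us k) (\<lambda>l. transpose (Qxu P Us k) *v dx k l + Quu P Us k *v du k l)"
proof -
  note * = first_order_add[OF first_order_grad_u[OF cost_args] first_order_transpose_Bmat[OF Vx'_dx']]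
  show ?thesis
    unfolding Qu_of_def Qxu_of_def Quu_def Quu_of_def
    by (rule first_order_cong[OF *])
      (simp_all add: matrix_vector_mult_add_rdistrib matrix_vector_right_distrib matrix_vector_mul_assoc[symmetric]
         matrix_transpose_mul linear_add[OF linear_transpose] transpose_Vxx k Suc_leI
         del: transpose_matrix_vector)
qed

lemmas approx_Vx' = first_order_imp_approx[OF Vx']
lemmas approx_matrix_mult = approx_bilinear[OF bounded_bilinear_matrix_matrix_mult]

lemma approx_Qxx: "approx (\<lambda>l. Qxx P (U l) k) (Qxx P Us k)"
  unfolding Qxx_of_def
  by (intro approx_add approx_sum approx_hess_x[OF cost_args] approx_hess_x[OF dyn_args]
      approx_matrix_mult approx_bounded_linear[OF bounded_linear_transpose] approx_Theta Vxx'
      approx_bilinear[OF bounded_bilinear_scaleR] approx_bounded_linear[OF bounded_linear_vec_nth] approx_Vx')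

lemma approx_Qxu: "approx (\<lambda>l. Qxu P (U l) k) (Qxu P Us k)"
  unfolding Qxu_of_def
  by (intro approx_add approx_sum approx_hess_xu[OF cost_args] approx_hess_xu[OF dyn_args]
      approx_matrix_mult approx_bounded_linear[OF bounded_linear_transpose] approx_Theta approx_Bmat Vxx'
      approx_bilinear[OF bounded_bilinear_scaleR] approx_bounded_linear[OF bounded_linear_vec_nth] approx_Vx')

lemma approx_Quu: "approx (\<lambda>l. Quu P (U l) k) (Quu P Us k)"
  unfolding Quu_def Quu_of_def
  by (intro approx_add approx_sum approx_hess_u[OF cost_args] approx_hess_u[OF dyn_args]
      approx_matrix_mult approx_bounded_linear[OF bounded_linear_transpose] approx_Bmat Vxx'
      approx_bilinear[OF bounded_bilinear_scaleR] approx_bounded_linear[OF bounded_linear_vec_nth] approx_Vx')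

end

end

end


section \<open>Second-order expansion of the cost\<close>

lemma sum_mult_quadratic:
  fixes A :: "'j::finite \<Rightarrow> real^'n^'m"
  shows "(\<Sum>i\<in>UNIV. q i * (a \<bullet> (A i *v b))) = a \<bullet> ((\<Sum>i\<in>UNIV. q i *\<^sub>R A i) *v b)"
  by (simp add: matrix_vector_mult_sum_left inner_sum_right flip: scaleR_matrix_vector_assoc)

lemma sum_mult_rows: "(\<Sum>i\<in>UNIV. q $ i * (A $ i \<bullet> v)) = (transpose A *v q) \<bullet> v" for A :: "real^'n^'m"
  by (simp add: transpose_mult_rows inner_sum_left del: transpose_matrix_vector)

text \<open>The constant is the minimum of the quadratic form over the unit sphere, attained by
  compactness; homogeneity does the rest.\<close>

lemma pos_def_lower_bound:
  fixes A :: "real^'n^'n"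
  assumes "pos_def A"
  obtains m where "m > 0" "\<And>v. m * (norm v)\<^sup>2 \<le> v \<bullet> (A *v v)"
proof -
  have cont: "continuous_on (sphere 0 1) (\<lambda>v. v \<bullet> (A *v v))"
    by (intro continuous_intros linear_continuous_on matrix_vector_mul_bounded_linear)
  have "sphere (0 :: real^'n) 1 \<noteq> {}" by simp
  then obtain v0 where v0: "v0 \<in> sphere 0 1" "\<And>v. v \<in> sphere 0 1 \<Longrightarrow> v0 \<bullet> (A *v v0) \<le> v \<bullet> (A *v v)"
    using continuous_attains_inf[OF compact_sphere _ cont] by blast
  show thesis
  proof
    show "v0 \<bullet> (A *v v0) > 0" using assms v0(1) unfolding pos_def_def by (metis dist_0_norm mem_sphere norm_zero zero_neq_one)
    fix v :: "real^'n"
    show "v0 \<bullet> (A *v v0) * (norm v)\<^sup>2 \<le> v \<bullet> (A *v v)"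
    proof (cases "v = 0")
      case False
      then have "v0 \<bullet> (A *v v0) \<le> (v /\<^sub>R norm v) \<bullet> (A *v (v /\<^sub>R norm v))"
        by (intro v0) simp
      also have "\<dots> = (v \<bullet> (A *v v)) / (norm v)\<^sup>2"
        by (simp add: matrix_vector_mult_scaleR power2_eq_square divide_simps)
      finally show ?thesis using False by (simp add: field_simps)
    qed simp
  qed
qed

context regular_ocp
begin

abbreviation cost_gap :: "(nat \<Rightarrow> real^'m) \<Rightarrow> nat \<Rightarrow> real" where
  "cost_gap V k \<equiv> (\<Sum>j=k..<steps P. stage_cost P j (states P V j) (V j) - stage_cost P j (xs j) (Us j))
     + final_cost P (states P V (steps P)) - final_cost P (xs (steps P))"

lemma total_cost_diff: "total_cost P V - total_cost P Us = cost_gap V 0"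
  by (simp add: total_cost_def sum_subtractf atLeast0LessThan)

lemma Vx_star:
  assumes "k < steps P" "Qu P Us k = 0"
  shows "Vx P Us k = Qx P Us k"
  using value_step(1)[OF assms(1) Quu_star[OF assms(1)]] assms(2) by (simp add: ell_def ell_of_def)

text \<open>For fixed \<open>a\<close> the critical point in \<open>b\<close> is
  \<open>Sigma_gain *v a\<close>, because \<open>Quu\<close> is symmetric and maps it to minus
  \<open>transpose Qxu *v a\<close>. The value left over at that point is the quadratic form of
  \<open>Vxx\<close>.\<close>

lemma complete_square:
  assumes k: "k < steps P"
  shows "a \<bullet> (Qxx P Us k *v a) + 2 * (a \<bullet> (Qxu P Us k *v b)) + b \<bullet> (Quu P Us k *v b)
    = a \<bullet> (Vxx P Us k *v a)
      + (b - Sigma_gain P Us k *v a) \<bullet> (Quu P Us k *v (b - Sigma_gain P Us k *v a))"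
proof -
  let ?Q = "Quu P Us k" and ?S = "Sigma_gain P Us k" and ?C = "Qxu P Us k"
  have QS: "?Q *v (?S *v a) = - (transpose ?C *v a)"
    using Quu_Sigma[OF Quu_star[OF k]]
    by (simp add: matrix_vector_mul_assoc bounded_bilinear.minus_left[OF bounded_bilinear_matrix_vector_mult]
        del: transpose_matrix_vector)
  have sym: "(?S *v a) \<bullet> (?Q *v b) = (?Q *v (?S *v a)) \<bullet> b"
    using inner_transpose_matrix[of "?S *v a" ?Q b] transpose_second_derivatives(2)[OF k]
      transpose_Vxx k by (simp del: transpose_matrix_vector)
  have t: "x \<bullet> (transpose ?C *v a) = a \<bullet> (?C *v x)" for x
    using inner_transpose_matrix[of x ?C a] by (simp add: inner_commute)
  show ?thesis
    using sym t[of b] t[of "?S *v a"]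
    by (simp add: value_step(2)[OF k Quu_star[OF k]] matrix_vector_mult_diff_distrib
      matrix_vector_mult_add_rdistrib inner_diff_left inner_diff_right inner_add_right QS
      matrix_vector_mul_assoc[symmetric] inner_commute[of "transpose ?C *v a"] del: transpose_matrix_vector)
qed

end

locale ocp_scale = regular_ocp P Us uf + asymptotic_scale F e
  for P :: "(real^'a, real^'m) ocp" and Us uf and F :: "'i filter" and e
begin

text \<open>Forward induction from a common initial state. Each control has to be small only if the
  state reached so far is, which fits feedback laws. \<open>1 \<le> r\<close> makes the dynamics
  expandable at all, and \<open>r \<le> 2\<close> is the order of the remainder of their
  linearization.\<close>

lemma bigO_trajectory:
  fixes V :: "'i \<Rightarrow> nat \<Rightarrow> real^'m"
  assumes r: "1 \<le> r" "r \<le> 2"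
    and feedback: "\<And>k. k < steps P \<Longrightarrow> bigO r (\<lambda>l. states P (V l) k - xs k) \<Longrightarrow> bigO r (\<lambda>l. V l k - Us k)"
  shows "k \<le> steps P \<Longrightarrow> bigO r (\<lambda>l. states P (V l) k - xs k)"
    and "k < steps P \<Longrightarrow> bigO r (\<lambda>l. V l k - Us k)"
proof -
  have *: "k \<le> steps P \<Longrightarrow> bigO r (\<lambda>l. states P (V l) k - xs k)" for k
  proof (induction k)
    case 0
    then show ?case by (simp add: bigO_zero)
  next
    case (Suc k)
    then have k: "k < steps P" and x: "bigO r (\<lambda>l. states P (V l) k - xs k)" by auto
    note u = feedback[OF k x]
    have ap: "approx (\<lambda>l. states P (V l) k) (xs k)" "approx (\<lambda>l. V l k) (Us k)"
      using x u r unfolding approx_def by (auto intro: bigO_mono)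
    show ?case
    proof (rule bigO_vec)
      fix j
      let ?lin = "\<lambda>l. grad (\<lambda>x. dyn P k x (Us k) $ j) (xs k) \<bullet> (states P (V l) k - xs k)
         + grad (\<lambda>u. dyn P k (xs k) u $ j) (Us k) \<bullet> (V l k - Us k)"
      have "bigO r (\<lambda>l. dyn P k (states P (V l) k) (V l k) $ j - dyn P k (xs k) (Us k) $ j - ?lin l)"
        using first_order_value[OF bivariate_dyn[OF k] ap, of j] r unfolding first_order_def
        by (auto intro: bigO_mono)
      moreover have "bigO r ?lin"
        by (intro bigO_add bigO_bounded_linear[OF bounded_linear_inner_right] x u)
      ultimately have "bigO r (\<lambda>l. (dyn P k (states P (V l) k) (V l k) $ j - dyn P k (xs k) (Us k) $ j - ?lin l) + ?lin l)"
        by (rule bigO_add)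
      then show "bigO r (\<lambda>l. (states P (V l) (Suc k) - xs (Suc k)) $ j)" by simp
    qed
  qed
  then show "k \<le> steps P \<Longrightarrow> bigO r (\<lambda>l. states P (V l) k - xs k)" .
  show "k < steps P \<Longrightarrow> bigO r (\<lambda>l. V l k - Us k)" using * feedback by simp
qed

end

context control_family
begin

abbreviation "quad_value k l \<equiv> Vx P Us k \<bullet> dx k l + (dx k l \<bullet> (Vxx P Us k *v dx k l)) / 2"
text \<open>Here the prime marks the deviation from the limiting feedback law, not the next
  stage.\<close>

abbreviation "du' k l \<equiv> du k l - Sigma_gain P Us k *v dx k l"

lemma bigO_du': "k < steps P \<Longrightarrow> bigO 1 (du' k)"
  by (intro bigO_diff bigO_matrix bigO_du bigO_dx) auto

lemma bigO_quadratic: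
  fixes A :: "real^'c^'r"
  assumes "bigO n y" "bigO m w"
  shows "bigO (n + m) (\<lambda>l. y l \<bullet> (A *v w l))"
  by (rule bigO_bilinear[OF bounded_bilinear_inner assms(1) bigO_matrix[OF assms(2)]])

text \<open>Second-order form of the Bellman step. Under the gradient \<open>p\<close>, which is not
  small, the dynamics are expanded to second order; under \<open>W\<close>, which meets two factors
  of order 1, linearized dynamics suffice. Vanishing of \<open>Qu\<close> is not assumed, so this
  can serve to prove it.\<close>

lemma stage_expansion:
  assumes k: "k < steps P"
  shows "bigO 3 (\<lambda>l. stage_cost P k (X l k) (U l k) - stage_cost P k (xs k) (Us k) + quad_value (Suc k) l
    - (Qx P Us k \<bullet> dx k l + Qu P Us k \<bullet> du k l
       + (dx k l \<bullet> (Vxx P Us k *v dx k l) + du' k l \<bullet> (Quu P Us k *v du' k l)) / 2))"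
proof -
  define p where "p = Vx P Us (Suc k)"
  define W where "W = Vxx P Us (Suc k)"
  let ?f = "\<lambda>i x u. dyn P k x u $ i"
  let ?q = "\<lambda>Hxx Hxu Huu l. (dx k l \<bullet> (Hxx *v dx k l) + 2 * (dx k l \<bullet> (Hxu *v du k l)) + du k l \<bullet> (Huu *v du k l)) / 2"
  have 1: "bigO 3 (\<lambda>l. stage_cost P k (X l k) (U l k) - stage_cost P k (xs k) (Us k)
      - grad (\<lambda>x. stage_cost P k x (Us k)) (xs k) \<bullet> dx k l - grad (\<lambda>u. stage_cost P k (xs k) u) (Us k) \<bullet> du k l
      - ?q (hess (\<lambda>x. stage_cost P k x (Us k)) (xs k)) (hess_xu (stage_cost P k) (xs k) (Us k))
           (hess (\<lambda>u. stage_cost P k (xs k) u) (Us k)) l)"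
    by (rule bigO_second_order[OF cost_args[OF k]])
  have "bigO 3 (\<lambda>l. \<Sum>i\<in>UNIV. p $ i *\<^sub>R (?f i (X l k) (U l k) - ?f i (xs k) (Us k)
      - grad (\<lambda>x. ?f i x (Us k)) (xs k) \<bullet> dx k l - grad (\<lambda>u. ?f i (xs k) u) (Us k) \<bullet> du k l
      - ?q (hess (\<lambda>x. ?f i x (Us k)) (xs k)) (hess_xu (?f i) (xs k) (Us k)) (hess (\<lambda>u. ?f i (xs k) u) (Us k)) l))"
    by (intro bigO_sum bigO_bounded_linear[OF bounded_linear_scaleR_right] bigO_second_order[OF dyn_args[OF k]])
  then have 2: "bigO 3 (\<lambda>l. p \<bullet> dx (Suc k) l - (transpose (Theta P Us k) *v p) \<bullet> dx k l
      - (transpose (Bmat P Us k) *v p) \<bullet> du k l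
      - ?q (\<Sum>i\<in>UNIV. p $ i *\<^sub>R hess (\<lambda>x. ?f i x (Us k)) (xs k))
           (\<Sum>i\<in>UNIV. p $ i *\<^sub>R hess_xu (?f i) (xs k) (Us k))
           (\<Sum>i\<in>UNIV. p $ i *\<^sub>R hess (\<lambda>u. ?f i (xs k) u) (Us k)) l)"
  proof (rule bigO_eq)
    fix l
    show "p \<bullet> dx (Suc k) l - (transpose (Theta P Us k) *v p) \<bullet> dx k l
      - (transpose (Bmat P Us k) *v p) \<bullet> du k l
      - ?q (\<Sum>i\<in>UNIV. p $ i *\<^sub>R hess (\<lambda>x. ?f i x (Us k)) (xs k))
           (\<Sum>i\<in>UNIV. p $ i *\<^sub>R hess_xu (?f i) (xs k) (Us k))
           (\<Sum>i\<in>UNIV. p $ i *\<^sub>R hess (\<lambda>u. ?f i (xs k) u) (Us k)) l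
     = (\<Sum>i\<in>UNIV. p $ i *\<^sub>R (?f i (X l k) (U l k) - ?f i (xs k) (Us k)
      - grad (\<lambda>x. ?f i x (Us k)) (xs k) \<bullet> dx k l - grad (\<lambda>u. ?f i (xs k) u) (Us k) \<bullet> du k l
      - ?q (hess (\<lambda>x. ?f i x (Us k)) (xs k)) (hess_xu (?f i) (xs k) (Us k)) (hess (\<lambda>u. ?f i (xs k) u) (Us k)) l))"
      unfolding sum_mult_quadratic[symmetric] sum_mult_rows[symmetric] inner_vec_def[of p]
      by (simp add: Theta_row_star[OF k] Bmat_row_star[OF k] sum_subtractf sum.distrib
          sum_distrib_left sum_divide_distrib right_diff_distrib distrib_left add_divide_distrib mult_ac)
  qed
  have dx': "bigO 1 (dx' k)"
    using k by (intro bigO_add bigO_matrix bigO_dx bigO_du) auto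
  \<comment> \<open>The difference of the quadratic forms of \<open>W\<close> at
    \<open>dx (Suc k)\<close> and \<open>dx' k\<close>, split so that each product has one factor of
    order 2 and one of order 1.\<close>
  have "bigO 3 (\<lambda>l. (dx (Suc k) l - dx' k l) \<bullet> (W *v dx (Suc k) l) + dx' k l \<bullet> (W *v (dx (Suc k) l - dx' k l)))"
    using bigO_quadratic[OF bigO_dx_Suc[OF k] bigO_dx[of "Suc k"], of W]
      bigO_quadratic[OF dx' bigO_dx_Suc[OF k], of W] k
    by (intro bigO_add) (simp_all only: Suc_leI add_2_eq_Suc' plus_1_eq_Suc numeral_3_eq_3 numeral_2_eq_2 add_Suc_right add_0_right One_nat_def)
  then have 3: "bigO 3 (\<lambda>l. (1 / 2) *\<^sub>R ((dx (Suc k) l - dx' k l) \<bullet> (W *v dx (Suc k) l)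
      + dx' k l \<bullet> (W *v (dx (Suc k) l - dx' k l))))"
    by (rule bigO_bounded_linear[OF bounded_linear_scaleR_right])
  \<comment> \<open>Symmetry of \<open>W\<close> merges the two mixed terms in its quadratic form at
    \<open>dx'\<close> into the doubled \<open>Qxu\<close> term.\<close>
  have Wsym: "(Bmat P Us k *v b) \<bullet> (W *v (Theta P Us k *v a)) = (Theta P Us k *v a) \<bullet> (W *v (Bmat P Us k *v b))" for a b
    using inner_transpose_matrix[of "Bmat P Us k *v b" W "Theta P Us k *v a"] transpose_Vxx[of "Suc k"] k
    by (simp add: W_def inner_commute del: transpose_matrix_vector)
  show ?thesis
    unfolding complete_square[OF k, symmetric]
  proof (rule bigO_eq[OF bigO_add[OF bigO_add[OF 1 2] 3]])
    fix l
    show "stage_cost P k (X l k) (U l k) - stage_cost P k (xs k) (Us k) + quad_value (Suc k) l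
      - (Qx P Us k \<bullet> dx k l + Qu P Us k \<bullet> du k l
       + (dx k l \<bullet> (Qxx P Us k *v dx k l) + 2 * (dx k l \<bullet> (Qxu P Us k *v du k l)) + du k l \<bullet> (Quu P Us k *v du k l)) / 2)
     = stage_cost P k (X l k) (U l k) - stage_cost P k (xs k) (Us k)
      - grad (\<lambda>x. stage_cost P k x (Us k)) (xs k) \<bullet> dx k l - grad (\<lambda>u. stage_cost P k (xs k) u) (Us k) \<bullet> du k l
      - ?q (hess (\<lambda>x. stage_cost P k x (Us k)) (xs k)) (hess_xu (stage_cost P k) (xs k) (Us k))
           (hess (\<lambda>u. stage_cost P k (xs k) u) (Us k)) l
      + (p \<bullet> dx (Suc k) l - (transpose (Theta P Us k) *v p) \<bullet> dx k l
      - (transpose (Bmat P Us k) *v p) \<bullet> du k l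
      - ?q (\<Sum>i\<in>UNIV. p $ i *\<^sub>R hess (\<lambda>x. ?f i x (Us k)) (xs k))
           (\<Sum>i\<in>UNIV. p $ i *\<^sub>R hess_xu (?f i) (xs k) (Us k))
           (\<Sum>i\<in>UNIV. p $ i *\<^sub>R hess (\<lambda>u. ?f i (xs k) u) (Us k)) l)
      + (1 / 2) *\<^sub>R ((dx (Suc k) l - dx' k l) \<bullet> (W *v dx (Suc k) l)
          + dx' k l \<bullet> (W *v (dx (Suc k) l - dx' k l)))"
      unfolding Qx_of_def Qu_of_def Qxx_of_def Qxu_of_def Quu_def Quu_of_def p_def[symmetric] W_def[symmetric]
      using Wsym[of "du k l" "dx k l"]
      by (simp add: matrix_vector_mult_add_rdistrib matrix_vector_right_distrib matrix_vector_mult_diff_distrib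
         inner_add_left inner_add_right inner_diff_left inner_diff_right matrix_vector_mul_assoc[symmetric]
         inner_transpose_matrix del: transpose_matrix_vector states.simps) argo
  qed
qed

text \<open>The stagewise expansions telescope, as the linear term of each stage is that of
  \<open>quad_value\<close> once \<open>Qu\<close> vanishes. This is required from stage
  \<open>k\<close> on only, so that the result is usable inside the backward induction for
  stationary points.\<close>

lemma cost_gap_expansion:
  assumes "k \<le> steps P" "\<And>j. k \<le> j \<Longrightarrow> j < steps P \<Longrightarrow> Qu P Us j = 0"
  shows "bigO 3 (\<lambda>l. cost_gap (U l) k - quad_value k l - (\<Sum>j=k..<steps P. du' j l \<bullet> (Quu P Us j *v du' j l)) / 2)"
  using assms
proof (induction k rule: inc_induct)
  case base
  have u: "approx (\<lambda>l. uf) uf" by (rule approx_const)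
  show ?case
    using bigO_second_order[OF bivariate_final approx_states[OF order_refl] u]
    by (simp add: value_final diff_diff_eq add.assoc)
next
  case (step k)
  have IH: "bigO 3 (\<lambda>l. cost_gap (U l) (Suc k) - quad_value (Suc k) l
      - (\<Sum>j=Suc k..<steps P. du' j l \<bullet> (Quu P Us j *v du' j l)) / 2)"
    using step by simp
  have Q: "Qu P Us k = 0" using step by simp
  show ?case
    by (rule bigO_eq[OF bigO_add[OF IH stage_expansion[OF step(2)]]])
       (simp add: Q Vx_star[OF step(2) Q] sum.atLeast_Suc_lessThan[OF step(2)] add_divide_distrib
         del: states.simps)
qed

end


section \<open>Stationarity and the full step\<close>

text \<open>One-sided, because an asymptotic scale must be nonnegative.\<close>

lemma gderiv_zero_imp_directional:
  fixes J :: "'u::real_inner \<Rightarrow> real"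
  assumes "GDERIV J x :> 0"
  shows "((\<lambda>t. (J (x + t *\<^sub>R q) - J x) / t) \<longlongrightarrow> 0) (at_right 0)"
proof -
  have "(J has_derivative (\<lambda>h. 0)) (at (x + 0 *\<^sub>R q))"
    using assms by (simp add: gderiv_def)
  moreover have "((\<lambda>t. x + t *\<^sub>R q) has_derivative (\<lambda>t. t *\<^sub>R q)) (at 0)"
    by (auto intro!: derivative_eq_intros)
  ultimately have "((\<lambda>t. J (x + t *\<^sub>R q)) has_derivative (\<lambda>t. 0)) (at 0)"
    using has_derivative_compose[of "\<lambda>t. x + t *\<^sub>R q" "\<lambda>t. t *\<^sub>R q" 0 UNIV J "\<lambda>h. 0"] by simp
  then have "((\<lambda>t. J (x + t *\<^sub>R q)) has_real_derivative 0) (at 0)"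
    by (simp add: has_field_derivative_def lambda_zero)
  then have "((\<lambda>t. (J (x + t *\<^sub>R q) - J x) / t) \<longlongrightarrow> 0) (at 0)"
    by (simp add: DERIV_def)
  then show ?thesis
    by (rule filterlim_mono) (simp_all add: at_le)
qed

context regular_ocp
begin

lemma stationary_imp_Qu_eq_0:
  assumes stat: "stationary_point P Us" and k: "k < steps P"
  shows "Qu P Us k = 0"
proof -
  have "k \<le> steps P" using k by simp
  then have "\<forall>j. k \<le> j \<and> j < steps P \<longrightarrow> Qu P Us j = 0"
  proof (induction k rule: inc_induct)
    case (step k)
    let ?q = "Qu P Us k"
    \<comment> \<open>Since \<open>Qu\<close> vanishes at the later stages, moving only \<open>Us k\<close> by \<open>t *\<^sub>R Qu P Us k\<close> changes
      the cost by \<open>t * (Qu P Us k \<bullet> Qu P Us k) + O(t\<^sup>2)\<close>.\<close>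
    define V where "V t = Us(k := Us k + t *\<^sub>R ?q)" for t :: real
    interpret asymptotic_scale "at_right (0::real)" "\<lambda>t. t"
      by unfold_locales (auto simp: eventually_at_filter intro: tendsto_ident_at)
    have id1: "bigO 1 (\<lambda>t. t *\<^sub>R v)" for v :: "real^'m"
      by (rule bigOI[where C = "norm v"]) (auto simp: eventually_at_filter)
    interpret control_family P Us uf "at_right (0::real)" "\<lambda>t. t" V
    proof unfold_locales
      fix j assume "j < steps P"
      show "approx (\<lambda>t. V t j) (Us j)"
        using id1[of ?q] by (cases "j = k") (simp_all add: V_def approx_def bigO_zero)
    qed
    have same: "states P (V t) j = xs j" if "j \<le> k" for t j
      using that by (intro states_cong) (auto simp: V_def)
    have Vk: "V t k = Us k + t *\<^sub>R ?q" for t by (simp add: V_def)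
    have Vj: "V t j = Us j" if "j < k" for t j using that by (simp add: V_def)
    \<comment> \<open>Later controls are unchanged, yet \<open>du'\<close> still contains the state
      deviations caused at stage \<open>k\<close>; its quadratic forms are of order 2 and drop
      out.\<close>
    have quad: "bigO 2 (\<lambda>t. du' j t \<bullet> (Quu P Us j *v du' j t))" if "j < steps P" for j
      using bigO_quadratic[OF bigO_du'[OF that] bigO_du'[OF that]] by (simp add: numeral_2_eq_2)
    have gap: "bigO 2 (\<lambda>t. cost_gap (V t) (Suc k) - quad_value (Suc k) t)"
    proof -
      have "bigO 2 (\<lambda>t. cost_gap (V t) (Suc k) - quad_value (Suc k) t
          - (\<Sum>j=Suc k..<steps P. du' j t \<bullet> (Quu P Us j *v du' j t)) / 2)"
        using step by (intro bigO_mono[OF cost_gap_expansion]) auto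
      moreover have "bigO 2 (\<lambda>t. (1 / 2) *\<^sub>R (\<Sum>j=Suc k..<steps P. du' j t \<bullet> (Quu P Us j *v du' j t)))"
        by (intro bigO_bounded_linear[OF bounded_linear_scaleR_right] bigO_sum quad) simp
      ultimately show ?thesis by (rule bigO_eq[OF bigO_add]) simp
    qed
    have stage: "bigO 2 (\<lambda>t. stage_cost P k (X t k) (V t k) - stage_cost P k (xs k) (Us k) + quad_value (Suc k) t
        - t * (?q \<bullet> ?q))"
    proof -
      have h: "bigO 2 (\<lambda>t. (1 / 2) *\<^sub>R (du' k t \<bullet> (Quu P Us k *v du' k t)))"
        by (intro bigO_bounded_linear[OF bounded_linear_scaleR_right] quad step)
      have s: "bigO 2 (\<lambda>l. stage_cost P k (X l k) (V l k) - stage_cost P k (xs k) (Us k) + quad_value (Suc k) l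
          - (Qx P Us k \<bullet> dx k l + Qu P Us k \<bullet> du k l
          + (dx k l \<bullet> (Vxx P Us k *v dx k l) + du' k l \<bullet> (Quu P Us k *v du' k l)) / 2))"
        by (rule bigO_mono[OF stage_expansion[OF step(2)]]) simp
      show ?thesis
        by (rule bigO_eq[OF bigO_add[OF s h]]) (simp add: same Vk del: states.simps)
    qed
    have "total_cost P (V t) - total_cost P Us
        = stage_cost P k (X t k) (V t k) - stage_cost P k (xs k) (Us k) + cost_gap (V t) (Suc k)" for t
    proof -
      have "(\<Sum>j=0..<k. stage_cost P j (X t j) (V t j) - stage_cost P j (xs j) (Us j)) = 0"
        by (intro sum.neutral) (auto simp: same Vj)
      then show ?thesis
        unfolding total_cost_diff
        using sum.atLeastLessThan_concat[of 0 k "steps P" "\<lambda>j. stage_cost P j (X t j) (V t j) - stage_cost P j (xs j) (Us j)"]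
          step(2) by (simp add: sum.atLeast_Suc_lessThan[OF step(2)] del: states.simps)
    qed
    then have "bigO 2 (\<lambda>t. total_cost P (V t) - total_cost P Us - t * (?q \<bullet> ?q))"
      by (intro bigO_eq[OF bigO_add[OF gap stage]]) simp
    then obtain C where C: "\<forall>\<^sub>F t in at_right 0. norm (total_cost P (V t) - total_cost P Us - t * (?q \<bullet> ?q)) \<le> C * t\<^sup>2"
      by (rule bigOE)
    have "((\<lambda>t. (total_cost P (V t) - total_cost P Us) / t - ?q \<bullet> ?q) \<longlongrightarrow> 0) (at_right 0)"
    proof (rule Lim_null_comparison)
      show "((\<lambda>t. C * t) \<longlongrightarrow> 0) (at_right 0)" using tendsto_mult_right_zero[OF e_tendsto] .
      have "\<forall>\<^sub>F t in at_right (0::real). t > 0" by (simp add: eventually_at_filter)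
      with C show "\<forall>\<^sub>F t in at_right 0. norm ((total_cost P (V t) - total_cost P Us) / t - ?q \<bullet> ?q) \<le> C * t"
      proof eventually_elim
        case (elim t)
        have "(total_cost P (V t) - total_cost P Us) / t - ?q \<bullet> ?q
           = (total_cost P (V t) - total_cost P Us - t * (?q \<bullet> ?q)) / t"
          using elim by (simp add: field_simps)
        then have "norm ((total_cost P (V t) - total_cost P Us) / t - ?q \<bullet> ?q)
           = norm (total_cost P (V t) - total_cost P Us - t * (?q \<bullet> ?q)) / t"
          using elim by simp
        also have "\<dots> \<le> C * t\<^sup>2 / t" using elim by (intro divide_right_mono) auto
        finally show ?case using elim by (simp add: power2_eq_square)
      qed
    qed
    moreover have "((\<lambda>t. (total_cost P (V t) - total_cost P Us) / t) \<longlongrightarrow> 0) (at_right 0)"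
      using gderiv_zero_imp_directional[of "\<lambda>v. total_cost P (Us(k := v))" "Us k" ?q] stat step(2)
      by (simp add: stationary_point_def V_def)
    ultimately have "((\<lambda>t. ?q \<bullet> ?q) \<longlongrightarrow> 0) (at_right (0::real))"
      using tendsto_diff[of "\<lambda>t. (total_cost P (V t) - total_cost P Us) / t" 0 "at_right 0"
          "\<lambda>t. (total_cost P (V t) - total_cost P Us) / t - ?q \<bullet> ?q" 0] by simp
    then have "?q = 0"
      using tendsto_unique[OF _ _ tendsto_const] by (fastforce simp: tendsto_const_iff)
    then show ?case using step(3) by (metis Suc_leI le_neq_implies_less)
  qed auto
  then show ?thesis using k by simp
qed

end

locale ddp_family = control_family P Us uf F e U
  for P :: "(real^'a, real^'m) ocp" and Us uf and F :: "'i filter" and e U +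
  assumes Quu_pos_def: "k < steps P \<Longrightarrow> \<forall>\<^sub>F l in F. pos_def (Quu P (U l) k)"
    and Qu_star: "k < steps P \<Longrightarrow> Qu P Us k = 0"
begin

section \<open>One backward step along the iterates\<close>

context
  fixes k assumes k: "k < steps P"
  assumes Vx': "first_order (\<lambda>l. Vx P (U l) (Suc k)) (Vx P Us (Suc k)) (\<lambda>l. Vxx P Us (Suc k) *v dx (Suc k) l)"
    and Vxx': "approx (\<lambda>l. Vxx P (U l) (Suc k)) (Vxx P Us (Suc k))"
begin

lemma approx_Quu_inv: "approx (\<lambda>l. matrix_inv (Quu P (U l) k)) (matrix_inv (Quu P Us k))"
  by (rule approx_matrix_inv[OF approx_Quu[OF k Vx' Vxx'] pos_def_imp_invertible[OF Quu_star[OF k]]])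
     (use Quu_pos_def[OF k] in \<open>auto elim: eventually_mono intro: pos_def_imp_invertible\<close>)

lemma approx_Sigma: "approx (\<lambda>l. Sigma_gain P (U l) k) (Sigma_gain P Us k)"
  unfolding Sigma_gain_def Sigma_of_def Quu_def[symmetric]
  by (intro approx_minus approx_bilinear[OF bounded_bilinear_matrix_matrix_mult] approx_Quu_inv
      approx_bounded_linear[OF bounded_linear_transpose] approx_Qxu[OF k Vx' Vxx'])

text \<open>\<open>Qu\<close> has limit 0, so the inverse of \<open>Quu\<close> may be frozen at the
  limit. Applied to the linear term of \<open>Qu\<close>, it turns the \<open>Quu\<close> part into
  \<open>du\<close> and the \<open>Qxu\<close> part into the gain applied to \<open>dx\<close>, up
  to sign.\<close>

lemma first_order_ell: "first_order (\<lambda>l. ell P (U l) k) 0 (\<lambda>l. - du' k l)"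
proof -
  let ?Q = "Quu P Us k"
  have main: "- du' k l = - (matrix_inv ?Q *v (transpose (Qxu P Us k) *v dx k l + ?Q *v du k l))" for l
    unfolding Sigma_gain_def Sigma_of_def Quu_def[symmetric]
    using matrix_inv_left[OF pos_def_imp_invertible[OF Quu_star[OF k]]]
    by (simp add: matrix_vector_right_distrib matrix_vector_mul_assoc
        bounded_bilinear.minus_left[OF bounded_bilinear_matrix_vector_mult] del: transpose_matrix_vector)
  have "first_order (\<lambda>l. Qu P (U l) k) 0 (\<lambda>l. transpose (Qxu P Us k) *v dx k l + ?Q *v du k l)"
    using first_order_Qu[OF k Vx' Vxx'] by (simp only: Qu_star[OF k])
  from first_order_minus[OF first_order_bilinear_null[OF bounded_bilinear_matrix_vector_mult approx_Quu_inv this]]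
  show ?thesis
    unfolding main ell_def ell_of_def Quu_def[symmetric] by simp
qed

text \<open>The control deviations cancel: \<open>Qxu *v du\<close> from \<open>Qx\<close> against
  \<open>Qxu *v (- du)\<close> from \<open>ell\<close>. What remains is
  \<open>Qxx + Qxu ** Sigma_gain\<close> applied to \<open>dx\<close>, that is,
  \<open>Vxx\<close>.\<close>

lemma first_order_Vx: "first_order (\<lambda>l. Vx P (U l) k) (Vx P Us k) (\<lambda>l. Vxx P Us k *v dx k l)"
proof (rule first_order_cong_ev)
  show "\<forall>\<^sub>F l in F. Vx P (U l) k = Qx P (U l) k + Qxu P (U l) k *v ell P (U l) k"
    using Quu_pos_def[OF k] by eventually_elim (rule value_step[OF k])
  note * = first_order_add[OF first_order_Qx[OF k Vx' Vxx']
      first_order_bilinear_null[OF bounded_bilinear_matrix_vector_mult approx_Qxu[OF k Vx' Vxx'] first_order_ell]]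
  show "first_order (\<lambda>l. Qx P (U l) k + Qxu P (U l) k *v ell P (U l) k) (Vx P Us k) (\<lambda>l. Vxx P Us k *v dx k l)"
    by (rule first_order_cong[OF *])
       (simp_all add: Vx_star[OF k Qu_star[OF k]] value_step(2)[OF k Quu_star[OF k]] matrix_vector_mult_add_rdistrib
         matrix_vector_mult_diff_distrib matrix_vector_mul_assoc)
qed

lemma approx_Vxx: "approx (\<lambda>l. Vxx P (U l) k) (Vxx P Us k)"
proof (rule approx_cong)
  show "\<forall>\<^sub>F l in F. Vxx P (U l) k = Qxx P (U l) k + Qxu P (U l) k ** Sigma_gain P (U l) k"
    using Quu_pos_def[OF k] by eventually_elim (rule value_step[OF k])
  show "approx (\<lambda>l. Qxx P (U l) k + Qxu P (U l) k ** Sigma_gain P (U l) k) (Vxx P Us k)"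
    unfolding value_step(2)[OF k Quu_star[OF k]]
    by (intro approx_add approx_bilinear[OF bounded_bilinear_matrix_matrix_mult]
        approx_Qxx[OF k Vx' Vxx'] approx_Qxu[OF k Vx' Vxx'] approx_Sigma)
qed

end

lemma value_expansions:
  "k \<le> steps P \<Longrightarrow>
    first_order (\<lambda>l. Vx P (U l) k) (Vx P Us k) (\<lambda>l. Vxx P Us k *v dx k l) \<and>
    approx (\<lambda>l. Vxx P (U l) k) (Vxx P Us k)"
proof (induction k rule: inc_induct)
  case base
  note args = bivariate_final approx_states[OF order_refl] approx_const[of uf]
  show ?case
    using first_order_grad_x[OF args] approx_hess_x[OF args] by (simp add: value_final)
next
  case (step k)
  then show ?case using first_order_Vx[of k] approx_Vxx[of k] by blast
qed

lemma
  assumes "k < steps P"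
  shows ell_expansion: "first_order (\<lambda>l. ell P (U l) k) 0 (\<lambda>l. - du' k l)"
    and Sigma_expansion: "approx (\<lambda>l. Sigma_gain P (U l) k) (Sigma_gain P Us k)"
  using value_expansions[of "Suc k"] first_order_ell[OF assms] approx_Sigma[OF assms] assms by auto

sublocale ocp_scale P Us uf F e ..

text \<open>With y the new state deviation, the new control deviation is \<open>ell + du'\<close>,
  plus the current gain applied to y, minus the gain error applied to \<open>dx\<close>. The first
  is of order 2 by \<open>ell_expansion\<close>, the last is a product of two factors of order 1,
  and the middle one has the order of y, as \<open>bigO_trajectory\<close> permits.\<close>

lemma new_controls_quadratic:
  assumes "k < steps P"
  shows "bigO 2 (\<lambda>l. new_controls P (U l) 1 k - Us k)"
proof (rule bigO_trajectory(2)[where V = "\<lambda>l. new_controls P (U l) 1", OF _ _ _ assms])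
  fix k assume k: "k < steps P" and x: "bigO 2 (\<lambda>l. states P (new_controls P (U l) 1) k - xs k)"
  let ?S = "Sigma_gain P Us k" and ?Sl = "\<lambda>l. Sigma_gain P (U l) k"
  let ?y = "\<lambda>l. states P (new_controls P (U l) 1) k - xs k"
  have S: "bigO 1 (\<lambda>l. ?Sl l - ?S)" using Sigma_expansion[OF k] by (simp add: approx_def)
  have 1: "bigO 2 (\<lambda>l. ell P (U l) k + du' k l)"
    by (rule bigO_eq[OF conjunct2[OF ell_expansion[OF k, unfolded first_order_def]]]) simp
  have 2: "bigO 2 (\<lambda>l. ?Sl l *v ?y l)"
    using bigO_bilinear[OF bounded_bilinear_matrix_vector_mult approx_bounded[OF Sigma_expansion[OF k]] x]
    by (simp add: numeral_2_eq_2)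
  have 3: "bigO 2 (\<lambda>l. (?Sl l - ?S) *v dx k l)"
    using bigO_bilinear[OF bounded_bilinear_matrix_vector_mult S bigO_dx[of k]] k
    by (simp add: numeral_2_eq_2)
  show "bigO 2 (\<lambda>l. new_controls P (U l) 1 k - Us k)"
    by (rule bigO_eq[OF bigO_diff[OF bigO_add[OF 1 2] 3]])
       (simp add: new_controls_def feedback_def states_new_controls[symmetric] matrix_vector_mult_diff_distrib
         bounded_bilinear.diff_left[OF bounded_bilinear_matrix_vector_mult])
qed auto

end


section \<open>Quadratic convergence\<close>

lemma norm_le_control_norm: "k < n \<Longrightarrow> norm (V k) \<le> control_norm n V"
  unfolding control_norm_def by (rule member_le_L2_set) auto

lemma control_norm_le_sum: "control_norm n V \<le> (\<Sum>k<n. norm (V k))"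
  unfolding control_norm_def by (rule L2_set_le_sum) simp

lemma control_norm_nonneg: "0 \<le> control_norm n V"
  by (simp add: control_norm_def)

lemma control_norm_cong: "(\<And>k. k < n \<Longrightarrow> V k = V' k) \<Longrightarrow> control_norm n V = control_norm n V'"
  unfolding control_norm_def by (auto intro!: L2_set_cong)

lemma stationary_point_cong:
  assumes "\<And>k. k < steps P \<Longrightarrow> V k = V' k"
  shows "stationary_point P V \<longleftrightarrow> stationary_point P V'"
proof -
  have "total_cost P (V(k := v)) = total_cost P (V'(k := v))" for k v
    using assms by (intro total_cost_cong) auto
  then show ?thesis using assms by (simp add: stationary_point_def)
qed

lemma times_differentiable_at_imp_isCont:
  assumes "times_differentiable_at (Suc n) f z"
  shows "isCont f z"
proof (cases n)
  case (Suc m)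
  then have "\<forall>\<^sub>F y in nhds z. f differentiable (at y)" using assms by simp
  then have "f differentiable (at z)" by (rule eventually_nhds_x_imp_x)
  then show ?thesis by (rule differentiable_imp_continuous_within)
qed (use assms in \<open>auto intro: differentiable_imp_continuous_within\<close>)

context asymptotic_scale
begin

lemma bigO_control_norm:
  assumes "\<And>k. k < n \<Longrightarrow> bigO r (\<lambda>l. V l k)"
  shows "bigO r (\<lambda>l. control_norm n (V l))"
proof (rule bigO_dominated[where K = 1])
  show "bigO r (\<lambda>l. \<Sum>k<n. norm (V l k))"
    by (intro bigO_sum bigO_norm assms) simp
  show "\<forall>\<^sub>F l in F. norm (control_norm n (V l)) \<le> 1 * norm (\<Sum>k<n. norm (V l k))"
    using control_norm_le_sum by (auto intro!: always_eventually order_trans[OF _ abs_ge_self] simp: control_norm_nonneg)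
qed

end

context control_family
begin

lemma cost_expansion:
  assumes "\<And>k. k < steps P \<Longrightarrow> Qu P Us k = 0"
  shows "bigO 3 (\<lambda>l. total_cost P (U l) - total_cost P Us - (\<Sum>k<steps P. du' k l \<bullet> (Quu P Us k *v du' k l)) / 2)"
  using cost_gap_expansion[of 0] assms by (simp add: total_cost_diff atLeast0LessThan)

lemma coercive:
  assumes e: "\<And>l. e l = control_norm (steps P) (\<lambda>k. du k l)"
  obtains a where "a > 0" "\<forall>\<^sub>F l in F. a * (e l)\<^sup>2 \<le> (\<Sum>k<steps P. du' k l \<bullet> (Quu P Us k *v du' k l))"
proof -
  define \<omega> where "\<omega> l = control_norm (steps P) (\<lambda>k. du' k l)" for l
  have "bigO 1 \<omega>"
    unfolding \<omega>_def by (intro bigO_control_norm bigO_du')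
  then have \<omega>_lim: "(\<omega> \<longlongrightarrow> 0) F"
    using bigO_imp_tendsto[of 0 \<omega>] by simp
  \<comment> \<open>In the scale \<open>\<omega>\<close> the deviations \<open>du'\<close> are of order 1, hence so are \<open>du\<close> and thus \<open>e\<close>.\<close>
  interpret w: ocp_scale P Us uf F \<omega>
    by unfold_locales (use \<omega>_lim in \<open>auto simp: \<omega>_def control_norm_nonneg\<close>)
  have "w.bigO 1 (du k)" if "k < steps P" for k
  proof (rule w.bigO_trajectory(2)[OF _ _ _ that])
    fix k assume k: "k < steps P" and x: "w.bigO 1 (dx k)"
    have "w.bigO 1 (du' k)"
      by (rule w.bigOI[where C = 1])
        (use norm_le_control_norm[OF k, of "\<lambda>k. du' k _"] in \<open>auto simp: \<omega>_def\<close>)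
    then show "w.bigO 1 (du k)"
      by (rule w.bigO_eq[OF w.bigO_add[OF _ w.bigO_matrix[OF x]]]) simp
  qed auto
  then have "w.bigO 1 e"
    unfolding e by (rule w.bigO_control_norm)
  then obtain C where C: "C \<ge> 0" "\<forall>\<^sub>F l in F. norm (e l) \<le> C * \<omega> l ^ 1"
    by (rule w.bigOE)
  have "\<forall>k. \<exists>m. k < steps P \<longrightarrow> m > 0 \<and> (\<forall>v. m * (norm v)\<^sup>2 \<le> v \<bullet> (Quu P Us k *v v))"
  proof
    fix k
    show "\<exists>m. k < steps P \<longrightarrow> m > 0 \<and> (\<forall>v. m * (norm v)\<^sup>2 \<le> v \<bullet> (Quu P Us k *v v))"
    proof (cases "k < steps P")
      case True
      from pos_def_lower_bound[OF Quu_star[OF this]] show ?thesis by blast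
    qed simp
  qed
  from choice[OF this] obtain m where m: "\<forall>k. k < steps P \<longrightarrow> m k > 0 \<and>
      (\<forall>v. m k * (norm v)\<^sup>2 \<le> v \<bullet> (Quu P Us k *v v))"
    by (elim exE)
  \<comment> \<open>The inserted 1 keeps the minimum defined when there are no stages.\<close>
  define \<mu> where "\<mu> = Min (insert 1 (m ` {..<steps P}))"
  have \<mu>: "\<mu> > 0" "\<And>k. k < steps P \<Longrightarrow> \<mu> \<le> m k"
    using m by (auto simp: \<mu>_def)
  show thesis
  proof
    \<comment> \<open>From \<mu> times the square of \<omega> and
      \<open>e \<le> (C + 1) * \<omega>\<close>; \<open>C + 1\<close> replaces \<open>C\<close>,
      which may be 0.\<close>
    show "\<mu> / (C + 1)\<^sup>2 > 0" using \<mu> C by simp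
    show "\<forall>\<^sub>F l in F. \<mu> / (C + 1)\<^sup>2 * (e l)\<^sup>2 \<le> (\<Sum>k<steps P. du' k l \<bullet> (Quu P Us k *v du' k l))"
      using C(2)
    proof eventually_elim
      case (elim l)
      have "0 \<le> e l" "0 \<le> \<omega> l" by (simp_all add: e \<omega>_def control_norm_nonneg)
      then have "e l \<le> (C + 1) * \<omega> l" using elim by (simp add: distrib_right)
      then have "(e l)\<^sup>2 \<le> ((C + 1) * \<omega> l)\<^sup>2" using \<open>0 \<le> e l\<close> by (rule power_mono)
      then have "\<mu> / (C + 1)\<^sup>2 * (e l)\<^sup>2 \<le> \<mu> * (\<omega> l)\<^sup>2"
        using \<mu>(1) C(1) by (simp add: power_mult_distrib divide_simps mult_ac)
      also have "\<dots> = (\<Sum>k<steps P. \<mu> * (norm (du' k l))\<^sup>2)"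
        by (simp add: \<omega>_def control_norm_def L2_set_def sum_nonneg sum_distrib_left)
      also have "\<dots> \<le> (\<Sum>k<steps P. du' k l \<bullet> (Quu P Us k *v du' k l))"
      proof (intro sum_mono)
        fix k assume "k \<in> {..<steps P}"
        then have k: "k < steps P" by simp
        have "\<mu> * (norm (du' k l))\<^sup>2 \<le> m k * (norm (du' k l))\<^sup>2"
          using \<mu>(2)[OF k] by (rule mult_right_mono) simp
        also have "\<dots> \<le> du' k l \<bullet> (Quu P Us k *v du' k l)"
          using m k by blast
        finally show "\<mu> * (norm (du' k l))\<^sup>2 \<le> du' k l \<bullet> (Quu P Us k *v du' k l)" .
      qed
      finally show ?case .
    qed
  qed
qed

end

context ddp_family
begin

text \<open>The excess cost is at least a positive multiple of e^2 before the step and O(e^3) after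
  it. The guard \<open>e l > 0\<close> excludes iterates that coincide with the limit.\<close>

lemma full_step_decreases_cost:
  assumes e: "\<And>l. e l = control_norm (steps P) (\<lambda>k. du k l)"
  shows "\<forall>\<^sub>F l in F. e l > 0 \<longrightarrow> total_cost P (new_controls P (U l) 1) < total_cost P (U l)"
proof -
  obtain a where a: "a > 0" "\<forall>\<^sub>F l in F. a * (e l)\<^sup>2 \<le> (\<Sum>k<steps P. du' k l \<bullet> (Quu P Us k *v du' k l))"
    using coercive[OF e] by blast
  obtain C1 where C1: "C1 \<ge> 0" "\<forall>\<^sub>F l in F. norm (total_cost P (U l) - total_cost P Us
      - (\<Sum>k<steps P. du' k l \<bullet> (Quu P Us k *v du' k l)) / 2) \<le> C1 * e l ^ 3"
    using bigOE[OF cost_expansion[OF Qu_star]] by blast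
  \<comment> \<open>The updated controls approach the limit too, so the same cost expansion holds
    for them. Their quadratic terms are of order 4; what remains is the remainder of order 3 in the
    old scale.\<close>
  interpret new: control_family P Us uf F e "\<lambda>l. new_controls P (U l) 1"
    by unfold_locales (use bigO_mono[OF new_controls_quadratic, of _ 1] in \<open>simp add: approx_def\<close>)
  have x: "bigO 2 (new.dx k)" if "k \<le> steps P" for k
    by (rule bigO_trajectory(1)[OF _ _ new_controls_quadratic that]) auto
  have du': "bigO 2 (new.du' k)" if "k < steps P" for k
    using that by (intro bigO_diff new_controls_quadratic bigO_matrix x) auto
  have quad: "bigO 3 (\<lambda>l. (1 / 2) *\<^sub>R (\<Sum>k<steps P. new.du' k l \<bullet> (Quu P Us k *v new.du' k l)))"
  proof (intro bigO_bounded_linear[OF bounded_linear_scaleR_right] bigO_sum)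
    fix k assume "k \<in> {..<steps P}"
    then have "bigO (2 + 2) (\<lambda>l. new.du' k l \<bullet> (Quu P Us k *v new.du' k l))"
      by (intro bigO_quadratic du') auto
    then show "bigO 3 (\<lambda>l. new.du' k l \<bullet> (Quu P Us k *v new.du' k l))"
      by (rule bigO_mono) simp
  qed
  have "bigO 3 (\<lambda>l. total_cost P (new_controls P (U l) 1) - total_cost P Us)"
    by (rule bigO_eq[OF bigO_add[OF new.cost_expansion[OF Qu_star] quad]]) simp_all
  then obtain C2 where C2: "C2 \<ge> 0"
      "\<forall>\<^sub>F l in F. norm (total_cost P (new_controls P (U l) 1) - total_cost P Us) \<le> C2 * e l ^ 3"
    by (rule bigOE)
  \<comment> \<open>Below this threshold both cubic errors together stay under half of the quadratic
    gain \<open>a * e^2\<close>.\<close>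
  have "\<forall>\<^sub>F l in F. e l < a / (2 * (C1 + C2 + 1))"
    using a(1) C1(1) C2(1) by (intro order_tendstoD(2)[OF e_tendsto]) simp
  then show ?thesis
    using a(2) C1(2) C2(2)
  proof eventually_elim
    case (elim l)
    show ?case
    proof
      assume pos: "e l > 0"
      have "(C1 + C2) * e l < a / 2"
      proof -
        have "(C1 + C2 + 1) * e l < a / 2"
          using elim(1) C1(1) C2(1) by (simp add: field_simps)
        with pos show ?thesis by (simp add: distrib_right)
      qed
      then have "(C1 + C2) * e l * (e l)\<^sup>2 < a / 2 * (e l)\<^sup>2"
        using pos by (intro mult_strict_right_mono) auto
      then have "C1 * e l ^ 3 + C2 * e l ^ 3 < a * (e l)\<^sup>2 / 2"
        by (simp add: power2_eq_square power3_eq_cube algebra_simps)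
      then show "total_cost P (new_controls P (U l) 1) < total_cost P (U l)"
        using elim(2-4) by (simp add: abs_le_iff)
    qed
  qed
qed

end

theorem mainTheorem2:
  fixes M :: "'w measure"
    and \<xi> :: "'w \<Rightarrow> real^'d"
    and D :: "(real^'d) set"
    and \<rho> :: "real^'d \<Rightarrow> real"
    and \<phi> :: "'k::finite \<Rightarrow> real^'d \<Rightarrow> real"
    and f :: "real^'n \<Rightarrow> real^'m \<Rightarrow> real \<Rightarrow> real^'d \<Rightarrow> real^'n"
    and \<Phi> :: "(real^('n \<times> 'k) \<Rightarrow> real^'m \<Rightarrow> real \<Rightarrow> real^('n \<times> 'k)) \<Rightarrow>
               real \<Rightarrow> real \<Rightarrow> real^('n \<times> 'k) \<Rightarrow> real^'m \<Rightarrow> real^('n \<times> 'k)"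
    and t0 \<Delta>t :: real
    and Kf :: nat
    and X0 :: "real^('n \<times> 'k)"
    and L :: "real^('n \<times> 'k) \<Rightarrow> real^'m \<Rightarrow> real \<Rightarrow> real"
    and F :: "real^('n \<times> 'k) \<Rightarrow> real \<Rightarrow> real"
    and P :: "(real^('n \<times> 'k), real^'m) ocp"
    and R :: "((real^('n \<times> 'k)) \<times> (real^'m)) set"
    and U :: "nat \<Rightarrow> nat \<Rightarrow> real^'m"
    and Ustar :: "nat \<Rightarrow> real^'m"
  assumes random: "random_vector_with_density M \<xi> D \<rho>"
    and basis: "orthogonal_polynomials D \<rho> \<phi>"
    and discretization: "one_step_method \<Phi>"
    and time_step: "\<Delta>t > 0"
    and problem: "P = gpc_ocp D \<rho> \<phi> f \<Phi> t0 \<Delta>t Kf X0 L F"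
    and R_compact_convex: "compact R" "convex R"
    and smooth_dynamics: "\<And>k z. k < Kf \<Longrightarrow> z \<in> R \<Longrightarrow>
          times_differentiable_at 3 (\<lambda>(x, u). dyn P k x u) z"
    and smooth_stage_cost: "\<And>k z. k < Kf \<Longrightarrow> z \<in> R \<Longrightarrow>
          times_differentiable_at 3 (\<lambda>(x, u). stage_cost P k x u) z"
    and smooth_final_cost: "\<And>z. z \<in> R \<Longrightarrow>
          times_differentiable_at 3 (\<lambda>(x, u). final_cost P x) z"
    and iteration: "\<And>l. ddp_step P (U l) (U (Suc l))"
    and in_R: "\<And>l k. k < Kf \<Longrightarrow> (states P (U l) k, U l k) \<in> R"
    and in_R_final: "\<And>l. \<exists>u. (states P (U l) Kf, u) \<in> R"
    and Quu_pos_def: "\<And>W k. W \<in> insert Ustar (range U) \<Longrightarrow> k < Kf \<Longrightarrow> pos_def (Quu P W k)"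
    and stationary: "stationary_point P Ustar"
    and convergence: "(\<lambda>l. control_norm Kf (\<lambda>k. U l k - Ustar k)) \<longlonglongrightarrow> 0"
  shows "\<exists>c>0. \<exists>l0\<ge>1. \<forall>l\<ge>l0.
           control_norm Kf (\<lambda>k. U l k - Ustar k)
             \<le> c * (control_norm Kf (\<lambda>k. U (l - 1) k - Ustar k))\<^sup>2"
proof -
  have steps: "steps P = Kf" by (simp add: problem gpc_ocp_def)
  define e where "e l = control_norm Kf (\<lambda>k. U l k - Ustar k)" for l
  have e_lim: "e \<longlonglongrightarrow> 0" using convergence unfolding e_def[abs_def] .
  have du: "norm (U l k - Ustar k) \<le> e l" if "k < Kf" for l k
    using norm_le_control_norm[OF that, of "\<lambda>k. U l k - Ustar k"] by (simp add: e_def)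
  have U_lim: "(\<lambda>l. U l k) \<longlonglongrightarrow> Ustar k" if "k < Kf" for k
    by (rule LIM_zero_cancel, rule Lim_null_comparison[OF _ e_lim]) (simp add: du that)
  have star_in_R: "(states P Ustar k, Ustar k) \<in> R"
    if "k < Kf" "(\<lambda>l. states P (U l) k) \<longlonglongrightarrow> states P Ustar k" for k
    using compact_imp_closed[OF R_compact_convex(1)]
    by (rule closed_sequentially) (use that in_R U_lim in \<open>auto intro!: tendsto_Pair\<close>)
  \<comment> \<open>Interleaved with \<open>star_in_R\<close>: convergence at stage \<open>k\<close>
    puts the limit pair into the closed set \<open>R\<close>, where the dynamics are continuous, and
    this gives convergence at the next stage.\<close>
  have X_lim: "(\<lambda>l. states P (U l) k) \<longlonglongrightarrow> states P Ustar k" if "k \<le> Kf" for k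
    using that
  proof (induction k)
    case (Suc k)
    then have k: "k < Kf" and X: "(\<lambda>l. states P (U l) k) \<longlonglongrightarrow> states P Ustar k" by auto
    have "isCont (\<lambda>(x, u). dyn P k x u) (states P Ustar k, Ustar k)"
      using smooth_dynamics[OF k star_in_R[OF k X]]
      by (intro times_differentiable_at_imp_isCont[where n = 2]) (simp add: eval_nat_numeral)
    from isCont_tendsto_compose[OF this tendsto_Pair[OF X U_lim[OF k]]] show ?case by simp
  qed simp
  \<comment> \<open>At the final stage only some control completes the state to a point of
    \<open>R\<close>, and these controls need not converge; projecting the compact \<open>R\<close>
    to the states avoids them and yields \<open>uf\<close>.\<close>
  have "closed (fst ` R)"
    by (intro compact_imp_closed compact_continuous_image R_compact_convex(1) continuous_intros)
  then have "states P Ustar Kf \<in> fst ` R"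
    by (rule closed_sequentially[OF _ _ X_lim[OF order_refl]]) (use in_R_final in force)
  then obtain uf where uf: "(states P Ustar Kf, uf) \<in> R" by auto
  interpret regular_ocp P Ustar uf
    by unfold_locales
      (auto simp: steps intro!: smooth_dynamics smooth_stage_cost smooth_final_cost star_in_R X_lim uf Quu_pos_def)
  interpret asymptotic_scale sequentially e
    by unfold_locales (simp_all add: e_lim e_def control_norm_nonneg)
  interpret ddp_family P Ustar uf sequentially e U
  proof unfold_locales
    fix k assume k: "k < steps P"
    show "approx (\<lambda>l. U l k) (Ustar k)"
      unfolding approx_def by (rule bigOI[where C = 1]) (use k du in \<open>simp add: steps\<close>)
    show "\<forall>\<^sub>F l in sequentially. pos_def (Quu P (U l) k)"
      using k Quu_pos_def by (simp add: steps)
    show "Qu P Ustar k = 0"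
      by (rule stationary_imp_Qu_eq_0[OF stationary k])
  qed
  \<comment> \<open>A stationary iterate freezes all later ones, so the sequence is eventually
    constant and its limit is that iterate.\<close>
  have stationary_iterate: "e l = 0" if stat: "stationary_point P (U l)" for l
  proof -
    have const: "\<forall>k<Kf. U (l + m) k = U l k" for m
    proof (induction m)
      case (Suc m)
      then have "stationary_point P (U (l + m))"
        using stationary_point_cong[of P "U (l + m)" "U l"] stat by (simp add: steps)
      then show ?case using iteration[of "l + m"] Suc by (simp add: ddp_step_def steps)
    qed simp
    have "e (m + l) = e l" for m
      unfolding e_def by (rule control_norm_cong) (use const[of m] in \<open>simp add: add.commute\<close>)
    then show ?thesis
      using LIMSEQ_ignore_initial_segment[OF e_lim, of l] by (simp add: LIMSEQ_const_iff)
  qed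
  have "bigO 2 (\<lambda>l. control_norm Kf (\<lambda>k. new_controls P (U l) 1 k - Ustar k))"
    using new_controls_quadratic by (intro bigO_control_norm) (simp add: steps)
  then obtain c where c: "c \<ge> 0"
      "\<forall>\<^sub>F l in sequentially. norm (control_norm Kf (\<lambda>k. new_controls P (U l) 1 k - Ustar k)) \<le> c * (e l)\<^sup>2"
    by (rule bigOE)
  \<comment> \<open>\<open>c\<close> may be 0, while the claim asks for a positive constant.\<close>
  have "\<forall>\<^sub>F l in sequentially. e (Suc l) \<le> (c + 1) * (e l)\<^sup>2"
    using c(2) full_step_decreases_cost[unfolded steps, OF e_def]
  proof eventually_elim
    case (elim l)
    have le: "c * (e l)\<^sup>2 \<le> (c + 1) * (e l)\<^sup>2" by (intro mult_right_mono) auto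
    show ?case
    proof (cases "stationary_point P (U l)")
      case True
      then have "e (Suc l) = e l"
        unfolding e_def using iteration[of l]
        by (intro control_norm_cong) (simp add: ddp_step_def steps)
      then show ?thesis using stationary_iterate[OF True] by simp
    next
      case False
      \<comment> \<open>Stationarity depends only on the controls before \<open>Kf\<close>, so an
        iterate at distance 0 would be stationary like the limit.\<close>
      have "e l \<noteq> 0"
      proof
        assume "e l = 0"
        then have "U l k = Ustar k" if "k < Kf" for k using du[OF that, of l] by simp
        then show False using stationary_point_cong[of P "U l" Ustar] stationary False by (simp add: steps)
      qed
      then have dec: "total_cost P (new_controls P (U l) 1) < total_cost P (U l)"
        using elim(2) by (simp add: e_def control_norm_nonneg order_less_le)
      obtain \<gamma> where \<gamma>: "line_search_result P (U l) \<gamma>" "\<forall>k<Kf. U (Suc l) k = new_controls P (U l) \<gamma> k"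
        using iteration[of l] False by (auto simp: ddp_step_def steps)
      obtain g :: "nat \<Rightarrow> real" and r where g: "g 0 = 1" "\<gamma> = g r"
          "\<forall>i<r. \<not> total_cost P (new_controls P (U l) (g i)) < total_cost P (U l)"
        using \<gamma>(1) unfolding line_search_result_def by blast
      \<comment> \<open>The trial value at index 0 is 1 and already decreases the cost, whereas
        every index before \<open>r\<close> was rejected.\<close>
      have "r = 0" using g dec by (metis gr0I)
      then have "e (Suc l) = control_norm Kf (\<lambda>k. new_controls P (U l) 1 k - Ustar k)"
        unfolding e_def using \<gamma>(2) g by (intro control_norm_cong) simp
      then show ?thesis using elim(1) le by simp
    qed
  qed
  then obtain N where N: "\<And>l. l \<ge> N \<Longrightarrow> e (Suc l) \<le> (c + 1) * (e l)\<^sup>2"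
    by (auto simp: eventually_sequentially)
  show ?thesis
  proof (intro exI conjI allI impI)
    show "c + 1 > 0" using c by simp
    show "Suc N \<ge> 1" by simp
    fix l assume "Suc N \<le> l"
    then show "control_norm Kf (\<lambda>k. U l k - Ustar k) \<le> (c + 1) * (control_norm Kf (\<lambda>k. U (l - 1) k - Ustar k))\<^sup>2"
      using N[of "l - 1"] by (simp add: e_def)
  qed
qed

end
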